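(* There is an absolute constant $C_z>0$ such that for every $\varepsilon>0$ the estimator $\hat Z$ of the minimizer (constructed in the context) satisfies $$\mathbb E_f|\hat Z-Z(f)|<53\,\rho_z(\varepsilon;f)\le C_z\,R_z(\varepsilon;f)\qquad\text{for all } f\in\mathcal F.$$
   Context: $\mathcal F$ is the collection of convex functions $f:[0,1]\to\mathbb R$ with a unique minimizer $Z(f)=\arg\min_{0\le t\le1}f(t)$; $M(f)=f(Z(f))$. One observes the white noise model $dY(t)=f(t)\,dt+\varepsilon\,dW(t)$, $0\le t\le1$, $W$ a standard Brownian motion, $\varepsilon>0$; $\mathbb E_f$ is expectation under drift $f$ (including auxiliary randomness). Benchmark: $R_z(\varepsilon;f)=\sup_{g\in\mathcal F}\inf_{\hat Z}\max_{h\in\{f,g\}}\mathbb E_h|\hat Z-Z(h)|$, infimum over all estimators based on $Y$. Geometric quantities: with $f_u(t)=\max\{f(t),u\}$ and $\|\cdot\|_2$ the $L_2[0,1]$ norm, $\rho_m(\varepsilon;f)=\sup\{u-M(f):\|f-f_u\|_2\le\varepsilon\}$ and $\rho_z(\varepsilon;f)=\sup\{|t-Z(f)|: f(t)\le\rho_m(\varepsilon;f)+M(f),\ t\in[0,1]\}$. Construction of $\hat Z$. Sample splitting: let $B_1,B_2$ be independent standard Brownian motions, independent of $Y$, and set $Y_l=Y+\frac{\sqrt2}{2}\varepsilon B_1+\frac{\sqrt6}{2}\varepsilon B_2$, $Y_s=Y+\frac{\sqrt2}{2}\varepsilon B_1-\frac{\sqrt6}{2}\varepsilon B_2$, $Y_e=Y-\sqrt2\,\varepsilon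 B_1$. Localization: $m_j=2^{-j}$, $t_{j,i}=i\,m_j$. For $j\ge0$, $1\le i\le2^j$ let $X_{j,i}=\int_{t_{j,i-1}}^{t_{j,i}}dY_l(t)$ and $\tilde X_{j,i}=\int_{t_{j,i-1}}^{t_{j,i}}dY_s(t)$; for integers $i\notin\{1,\dots,2^j\}$ set $X_{j,i}=\tilde X_{j,i}=+\infty$. Let $\hat i_0=1$ and, for $j\ge1$, $\hat i_j=\arg\min_{2\hat i_{j-1}-2\le i\le2\hat i_{j-1}+1}X_{j,i}$. Stopping: $T_j=\min\{\tilde X_{j,\hat i_j+6}-\tilde X_{j,\hat i_j+5},\ \tilde X_{j,\hat i_j-6}-\tilde X_{j,\hat i_j-5}\}$, with the convention $+\infty-x=+\infty$ and $\min\{+\infty,x\}=x$ for all $-\infty\le x\le\infty$. Let $\sigma_j^2=6m_j\varepsilon^2$ and $\hat j=\min\{j:T_j/\sigma_j\le2\}$. Estimator: $\hat Z=\frac12\big(t_{\hat j,\hat i_{\hat j}}+t_{\hat j,\hat i_{\hat j}-1}\big)$. *)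

theory Defs
  imports "HOL-Probability.Probability"
begin

section \<open>Convex functions on the unit interval\<close>

text \<open>Functions on [0,1] are total functions on the reals whose values outside [0,1] are never used.\<close>

definition convex_class :: "(real \<Rightarrow> real) set" where
  "convex_class = {f. convex_on {0..1} f \<and> (\<exists>!t. is_arg_min f (\<lambda>t. t \<in> {0..1}) t)}"

definition minimizer :: "(real \<Rightarrow> real) \<Rightarrow> real" where
  "minimizer f = arg_min_on f {0..1}"

definition min_value :: "(real \<Rightarrow> real) \<Rightarrow> real" where
  "min_value f = f (minimizer f)"

definition L2_norm01 :: "(real \<Rightarrow> real) \<Rightarrow> real" where
  "L2_norm01 g = sqrt (LINT t:{0..1}|lborel. (g t)\<^sup>2)"

definition rho_m :: "real \<Rightarrow> (real \<Rightarrow> real) \<Rightarrow> real" where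
  "rho_m \<epsilon> f = Sup {u - min_value f | u. L2_norm01 (\<lambda>t. f t - max (f t) u) \<le> \<epsilon>}"

definition rho_z :: "real \<Rightarrow> (real \<Rightarrow> real) \<Rightarrow> real" where
  "rho_z \<epsilon> f = Sup {\<bar>t - minimizer f\<bar> | t. t \<in> {0..1} \<and> f t \<le> rho_m \<epsilon> f + min_value f}"

section \<open>Brownian motion and the white noise model\<close>

definition standard_brownian_motion :: "'w measure \<Rightarrow> (real \<Rightarrow> 'w \<Rightarrow> real) \<Rightarrow> bool" where
  "standard_brownian_motion \<Omega> W \<longleftrightarrow>
     prob_space \<Omega> \<and>
     (\<forall>t\<in>{0..1}. W t \<in> borel_measurable \<Omega>) \<and>
     (AE \<omega> in \<Omega>. W 0 \<omega> = 0) \<and>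
     (\<forall>s\<in>{0..1}. \<forall>t\<in>{0..1}. s < t \<longrightarrow>
        distributed \<Omega> lborel (\<lambda>\<omega>. W t \<omega> - W s \<omega>) (normal_density 0 (sqrt (t - s)))) \<and>
     (\<forall>n (t :: nat \<Rightarrow> real). (\<forall>i\<le>n. t i \<in> {0..1}) \<and> (\<forall>i<n. t i < t (Suc i)) \<longrightarrow>
        prob_space.indep_vars \<Omega> (\<lambda>_. borel) (\<lambda>i \<omega>. W (t (Suc i)) \<omega> - W (t i) \<omega>) {..<n}) \<and>
     (AE \<omega> in \<Omega>. continuous_on {0..1} (\<lambda>t. W t \<omega>))"

text \<open>Three mutually independent standard Brownian motions, independence being that of whole
  paths.  Since the drift is deterministic, independence of \<open>W\<close> is the same as independence of \<open>Y\<close>.\<close>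

definition independent_brownian_motions ::
  "'w measure \<Rightarrow> (real \<Rightarrow> 'w \<Rightarrow> real) \<Rightarrow> (real \<Rightarrow> 'w \<Rightarrow> real) \<Rightarrow> (real \<Rightarrow> 'w \<Rightarrow> real) \<Rightarrow> bool" where
  "independent_brownian_motions \<Omega> W B1 B2 \<longleftrightarrow>
     standard_brownian_motion \<Omega> W \<and>
     standard_brownian_motion \<Omega> B1 \<and>
     standard_brownian_motion \<Omega> B2 \<and>
     prob_space.indep_vars \<Omega> (\<lambda>_. PiM {0..1} (\<lambda>_. borel))
       (\<lambda>k \<omega>. \<lambda>t\<in>{0..1}. ([W, B1, B2] ! k) t \<omega>) {..<3}"

text \<open>The white noise path with drift \<open>f\<close>, driven by a Brownian path \<open>w\<close>.\<close>

definition white_noise :: "real \<Rightarrow> (real \<Rightarrow> real) \<Rightarrow> (real \<Rightarrow> real) \<Rightarrow> real \<Rightarrow> real" where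
  "white_noise \<epsilon> f w t = (LINT s:{0..t}|lborel. f s) + \<epsilon> * w t"

section \<open>The benchmark\<close>

text \<open>The sample space C[0,1], with the sigma-algebra generated by the evaluations; its points are
  \<open>undefined\<close> outside [0,1].\<close>

definition path_space :: "(real \<Rightarrow> real) measure" where
  "path_space = restrict_space (PiM {0..1} (\<lambda>_. borel)) {w. continuous_on {0..1} w}"

definition wiener_measure :: "(real \<Rightarrow> real) measure \<Rightarrow> bool" where
  "wiener_measure P \<longleftrightarrow>
     sets P = sets path_space \<and> standard_brownian_motion P (\<lambda>t w. w t)"

definition white_noise_law ::
  "(real \<Rightarrow> real) measure \<Rightarrow> real \<Rightarrow> (real \<Rightarrow> real) \<Rightarrow> (real \<Rightarrow> real) measure" where
  "white_noise_law P \<epsilon> f = distr P path_space (\<lambda>w. \<lambda>t\<in>{0..1}. white_noise \<epsilon> f w t)"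

text \<open>Estimators are functions of the observed path and of an auxiliary variable, independent of
  the path and uniform on [0,1].\<close>

definition estimators :: "((real \<Rightarrow> real) \<times> real \<Rightarrow> real) set" where
  "estimators = borel_measurable (path_space \<Otimes>\<^sub>M borel)"

definition risk ::
  "(real \<Rightarrow> real) measure \<Rightarrow> real \<Rightarrow> ((real \<Rightarrow> real) \<times> real \<Rightarrow> real) \<Rightarrow> (real \<Rightarrow> real) \<Rightarrow> ennreal" where
  "risk P \<epsilon> \<delta> h =
     (\<integral>\<^sup>+ x. ennreal \<bar>\<delta> x - minimizer h\<bar>
        \<partial>(white_noise_law P \<epsilon> h \<Otimes>\<^sub>M uniform_measure lborel {0..1}))"

definition benchmark_z :: "(real \<Rightarrow> real) measure \<Rightarrow> real \<Rightarrow> (real \<Rightarrow> real) \<Rightarrow> ennreal" where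
  "benchmark_z P \<epsilon> f =
     (SUP g\<in>convex_class. INF \<delta>\<in>estimators. max (risk P \<epsilon> \<delta> f) (risk P \<epsilon> \<delta> g))"

section \<open>The estimator\<close>

definition mesh :: "nat \<Rightarrow> real" where
  "mesh j = (1 / 2) ^ j"

definition grid :: "nat \<Rightarrow> int \<Rightarrow> real" where
  "grid j i = of_int i * mesh j"

definition grid_increment :: "(real \<Rightarrow> real) \<Rightarrow> nat \<Rightarrow> int \<Rightarrow> ereal" where
  "grid_increment y j i =
     (if 1 \<le> i \<and> i \<le> 2 ^ j then ereal (y (grid j i) - y (grid j (i - 1))) else \<infinity>)"

text \<open>Ties in the argmin have probability zero; they are broken arbitrarily.\<close>

primrec ihat :: "(real \<Rightarrow> real) \<Rightarrow> nat \<Rightarrow> int" where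
  "ihat yl 0 = 1"
| "ihat yl (Suc j) =
     arg_min_on (grid_increment yl (Suc j)) {2 * ihat yl j - 2 .. 2 * ihat yl j + 1}"

text \<open>On \<^typ>\<open>ereal\<close>, infinity minus anything, itself included, is infinity.\<close>

definition stop_stat :: "(real \<Rightarrow> real) \<Rightarrow> (real \<Rightarrow> real) \<Rightarrow> nat \<Rightarrow> ereal" where
  "stop_stat yl ys j =
     (let i = ihat yl j in
      min (grid_increment ys j (i + 6) - grid_increment ys j (i + 5))
          (grid_increment ys j (i - 6) - grid_increment ys j (i - 5)))"

definition stop_sd :: "real \<Rightarrow> nat \<Rightarrow> real" where
  "stop_sd \<epsilon> j = sqrt (6 * mesh j * \<epsilon>\<^sup>2)"

text \<open>The level set is nonempty almost surely; otherwise the value is immaterial.\<close>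

definition jhat :: "real \<Rightarrow> (real \<Rightarrow> real) \<Rightarrow> (real \<Rightarrow> real) \<Rightarrow> nat" where
  "jhat \<epsilon> yl ys = (LEAST j. stop_stat yl ys j / ereal (stop_sd \<epsilon> j) \<le> 2)"

definition zhat :: "real \<Rightarrow> (real \<Rightarrow> real) \<Rightarrow> (real \<Rightarrow> real) \<Rightarrow> real" where
  "zhat \<epsilon> yl ys =
     (let j = jhat \<epsilon> yl ys; i = ihat yl j in (grid j i + grid j (i - 1)) / 2)"

text \<open>The two copies of the observation used by the estimator, as functions of the observed path
  \<open>y\<close> and the auxiliary Brownian paths.\<close>

definition localization_copy ::
  "real \<Rightarrow> (real \<Rightarrow> real) \<Rightarrow> (real \<Rightarrow> real) \<Rightarrow> (real \<Rightarrow> real) \<Rightarrow> real \<Rightarrow> real" where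
  "localization_copy \<epsilon> y b1 b2 t = y t + sqrt 2 / 2 * \<epsilon> * b1 t + sqrt 6 / 2 * \<epsilon> * b2 t"

definition stopping_copy ::
  "real \<Rightarrow> (real \<Rightarrow> real) \<Rightarrow> (real \<Rightarrow> real) \<Rightarrow> (real \<Rightarrow> real) \<Rightarrow> real \<Rightarrow> real" where
  "stopping_copy \<epsilon> y b1 b2 t = y t + sqrt 2 / 2 * \<epsilon> * b1 t - sqrt 6 / 2 * \<epsilon> * b2 t"

definition minimizer_estimator ::
  "real \<Rightarrow> (real \<Rightarrow> real) \<Rightarrow> (real \<Rightarrow> real) \<Rightarrow> (real \<Rightarrow> real) \<Rightarrow> real" where
  "minimizer_estimator \<epsilon> y b1 b2 =
     zhat \<epsilon> (localization_copy \<epsilon> y b1 b2) (stopping_copy \<epsilon> y b1 b2)"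

end

theory Submission
  imports Defs
begin

text \<open>
  Write \<open>Z\<close>, \<open>M\<close> for the minimizer and the minimum of \<open>f\<close>, and \<open>\<mu>\<close>, \<open>\<rho>\<close> for \<open>rho_m\<close>, \<open>rho_z\<close>.  Convexity gives
  \<open>\<epsilon>\<^sup>2 \<le> 2 \<rho> \<mu>\<^sup>2\<close> and shows that \<open>f\<close> grows at rate at least \<open>\<mu> / \<rho>\<close> outside the level set.  Hence at a level
  whose mesh \<open>m\<close> exceeds \<open>\<rho>\<close> the increments of two cells on the same side of \<open>Z\<close> differ in mean by at
  least \<open>(m / \<rho>)\<^bsup>3/2\<^esup> / \<surd>12\<close> standard deviations, and Chebyshev's inequality with a union bound over
  the few relevant pairs of cells controls both a wrong localization and a premature stop.  An error
  first committed at mesh \<open>m\<close> costs at most \<open>6 m\<close>, since later steps move the center by at most \<open>3 m / 2\<close> in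
  total; stopping late is therefore harmless, provided that the procedure stops at all.  It
  does so almost surely: each level has only four times as many index paths as the previous one, the
  stopping statistics along a fixed path use disjoint cells and so are independent, and each exceeds
  its threshold with probability at most \<open>9/40 < 1/4\<close>.

  For the benchmark, cut \<open>f\<close> off below by a slightly tilted line.  This moves the minimizer by at least
  \<open>\<rho> / 2\<close> at \<open>L\<^sub>2\<close> cost of order \<open>\<epsilon>\<close>, so that the two white noise laws are quantitatively contiguous:
  on cylinder sets by the Gaussian likelihood ratio and the Cauchy-Schwarz inequality, and then on all
  measurable sets by approximation.
\<close>

section \<open>Convex functions\<close>

text \<open>Two inequalities between the radii carry everything:
  \<open>\<epsilon>\<^sup>2 \<le> 2 * \<rho> * \<mu>\<^sup>2\<close> for the upper bound and
  \<open>\<rho> * \<mu>\<^sup>2 \<le> 128 * \<epsilon>\<^sup>2\<close> for the lower one. The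
  exponent 3/2 turns into failure probabilities of order \<open>(\<rho> / m) ^ 3\<close>. Multiplied
  by a cost of order \<open>m\<close> they form a geometric series dominated by its finest level, so
  second moments are enough. That level \<open>N\<close> is taken with
  \<open>5 * \<rho> \<le> mesh N < 10 * \<rho>\<close>; for \<open>r = mesh N / \<rho>\<close> the
  total is \<open>\<rho> * (3 * r + 612 / r\<^sup>2)\<close>, which stays below
  \<open>53 * \<rho>\<close>. When \<open>5 * \<rho> > 1\<close> the trivial error bound 1 does it.
  The indices are random, but until localization fails they stay within one cell of the
  deterministic cell of the minimizer, so a fixed finite list of comparisons per level covers every
  case. In the lower bound the likelihood ratio at finitely many sampling times has second moment at
  most \<open>exp \<kappa>\<close>, where \<kappa> depends only on the L2 distance of the drifts.
  This uniformity in the sampling times is what lets the bound pass from cylinder sets to all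
  events.\<close>

lemma is_arg_min_minimizer:
  assumes "f \<in> convex_class"
  shows "is_arg_min f (\<lambda>t. t \<in> {0..1}) (minimizer f)"
proof -
  have "\<exists>t. is_arg_min f (\<lambda>t. t \<in> {0..1}) t"
    using assms unfolding convex_class_def by blast
  then show ?thesis
    unfolding minimizer_def arg_min_on_def arg_min_def by (rule someI_ex)
qed

lemma minimizer_eqI:
  assumes "f \<in> convex_class" "t \<in> {0..1}" "\<And>s. s \<in> {0..1} \<Longrightarrow> f t \<le> f s"
  shows "minimizer f = t"
proof -
  have "is_arg_min f (\<lambda>t. t \<in> {0..1}) t"
    using assms(2,3) by (force simp: is_arg_min_def)
  then show ?thesis
    using is_arg_min_minimizer[OF assms(1)] assms(1) unfolding convex_class_def by blast
qed

locale convex_fn =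
  fixes f :: "real \<Rightarrow> real"
  assumes in_class: "f \<in> convex_class"
begin

abbreviation "Z \<equiv> minimizer f"
abbreviation "M \<equiv> min_value f"

lemma convex: "convex_on {0..1} f"
  using in_class by (simp add: convex_class_def)

lemma Z_in: "Z \<in> {0..1}"
  using is_arg_min_minimizer[OF in_class] by (simp add: is_arg_min_def)

lemma Z_bounds: "0 \<le> Z" "Z \<le> 1"
  using Z_in by auto

lemma M_le: "t \<in> {0..1} \<Longrightarrow> M \<le> f t"
  using is_arg_min_minimizer[OF in_class] unfolding is_arg_min_def min_value_def
  by force

lemma f_Z: "f Z = M"
  by (simp add: min_value_def)

lemma M_less: "t \<in> {0..1} \<Longrightarrow> t \<noteq> Z \<Longrightarrow> M < f t"
proof -
  assume t: "t \<in> {0..1}" "t \<noteq> Z"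
  have "f t \<noteq> M"
    using minimizer_eqI[OF in_class t(1)] M_le t(2) by metis
  then show ?thesis using M_le[OF t(1)] by simp
qed

lemma chord:
  assumes "a \<in> {0..1}" "b \<in> {0..1}" "0 \<le> l" "l \<le> 1" "x = (1 - l) * a + l * b"
  shows "f x \<le> (1 - l) * f a + l * f b"
  using convex_onD[OF convex, of l a b] assms by simp

lemma chord_Z:
  assumes "y \<in> {0..1}" "0 \<le> l" "l \<le> 1" "x = Z + l * (y - Z)"
  shows "f x - M \<le> l * (f y - M)"
proof -
  have "f x \<le> (1 - l) * f Z + l * f y"
    using assms(4) by (intro chord[OF Z_in assms(1,2,3)]) (simp add: algebra_simps)
  then show ?thesis using f_Z by (simp add: algebra_simps)
qed

text \<open>\<open>chord_Z\<close> with \<open>l = 1 / c\<close>: along a ray from the minimizer the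
  excess over \<open>M\<close> grows at least proportionally, which is how level sets at different
  heights are compared.\<close>

lemma ge_scaled:
  assumes "y \<in> {0..1}" "1 \<le> c" "x - Z = (y - Z) / c"
  shows "c * (f x - M) \<le> f y - M"
proof -
  have "f x - M \<le> (1 / c) * (f y - M)"
    using assms by (intro chord_Z) (auto simp: field_simps)
  then show ?thesis using assms(2) by (simp add: field_simps)
qed

definition "fmax = max (f 0) (f 1)"

lemma f_le_fmax: "t \<in> {0..1} \<Longrightarrow> f t \<le> fmax"
proof -
  assume t: "t \<in> {0..1}"
  then have "f t \<le> (1 - t) * f 0 + t * f 1" by (intro chord) auto
  also have "\<dots> \<le> (1 - t) * fmax + t * fmax"
    using t unfolding fmax_def by (intro add_mono mult_left_mono) auto
  finally show ?thesis by (simp add: algebra_simps)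
qed

lemma abs_f_le: "t \<in> {0..1} \<Longrightarrow> \<bar>f t\<bar> \<le> \<bar>fmax\<bar> + \<bar>M\<bar>"
  using f_le_fmax[of t] M_le[of t] by linarith

text \<open>A convex function is continuous on the open interval but may jump at 0 and 1, so the
  endpoints are added back as separate summands. The indicator cuts off the arbitrary values outside
  [0,1].\<close>

lemma measurable_indicator_f: "(\<lambda>t. indicator {0..1} t * f t) \<in> borel_measurable borel"
proof -
  have "continuous_on {0<..<1} f"
    by (rule convex_on_continuous[OF open_greaterThanLessThan])
       (rule convex_on_subset[OF convex], auto)
  then have "(\<lambda>t. indicator {0<..<1} t *\<^sub>R f t) \<in> borel_measurable borel"
    by (intro borel_measurable_continuous_on_indicator) auto
  then have "(\<lambda>t. indicator {0<..<1::real} t *\<^sub>R f t + indicator {0} t * f 0 + indicator {1} t * f 1)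
      \<in> borel_measurable borel" by measurable
  also have "(\<lambda>t. indicator {0<..<1::real} t *\<^sub>R f t + indicator {0} t * f 0 + indicator {1} t * f 1)
     = (\<lambda>t. indicator {0..1} t * f t)"
    by (auto simp: fun_eq_iff indicator_def)
  finally show ?thesis .
qed

lemma set_borel_measurable_f:
  assumes "A \<in> sets borel" "A \<subseteq> {0..1}"
  shows "set_borel_measurable lborel A f"
proof -
  have "(\<lambda>t. indicator A t * (indicator {0..1} t * f t)) \<in> borel_measurable borel"
    using assms(1) measurable_indicator_f by measurable
  also have "(\<lambda>t. indicator A t * (indicator {0..1} t * f t)) = (\<lambda>t. indicator A t *\<^sub>R f t)"
    using assms(2) by (auto simp: fun_eq_iff indicator_def)
  finally show ?thesis by (simp add: set_borel_measurable_def)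
qed

end

lemma set_integrable_bounded_01:
  fixes g :: "real \<Rightarrow> real"
  assumes "A \<in> sets borel" "A \<subseteq> {0..1}" "set_borel_measurable lborel A g"
    "\<And>t. t \<in> A \<Longrightarrow> \<bar>g t\<bar> \<le> B"
  shows "set_integrable lborel A g"
  unfolding set_integrable_def
proof (rule integrableI_bounded_set[where A = A and B = B])
  show "A \<in> sets lborel" using assms by simp
  show "(\<lambda>x. indicator A x *\<^sub>R g x) \<in> borel_measurable lborel"
    using assms(3) by (simp add: set_borel_measurable_def)
  show "emeasure lborel A < \<infinity>"
    using emeasure_mono[OF assms(2), of lborel] by (auto simp: less_top[symmetric] top_unique)
  show "AE x in lborel. x \<in> A \<longrightarrow> norm (indicator A x *\<^sub>R g x) \<le> B"
    using assms(4) by (intro AE_I2) (simp add: indicator_def)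
  show "AE x in lborel. x \<notin> A \<longrightarrow> indicator A x *\<^sub>R g x = 0"
    by (intro AE_I2) simp
qed

lemma set_integral_Ioc_diff:
  fixes \<phi> :: "real \<Rightarrow> real"
  assumes "set_integrable lborel {0..1} \<phi>" "0 \<le> a" "a \<le> b" "b \<le> 1"
  shows "(LINT u:{0..b}|lborel. \<phi> u) - (LINT u:{0..a}|lborel. \<phi> u) = (LINT u:{a<..b}|lborel. \<phi> u)"
proof -
  have "{0..b} = {0..a} \<union> {a<..b}" using assms by auto
  moreover have "set_integrable lborel {0..a} \<phi>" "set_integrable lborel {a<..b} \<phi>"
    using assms by (auto intro!: set_integrable_subset[OF assms(1)])
  ultimately have "(LINT u:{0..b}|lborel. \<phi> u) = (LINT u:{0..a}|lborel. \<phi> u) + (LINT u:{a<..b}|lborel. \<phi> u)"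
    by (simp only:, intro set_integral_Un) auto
  then show ?thesis by simp
qed

context convex_fn begin

lemma f_set_integrable:
  assumes "A \<in> sets borel" "A \<subseteq> {0..1}"
  shows "set_integrable lborel A f"
  by (rule set_integrable_bounded_01[OF assms set_borel_measurable_f[OF assms],
      where B = "\<bar>fmax\<bar> + \<bar>M\<bar>"])
     (use assms(2) in \<open>auto intro: abs_f_le\<close>)

text \<open>The squared L2 distance of \<open>f\<close> from its truncation at level
  \<open>u\<close>; see \<open>gap_L2\<close>.\<close>

definition gap :: "real \<Rightarrow> real" where
  "gap u = (LINT t:{0..1}|lborel. (max 0 (u - f t))\<^sup>2)"

lemma gap_set_integrable:
  assumes "A \<in> sets borel" "A \<subseteq> {0..1}"
  shows "set_integrable lborel A (\<lambda>t. (max 0 (u - f t))\<^sup>2)"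
proof (rule set_integrable_bounded_01[OF assms, where B = "(\<bar>u\<bar> + \<bar>fmax\<bar> + \<bar>M\<bar>)\<^sup>2"])
  have [measurable]: "A \<in> sets borel" by fact
  have "(\<lambda>t. indicator A t * (max 0 (u - indicator {0..1} t * f t))\<^sup>2) \<in> borel_measurable borel"
    using measurable_indicator_f by measurable
  also have "(\<lambda>t. indicator A t * (max 0 (u - indicator {0..1} t * f t))\<^sup>2)
     = (\<lambda>t. indicator A t *\<^sub>R (max 0 (u - f t))\<^sup>2)"
    using assms(2) by (auto simp: fun_eq_iff indicator_def)
  finally show "set_borel_measurable lborel A (\<lambda>t. (max 0 (u - f t))\<^sup>2)"
    by (simp add: set_borel_measurable_def)
  show "\<bar>(max 0 (u - f t))\<^sup>2\<bar> \<le> (\<bar>u\<bar> + \<bar>fmax\<bar> + \<bar>M\<bar>)\<^sup>2" if "t \<in> A" for t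
  proof -
    have "\<bar>max 0 (u - f t)\<bar> \<le> \<bar>u\<bar> + \<bar>fmax\<bar> + \<bar>M\<bar>"
      using abs_f_le[of t] that assms(2) by auto
    then show ?thesis
      using power_mono[of "\<bar>max 0 (u - f t)\<bar>" _ 2] by simp
  qed
qed

lemma gap_L2: "L2_norm01 (\<lambda>t. f t - max (f t) u) = sqrt (gap u)"
proof -
  have "(f t - max (f t) u)\<^sup>2 = (max 0 (u - f t))\<^sup>2" for t
    by (cases "f t \<le> u") (auto simp: max_def power2_commute)
  then show ?thesis by (simp add: L2_norm01_def gap_def)
qed

lemma gap_mono: "u \<le> v \<Longrightarrow> gap u \<le> gap v"
  unfolding gap_def
  by (intro set_integral_mono gap_set_integrable power_mono) auto

lemma set_integral_01_const: "(LINT t:{0..1::real}|lborel. c) = (c::real)"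
  by (simp add: set_lebesgue_integral_def content_real)

lemma gap_le:
  assumes "M \<le> u" shows "gap u \<le> (u - M)\<^sup>2"
proof -
  have "gap u \<le> (LINT t:{0..1::real}|lborel. (u - M)\<^sup>2)"
    unfolding gap_def
  proof (intro set_integral_mono gap_set_integrable)
    show "set_integrable lborel {0..1::real} (\<lambda>t. (u - M)\<^sup>2)"
      by (simp add: set_integrable_def)
  qed (use M_le assms in \<open>auto intro!: power_mono\<close>)
  then show ?thesis by (simp only: set_integral_01_const)
qed

text \<open>Above the whole function the truncation error grows without bound; this keeps the
  supremum in \<open>rho_m\<close> finite.\<close>

lemma gap_ge:
  assumes "fmax \<le> u" shows "(u - fmax)\<^sup>2 \<le> gap u"
proof -
  have "(LINT t:{0..1::real}|lborel. (u - fmax)\<^sup>2) \<le> gap u"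
    unfolding gap_def
  proof (intro set_integral_mono gap_set_integrable)
    show "set_integrable lborel {0..1::real} (\<lambda>t. (u - fmax)\<^sup>2)"
      by (simp add: set_integrable_def)
    fix t :: real assume "t \<in> {0..1}"
    then show "(u - fmax)\<^sup>2 \<le> (max 0 (u - f t))\<^sup>2"
      using f_le_fmax[of t] assms by (auto intro!: power_mono)
  qed auto
  then show ?thesis by (simp only: set_integral_01_const)
qed

end

section \<open>The radii \<mu> and \<rho>, and the growth of the function outside its level
  set\<close>

locale convex_fn_eps = convex_fn +
  fixes \<epsilon> :: real
  assumes eps: "0 < \<epsilon>"
begin

abbreviation "\<mu> \<equiv> rho_m \<epsilon> f"
abbreviation "\<rho> \<equiv> rho_z \<epsilon> f"

lemma rho_m_alt: "\<mu> = Sup {u - M | u. gap u \<le> \<epsilon>\<^sup>2}"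
proof -
  have "(sqrt (gap u) \<le> \<epsilon>) = (gap u \<le> \<epsilon>\<^sup>2)" for u
    using eps real_sqrt_le_iff[of "gap u" "\<epsilon>\<^sup>2"] by simp
  then show ?thesis unfolding rho_m_def gap_L2 by simp
qed

lemma rho_m_bdd: "bdd_above {u - M | u. gap u \<le> \<epsilon>\<^sup>2}"
proof -
  have "u \<le> fmax + \<epsilon>" if "gap u \<le> \<epsilon>\<^sup>2" for u
  proof (cases "fmax \<le> u")
    case True
    then have "(u - fmax)\<^sup>2 \<le> \<epsilon>\<^sup>2" using gap_ge that by force
    then show ?thesis using eps abs_le_square_iff[of "u - fmax" \<epsilon>] by simp
  qed (use eps in simp)
  then show ?thesis by (intro bdd_aboveI[of _ "fmax + \<epsilon> - M"]) force
qed

lemma rho_m_ge: "\<epsilon> \<le> \<mu>"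
proof -
  have "gap (M + \<epsilon>) \<le> \<epsilon>\<^sup>2" using gap_le[of "M + \<epsilon>"] eps by simp
  then have "\<epsilon> \<in> {u - M | u. gap u \<le> \<epsilon>\<^sup>2}"
    by (intro CollectI exI[of _ "M + \<epsilon>"]) simp
  then show ?thesis unfolding rho_m_alt by (intro cSup_upper[OF _ rho_m_bdd])
qed

lemma rho_m_pos: "0 < \<mu>"
  using rho_m_ge eps by linarith

text \<open>Inequalities at levels strictly above and, in \<open>gap_below\<close>, strictly below
  the critical one carry the information about \<mu> without an appeal to continuity of
  \<open>gap\<close>.\<close>

lemma gap_above: "M + \<mu> < v \<Longrightarrow> \<epsilon>\<^sup>2 < gap v"
proof (rule ccontr)
  assume v: "M + \<mu> < v" and "\<not> \<epsilon>\<^sup>2 < gap v"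
  then have "v - M \<le> \<mu>"
    unfolding rho_m_alt by (intro cSup_upper[OF _ rho_m_bdd]) auto
  then show False using v by simp
qed

lemma gap_below: "v < M + \<mu> \<Longrightarrow> gap v \<le> \<epsilon>\<^sup>2"
proof -
  assume "v < M + \<mu>"
  then have "v - M < Sup {u - M | u. gap u \<le> \<epsilon>\<^sup>2}" unfolding rho_m_alt by linarith
  moreover have "{u - M | u. gap u \<le> \<epsilon>\<^sup>2} \<noteq> {}"
    using gap_le[of "M + \<epsilon>"] eps by force
  ultimately obtain u where "v < u" "gap u \<le> \<epsilon>\<^sup>2"
    using less_cSup_iff[OF _ rho_m_bdd] by auto
  then show ?thesis using gap_mono[of v u] by linarith
qed

lemma rho_z_bdd: "bdd_above {\<bar>t - Z\<bar> | t. t \<in> {0..1} \<and> f t \<le> \<mu> + M}"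
  using Z_bounds by (intro bdd_aboveI[of _ 1]) auto

lemma dist_le_rho_z: "t \<in> {0..1} \<Longrightarrow> f t \<le> M + \<mu> \<Longrightarrow> \<bar>t - Z\<bar> \<le> \<rho>"
  unfolding rho_z_def by (intro cSup_upper[OF _ rho_z_bdd] CollectI exI[of _ t]) (simp add: add.commute)

lemma rho_z_witness:
  assumes "c < \<rho>"
  obtains t where "t \<in> {0..1}" "f t \<le> M + \<mu>" "c < \<bar>t - Z\<bar>"
proof -
  let ?S = "{\<bar>t - Z\<bar> | t. t \<in> {0..1} \<and> f t \<le> \<mu> + M}"
  have "\<bar>Z - Z\<bar> \<in> ?S"
    using Z_in f_Z rho_m_pos by (intro CollectI exI[of _ Z]) simp
  then have "?S \<noteq> {}" by blast
  then obtain y where "y \<in> ?S" "c < y"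
    using assms less_cSup_iff[OF _ rho_z_bdd, of c] unfolding rho_z_def by blast
  then obtain t where "t \<in> {0..1}" "f t \<le> \<mu> + M" "c < \<bar>t - Z\<bar>" by blast
  then show ?thesis by (intro that[of t]) simp_all
qed

lemma rho_z_nonneg: "0 \<le> \<rho>"
  using dist_le_rho_z[OF Z_in] f_Z rho_m_pos by simp

text \<open>Enlarging the level by a factor \<open>c > 1\<close> enlarges the level set around the
  minimizer at most by \<open>c\<close>; then let \<open>c\<close> tend to 1.\<close>

lemma eps_le: "\<epsilon>\<^sup>2 \<le> 2 * \<rho> * \<mu>\<^sup>2"
proof -
  have "\<epsilon>\<^sup>2 \<le> c ^ 3 * (2 * \<rho> * \<mu>\<^sup>2)" if c: "1 < c" for c
  proof -
    let ?v = "M + c * \<mu>" and ?A = "{Z - c * \<rho> .. Z + c * \<rho>}"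
    have v: "M + \<mu> < ?v" using c rho_m_pos by simp
    have le: "\<bar>t - Z\<bar> \<le> c * \<rho>" if t: "t \<in> {0..1}" "f t < ?v" for t
    proof -
      \<comment> \<open>Pulled towards \<open>Z\<close> by the factor \<open>c\<close>, a point
        below \<open>M + c * \<mu>\<close> lands in the level set that defines \<rho>.\<close>
      define x where "x = Z + (t - Z) / c"
      have "c * (f x - M) \<le> f t - M"
        using ge_scaled[OF t(1), of c x] c by (simp add: x_def)
      then have "c * (f x - M) \<le> c * \<mu>" using t(2) by simp
      then have "f x \<le> M + \<mu>" using c by simp
      moreover have "x = (1 - 1 / c) * Z + (1 / c) * t"
        using c by (simp add: x_def field_simps)
      then have "x \<in> {0..1}"
        using Z_in t(1) c convexD_alt[OF convex_real_interval(5), of Z 0 1 t "1/c"] by simp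
      ultimately have "\<bar>(t - Z) / c\<bar> \<le> \<rho>"
        using dist_le_rho_z[of x] by (simp add: x_def)
      then show ?thesis using c by (simp add: abs_div_pos[symmetric] field_simps)
    qed
    have cr: "0 \<le> c * \<rho>" using c rho_z_nonneg by simp
    have "\<epsilon>\<^sup>2 \<le> gap ?v" using gap_above[OF v] by simp
    \<comment> \<open>The integrand is at most \<open>(c * \<mu>)\<^sup>2\<close> and vanishes off
      an interval of length \<open>2 * c * \<rho>\<close>, whence the factor
      \<open>c ^ 3\<close>.\<close>
    also have "\<dots> \<le> (LINT t:?A|lborel. (c * \<mu>)\<^sup>2)"
      unfolding gap_def set_lebesgue_integral_def
    proof (rule integral_mono_AE)
      show "integrable lborel (\<lambda>x. indicat_real {0..1} x *\<^sub>R (max 0 (?v - f x))\<^sup>2)"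
        using gap_set_integrable[of "{0..1}"] by (simp add: set_integrable_def)
      show "AE x in lborel. indicat_real {0..1} x *\<^sub>R (max 0 (?v - f x))\<^sup>2 \<le> indicat_real ?A x *\<^sub>R (c * \<mu>)\<^sup>2"
      proof (rule AE_I2)
        fix x :: real
        show "indicat_real {0..1} x *\<^sub>R (max 0 (?v - f x))\<^sup>2 \<le> indicat_real ?A x *\<^sub>R (c * \<mu>)\<^sup>2"
        proof (cases "x \<in> {0..1} \<and> f x < ?v")
          case True
          then have "x \<in> ?A" using le[of x] by (auto simp: abs_le_iff)
          moreover have "(max 0 (?v - f x))\<^sup>2 \<le> (c * \<mu>)\<^sup>2"
            using M_le[of x] True by (intro power_mono) auto
          ultimately show ?thesis using True by simp
        next
          case False
          then have "indicat_real {0..1} x *\<^sub>R (max 0 (?v - f x))\<^sup>2 = 0"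
            by (auto simp: indicator_def)
          then show ?thesis by (metis scaleR_nonneg_nonneg indicator_pos_le zero_le_power2)
        qed
      qed
    qed (simp add: integrable_real_indicator emeasure_lborel_Icc_eq)
    also have "\<dots> = c ^ 3 * (2 * \<rho> * \<mu>\<^sup>2)"
      using cr by (simp add: set_lebesgue_integral_def power2_eq_square power3_eq_cube content_real)
    finally show ?thesis .
  qed
  then have "\<forall>\<^sub>F c in at_right 1. \<epsilon>\<^sup>2 \<le> c ^ 3 * (2 * \<rho> * \<mu>\<^sup>2)"
    unfolding eventually_at_right_field by (meson less_add_one)
  moreover have "((\<lambda>c::real. c ^ 3 * (2 * \<rho> * \<mu>\<^sup>2)) \<longlongrightarrow> 1 ^ 3 * (2 * \<rho> * \<mu>\<^sup>2)) (at_right 1)"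
    by (intro tendsto_intros)
  ultimately show ?thesis
    using tendsto_lowerbound by fastforce
qed

lemma rho_z_pos: "0 < \<rho>"
proof -
  have "\<rho> \<noteq> 0" using eps_le eps by auto
  then show ?thesis using rho_z_nonneg by simp
qed

text \<open>A point at distance \<open>r > \<rho>\<close> from \<open>Z\<close> lies outside the
  level set, so its excess is at least \<mu>. \<open>ge_scaled\<close> carries this out to
  \<open>t\<close>, and \<open>r\<close> then decreases to \<rho>.\<close>

lemma growth:
  assumes "t \<in> {0..1}" "\<rho> < \<bar>t - Z\<bar>"
  shows "\<mu> * \<bar>t - Z\<bar> / \<rho> \<le> f t - M"
proof -
  have "\<mu> * \<bar>t - Z\<bar> \<le> (f t - M) * r" if r: "\<rho> < r" "r \<le> \<bar>t - Z\<bar>" for r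
  proof -
    define c where "c = \<bar>t - Z\<bar> / r"
    have c: "1 \<le> c" using r rho_z_pos by (simp add: c_def)
    define x where "x = Z + (t - Z) / c"
    have "c * (f x - M) \<le> f t - M"
      using ge_scaled[OF assms(1) c, of x] by (simp add: x_def)
    moreover have "\<mu> \<le> f x - M"
    proof (rule ccontr)
      assume "\<not> \<mu> \<le> f x - M"
      then have fx: "f x \<le> M + \<mu>" by simp
      have "x = (1 - 1 / c) * Z + (1 / c) * t"
        using c by (simp add: x_def field_simps)
      then have "x \<in> {0..1}"
        using Z_in assms(1) c convexD_alt[OF convex_real_interval(5), of Z 0 1 t "1/c"] by simp
      then have "\<bar>(t - Z) / c\<bar> \<le> \<rho>"
        using dist_le_rho_z[of x] fx by (simp add: x_def)
      moreover have "\<bar>(t - Z) / c\<bar> = r"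
        using c r rho_z_pos by (cases "t = Z") (auto simp: c_def abs_divide abs_mult)
      ultimately show False using r by simp
    qed
    then have "c * \<mu> \<le> c * (f x - M)" using c by (intro mult_left_mono) auto
    ultimately show ?thesis using r rho_z_pos by (simp add: c_def field_simps)
  qed
  then have "\<forall>\<^sub>F r in at_right \<rho>. \<mu> * \<bar>t - Z\<bar> \<le> (f t - M) * r"
    unfolding eventually_at_right_field using assms(2) less_imp_le by blast
  moreover have "((\<lambda>r. (f t - M) * r) \<longlongrightarrow> (f t - M) * \<rho>) (at_right \<rho>)"
    by (intro tendsto_intros)
  ultimately have "\<mu> * \<bar>t - Z\<bar> \<le> (f t - M) * \<rho>"
    using tendsto_lowerbound by fastforce
  then show ?thesis using rho_z_pos by (simp add: field_simps)
qed

text \<open>Slopes of a convex function increase away from \<open>Z\<close>, so the chord from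
  \<open>x\<close> to \<open>y\<close> is at least as steep as the one from \<open>Z\<close> to
  \<open>y\<close>, to which \<open>growth\<close> applies. The third hypothesis puts
  \<open>x\<close> between \<open>Z\<close> and \<open>y\<close>.\<close>

lemma steep:
  assumes "x \<in> {0..1}" "y \<in> {0..1}" "0 \<le> (x - Z) * (y - x)" "\<rho> < \<bar>y - x\<bar>"
  shows "\<mu> * \<bar>y - x\<bar> / \<rho> \<le> f y - f x"
proof -
  have sum: "\<bar>y - Z\<bar> = \<bar>x - Z\<bar> + \<bar>y - x\<bar>"
    using assms(3,4) by (auto simp: zero_le_mult_iff)
  then have pos: "0 < \<bar>y - Z\<bar>" and far: "\<rho> < \<bar>y - Z\<bar>" using assms(4) rho_z_pos by linarith+
  define l where "l = \<bar>x - Z\<bar> / \<bar>y - Z\<bar>"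
  have l: "0 \<le> l" "l \<le> 1" using sum pos by (auto simp: l_def)
  have "x - Z = l * (y - Z)"
  proof -
    have "0 \<le> x - Z \<and> 0 \<le> y - x \<or> x - Z \<le> 0 \<and> y - x \<le> 0"
      using assms(3) by (simp add: zero_le_mult_iff)
    then have "\<bar>x - Z\<bar> = x - Z \<and> \<bar>y - Z\<bar> = y - Z \<or> \<bar>x - Z\<bar> = - (x - Z) \<and> \<bar>y - Z\<bar> = - (y - Z)"
      by auto
    then have "(x - Z) * \<bar>y - Z\<bar> = \<bar>x - Z\<bar> * (y - Z)" by (auto simp: algebra_simps)
    then show ?thesis using pos by (simp add: l_def nonzero_eq_divide_eq)
  qed
  then have "f x - M \<le> l * (f y - M)"
    using chord_Z[OF assms(2) l, of x] by simp
  then have "(1 - l) * (f y - M) \<le> f y - f x" by (simp add: algebra_simps)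
  moreover have "(1 - l) * (\<mu> * \<bar>y - Z\<bar> / \<rho>) \<le> (1 - l) * (f y - M)"
    using growth[OF assms(2) far] l by (intro mult_left_mono) auto
  moreover have "(1 - l) * (\<mu> * \<bar>y - Z\<bar> / \<rho>) = \<mu> * \<bar>y - x\<bar> / \<rho>"
  proof -
    have "(1 - l) * \<bar>y - Z\<bar> = \<bar>y - x\<bar>"
      using pos sum by (simp add: l_def left_diff_distrib)
    then show ?thesis by (metis mult.left_commute times_divide_eq_right)
  qed
  ultimately show ?thesis by linarith
qed

text \<open>On a segment of length at least \<open>\<rho> / 4\<close> starting at the minimizer, \<open>f\<close> stays below \<open>M + \<mu> / 2\<close>.\<close>

lemma rho_mu_le: "\<rho> * \<mu>\<^sup>2 \<le> 128 * \<epsilon>\<^sup>2"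
proof -
  obtain t0 where t0: "t0 \<in> {0..1}" "f t0 \<le> M + \<mu>" "\<rho> / 2 < \<bar>t0 - Z\<bar>"
    using rho_z_witness[of "\<rho> / 2"] rho_z_pos by auto
  define h where "h = (t0 - Z) / 2"
  have t0_eq: "t0 = Z + 2 * h" by (simp add: h_def field_simps)
  have h0: "h \<noteq> 0" "\<bar>h\<bar> \<ge> \<rho> / 4" using t0(3) rho_z_pos unfolding t0_eq by auto
  define a where "a = min Z (Z + h)"
  define b where "b = max Z (Z + h)"
  have ab: "a \<le> b" "b - a = \<bar>h\<bar>" "0 \<le> a" "b \<le> 1"
    using Z_bounds t0(1) unfolding a_def b_def t0_eq by auto
  \<comment> \<open>\<open>gap_below\<close> asks for a level strictly below
    \<open>M + \<mu>\<close>. This one exceeds the bound \<open>M + \<mu> / 2\<close> on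
    \<open>{a..b}\<close> by \<open>\<mu> / 4\<close>, which yields
    \<open>\<rho> * \<mu>\<^sup>2 / 64 \<le> \<epsilon>\<^sup>2\<close>.\<close>
  let ?v = "M + 3/4 * \<mu>"
  have low: "f t \<le> M + \<mu> / 2" if t: "t \<in> {a..b}" for t
  proof -
    define l where "l = (t - Z) / (2 * h)"
    have l: "0 \<le> l \<and> l \<le> 1/2"
    proof (cases "0 < h")
      case True
      then have "0 \<le> t - Z" "t - Z \<le> h" using t by (auto simp: a_def b_def)
      then show ?thesis using True by (simp add: l_def)
    next
      case False
      then have "h < 0" "t - Z \<le> 0" "h \<le> t - Z" using t h0 by (auto simp: a_def b_def)
      then show ?thesis by (simp add: l_def divide_nonpos_neg)
    qed
    have "t = Z + l * (t0 - Z)" using h0 by (simp add: l_def t0_eq)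
    then have "f t - M \<le> l * (f t0 - M)"
      using chord_Z[OF t0(1), of l t] l by simp
    also have "\<dots> \<le> 1/2 * \<mu>"
      using l t0(2) M_le[OF t0(1)] rho_m_pos by (intro mult_mono) auto
    finally show ?thesis by simp
  qed
  have "\<rho> / 4 * (\<mu> / 4)\<^sup>2 \<le> (b - a) * (\<mu> / 4)\<^sup>2"
    using ab(2) h0 by (intro mult_right_mono) auto
  also have "\<dots> = (LINT t:{a..b}|lborel. (\<mu> / 4)\<^sup>2)"
    using ab(1) by (simp add: set_lebesgue_integral_def content_real)
  also have "\<dots> \<le> gap ?v"
    unfolding gap_def set_lebesgue_integral_def
  proof (rule integral_mono)
    show "integrable lborel (\<lambda>x. indicat_real {0..1} x *\<^sub>R (max 0 (?v - f x))\<^sup>2)"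
      using gap_set_integrable[of "{0..1}"] by (simp add: set_integrable_def)
    show "indicat_real {a..b} x *\<^sub>R (\<mu> / 4)\<^sup>2 \<le> indicat_real {0..1} x *\<^sub>R (max 0 (?v - f x))\<^sup>2"
      for x
    proof (cases "x \<in> {a..b}")
      case True
      then have "(\<mu> / 4)\<^sup>2 \<le> (max 0 (?v - f x))\<^sup>2"
        using low[of x] rho_m_pos by (intro power_mono) auto
      moreover have "x \<in> {0..1}" using True ab by auto
      ultimately show ?thesis using True by simp
    next
      case False
      then have "indicat_real {a..b} x = 0" by (rule indicator_simps)
      then show ?thesis by simp
    qed
  qed (simp add: integrable_real_indicator emeasure_lborel_Icc_eq)
  also have "\<dots> \<le> \<epsilon>\<^sup>2" using rho_m_pos by (intro gap_below) simp
  finally have "\<rho> / 4 * (\<mu> / 4)\<^sup>2 \<le> \<epsilon>\<^sup>2" .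
  moreover have "\<rho> / 4 * (\<mu> / 4)\<^sup>2 = \<rho> * \<mu>\<^sup>2 / 64" by (simp add: power2_eq_square)
  ultimately show ?thesis using zero_le_power2[of \<epsilon>] by linarith
qed

end

section \<open>Second moment bounds and independence\<close>

text \<open>Cantelli's one-sided form of Chebyshev's inequality: Markov's inequality for the square
  of a shifted variable.\<close>

lemma (in prob_space) normal_upper_tail:
  assumes X: "distributed M lborel X (normal_density 0 \<sigma>)" and \<sigma>: "0 < \<sigma>" and x: "0 < x"
  shows "prob {\<omega> \<in> space M. x \<le> X \<omega>} \<le> \<sigma>\<^sup>2 / (\<sigma>\<^sup>2 + x\<^sup>2)"
proof -
  have [measurable]: "X \<in> borel_measurable M"
    using distributed_measurable[OF X] by simp
  have i1: "integrable M X"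
    using integrable_normal_moment_nz_1[OF \<sigma>, of 0] distributed_integrable[OF X, of "\<lambda>x. x"] by simp
  have i2: "integrable M (\<lambda>\<omega>. (X \<omega>)\<^sup>2)"
    using integrable_normal_moment[OF \<sigma>, of 0 2] distributed_integrable[OF X, of "\<lambda>x. x\<^sup>2"] by simp
  have e1: "expectation X = 0" by (rule normal_distributed_expectation[OF \<sigma> X])
  have e2: "expectation (\<lambda>\<omega>. (X \<omega>)\<^sup>2) = \<sigma>\<^sup>2"
    using normal_distributed_variance[OF \<sigma> X] by (simp add: e1)
  \<comment> \<open>The shift that minimizes the Markov bound
    \<open>(\<sigma>\<^sup>2 + c\<^sup>2) / (x + c)\<^sup>2\<close>.\<close>
  define c where "c = \<sigma>\<^sup>2 / x"
  have c: "0 < c" using \<sigma> x by (simp add: c_def)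
  have sq: "(X \<omega> + c)\<^sup>2 = (X \<omega>)\<^sup>2 + 2 * c * X \<omega> + c\<^sup>2" for \<omega>
    by (simp add: power2_eq_square algebra_simps)
  have i3: "integrable M (\<lambda>\<omega>. (X \<omega> + c)\<^sup>2)"
    unfolding sq using i1 i2 by simp
  have e3: "expectation (\<lambda>\<omega>. (X \<omega> + c)\<^sup>2) = \<sigma>\<^sup>2 + c\<^sup>2"
    unfolding sq using i1 i2 by (simp add: e1 e2 prob_space)
  have "prob {\<omega> \<in> space M. x \<le> X \<omega>} \<le> prob {\<omega> \<in> space M. (x + c)\<^sup>2 \<le> (X \<omega> + c)\<^sup>2}"
    using x c by (intro finite_measure_mono) (auto intro!: power_mono)
  also have "\<dots> \<le> (\<sigma>\<^sup>2 + c\<^sup>2) / (x + c)\<^sup>2"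
    using integral_Markov_inequality_measure[OF i3, of "{}" "(x + c)\<^sup>2"] x c by (simp add: e3)
  also have "\<dots> = \<sigma>\<^sup>2 / (\<sigma>\<^sup>2 + x\<^sup>2)"
  proof -
    have "x + c = (\<sigma>\<^sup>2 + x\<^sup>2) / x" using x by (simp add: c_def field_simps power2_eq_square)
    moreover have "\<sigma>\<^sup>2 + c\<^sup>2 = \<sigma>\<^sup>2 * (\<sigma>\<^sup>2 + x\<^sup>2) / x\<^sup>2"
      using x by (simp add: c_def field_simps power2_eq_square)
    moreover have "0 < \<sigma>\<^sup>2 + x\<^sup>2" using x by (simp add: add_nonneg_pos)
    ultimately show ?thesis using x by (simp add: power_divide power2_eq_square)
  qed
  finally show ?thesis .
qed

text \<open>Joins two kinds of independence, that between the paths \<open>X k\<close> and that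
  between the increments \<open>h k j\<close> of a single path. A joint probability factors first
  over \<open>k\<close>, as events on whole paths, and then over \<open>j\<close>.\<close>

lemma (in prob_space) indep_vars_Times:
  assumes X: "indep_vars N X I" and fin: "finite I" "finite J"
    and Y: "\<And>k. k \<in> I \<Longrightarrow> indep_vars (\<lambda>_. borel) (\<lambda>j \<omega>. h k j (X k \<omega>)) J"
    and h: "\<And>k j. k \<in> I \<Longrightarrow> j \<in> J \<Longrightarrow> h k j \<in> measurable (N k) borel"
  shows "indep_vars (\<lambda>_. borel) (\<lambda>(k, j) \<omega>. h k j (X k \<omega>) :: 'b :: topological_space) (I \<times> J)"
proof (cases "I = {} \<or> J = {}")
  case True
  then have "I \<times> J = {}" by auto
  then show ?thesis unfolding indep_vars_def2 indep_sets_def by (simp only: subset_empty ball_empty) blast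
next
  case False
  then have ne: "I \<noteq> {}" "J \<noteq> {}" by auto
  have Xm: "X k \<in> measurable M (N k)" if "k \<in> I" for k
    using X that by (auto simp: indep_vars_def2)
  have rv: "(\<lambda>\<omega>. h k j (X k \<omega>)) \<in> measurable M borel" if "k \<in> I" "j \<in> J" for k j
    using measurable_compose[OF Xm h] that by blast
  let ?F = "\<lambda>i. {(\<lambda>(k, j) \<omega>. h k j (X k \<omega>)) i -` A \<inter> space M |A. A \<in> sets borel}"
  have "indep_sets ?F (I \<times> J)"
  proof (subst indep_sets_finite)
    show "I \<times> J \<noteq> {}" "finite (I \<times> J)" using ne fin by auto
    show "?F i \<subseteq> events" if "i \<in> I \<times> J" for i
      using that rv by (auto intro!: measurable_sets)
    show "space M \<in> ?F i" for i by (auto intro!: exI[of _ UNIV])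
    show "\<forall>A\<in>Pi (I \<times> J) ?F. prob (\<Inter>j\<in>I \<times> J. A j) = (\<Prod>j\<in>I \<times> J. prob (A j))"
    proof
      fix A assume "A \<in> Pi (I \<times> J) ?F"
      then have "\<forall>k\<in>I. \<forall>j\<in>J. \<exists>B. B \<in> sets borel \<and> A (k, j) = (\<lambda>\<omega>. h k j (X k \<omega>)) -` B \<inter> space M"
        unfolding Pi_iff by force
      then obtain B where B: "\<And>k j. k \<in> I \<Longrightarrow> j \<in> J \<Longrightarrow> B k j \<in> sets borel"
        "\<And>k j. k \<in> I \<Longrightarrow> j \<in> J \<Longrightarrow> A (k, j) = (\<lambda>\<omega>. h k j (X k \<omega>)) -` B k j \<inter> space M"
        by metis
      define C where "C k = (\<Inter>j\<in>J. h k j -` B k j \<inter> space (N k))" for k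
      have C: "C k \<in> sets (N k)" if "k \<in> I" for k
        unfolding C_def using that ne fin B(1) h by (intro sets.finite_INT) auto
      have XC: "X k -` C k \<inter> space M = (\<Inter>j\<in>J. A (k, j))" if k: "k \<in> I" for k
        using k ne B(2) measurable_space[OF Xm[OF k]] by (auto simp: C_def)
      have "(\<Inter>i\<in>I \<times> J. A i) = (\<Inter>k\<in>I. X k -` C k \<inter> space M)"
        using XC by auto
      also have "prob \<dots> = (\<Prod>k\<in>I. prob (X k -` C k \<inter> space M))"
        using C by (intro indep_varsD_finite[OF X ne(1) fin(1)])
      also have "\<dots> = (\<Prod>k\<in>I. prob (\<Inter>j\<in>J. (\<lambda>\<omega>. h k j (X k \<omega>)) -` B k j \<inter> space M))"
        using XC B(2) by (intro prod.cong refl arg_cong[where f = prob]) auto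
      also have "\<dots> = (\<Prod>k\<in>I. \<Prod>j\<in>J. prob ((\<lambda>\<omega>. h k j (X k \<omega>)) -` B k j \<inter> space M))"
        using B(1) by (intro prod.cong refl indep_varsD_finite[OF Y ne(2) fin(2)]) auto
      also have "\<dots> = (\<Prod>k\<in>I. \<Prod>j\<in>J. prob (A (k, j)))"
        using B(2) by (intro prod.cong refl) auto
      also have "\<dots> = (\<Prod>i\<in>I \<times> J. prob (A i))"
        by (subst prod.cartesian_product) (auto intro!: prod.cong)
      finally show "prob (\<Inter>j\<in>I \<times> J. A j) = (\<Prod>j\<in>I \<times> J. prob (A j))" .
    qed
  qed
  moreover have "\<forall>i\<in>I \<times> J. random_variable borel ((\<lambda>(k, j) \<omega>. h k j (X k \<omega>)) i)"
    using rv by auto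
  ultimately show ?thesis unfolding indep_vars_def2 by blast
qed

section \<open>Increments of the combined noise\<close>

lemma mesh_pos: "0 < mesh j" by (simp add: mesh_def)

lemma mesh_Suc: "mesh (Suc j) = mesh j / 2" by (simp add: mesh_def)

lemma grid_01: "0 \<le> i \<Longrightarrow> i \<le> 2 ^ j \<Longrightarrow> grid j i \<in> {0..1}"
proof -
  assume "0 \<le> i" "i \<le> 2 ^ j"
  then have "real_of_int i \<le> 2 ^ j" by (metis of_int_le_iff of_int_numeral of_int_power)
  then show ?thesis using \<open>0 \<le> i\<close> by (simp add: grid_def mesh_def power_one_over divide_le_eq)
qed

lemma grid_nat_01: "i \<le> 2 ^ j \<Longrightarrow> grid j (int i) \<in> {0..1}"
proof -
  assume "i \<le> 2 ^ j"
  then have "int i \<le> 2 ^ j" by (metis of_nat_le_iff of_nat_numeral of_nat_power)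
  then show ?thesis by (intro grid_01) auto
qed

lemma grid_mono: "i < k \<Longrightarrow> grid j i < grid j k"
  using mesh_pos[of j] by (simp add: grid_def)

lemma grid_diff: "grid j i - grid j k = of_int (i - k) * mesh j"
  by (simp add: grid_def algebra_simps)

lemma grid_refine: "grid (j + n) (i * 2 ^ n) = grid j i"
  by (simp add: grid_def mesh_def power_add power_one_over)

locale white_noise_copies = prob_space \<Omega> for \<Omega> :: "'w measure" +
  fixes W B1 B2 :: "real \<Rightarrow> 'w \<Rightarrow> real"
  assumes ibm: "independent_brownian_motions \<Omega> W B1 B2"
begin

abbreviation V :: "nat \<Rightarrow> real \<Rightarrow> 'w \<Rightarrow> real" where
  "V k \<equiv> [W, B1, B2] ! k"

lemma V_bm: "k < 3 \<Longrightarrow> standard_brownian_motion \<Omega> (V k)"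
proof -
  assume "k < 3"
  then consider "k = 0" | "k = 1" | "k = 2" by linarith
  moreover have "standard_brownian_motion \<Omega> W" "standard_brownian_motion \<Omega> B1" "standard_brownian_motion \<Omega> B2"
    using ibm unfolding independent_brownian_motions_def by blast+
  ultimately show ?thesis by cases (simp_all add: numeral_2_eq_2)
qed

lemma V_measurable: "k < 3 \<Longrightarrow> t \<in> {0..1} \<Longrightarrow> V k t \<in> borel_measurable \<Omega>"
  using V_bm unfolding standard_brownian_motion_def by blast

text \<open>Cells are counted from 0 here, whereas \<open>grid_increment\<close>,
  \<open>ihat\<close> and \<open>istar\<close> count them from 1.\<close>

definition cell :: "nat \<Rightarrow> nat \<times> nat \<Rightarrow> 'w \<Rightarrow> real" where
  "cell K = (\<lambda>(k, i) \<omega>. V k (grid K (int i + 1)) \<omega> - V k (grid K (int i)) \<omega>)"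

lemma cell_normal:
  assumes "k < 3" "i < 2 ^ K"
  shows "distributed \<Omega> lborel (cell K (k, i)) (normal_density 0 (sqrt (mesh K)))"
proof -
  have "grid K (int i) \<in> {0..1}" "grid K (int i + 1) \<in> {0..1}"
    using grid_nat_01[of i K] grid_nat_01[of "Suc i" K] assms(2) by (simp_all add: add.commute)
  moreover have "grid K (int i) < grid K (int i + 1)" by (simp add: grid_mono)
  moreover have "grid K (int i + 1) - grid K (int i) = mesh K" by (simp add: grid_diff)
  ultimately show ?thesis
    using V_bm[OF assms(1)] unfolding standard_brownian_motion_def cell_def by fastforce
qed

lemma cell_indep: "indep_vars (\<lambda>_. borel) (cell K) ({..<3} \<times> {..<2 ^ K})"
proof -
  let ?X = "\<lambda>k \<omega>. \<lambda>t\<in>{0..1}. V k t \<omega>"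
  let ?h = "\<lambda>(k::nat) i x. x (grid K (int i + 1)) - x (grid K (int i)) :: real"
  have g: "grid K (int i) \<in> {0..1} \<and> grid K (int i + 1) \<in> {0..1}" if "i < 2 ^ K" for i
    using grid_nat_01[of i K] grid_nat_01[of "Suc i" K] that by (simp add: add.commute)
  have g': "grid K (int i) \<in> {0..1}" if "i \<le> 2 ^ K" for i
    using that by (rule grid_nat_01)
  have X: "indep_vars (\<lambda>_. PiM {0..1} (\<lambda>_. borel)) ?X {..<3}"
    using ibm unfolding independent_brownian_motions_def by blast
  have Y: "indep_vars (\<lambda>_. borel) (\<lambda>i \<omega>. ?h k i (?X k \<omega>)) {..<2 ^ K}" if k: "k \<in> {..<3}" for k
  proof -
    have "indep_vars (\<lambda>_. borel) (\<lambda>i \<omega>. V k (grid K (int (Suc i))) \<omega> - V k (grid K (int i)) \<omega>) {..<2 ^ K}"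
    proof -
      have "\<forall>n t. (\<forall>i\<le>n. t i \<in> {0..1}) \<and> (\<forall>i<n. t i < t (Suc i)) \<longrightarrow>
          indep_vars (\<lambda>_. borel) (\<lambda>i \<omega>. V k (t (Suc i)) \<omega> - V k (t i) \<omega>) {..<n}"
        using V_bm[of k] k unfolding standard_brownian_motion_def by blast
      from this[rule_format, of "2 ^ K" "\<lambda>i. grid K (int i)"] show ?thesis
        using g' grid_mono by simp
    qed
    then show ?thesis
      using g by (subst indep_vars_cong[OF refl _ refl]) (auto simp: fun_eq_iff add.commute)
  qed
  have "indep_vars (\<lambda>_. borel) (\<lambda>(k, i) \<omega>. ?h k i (?X k \<omega>)) ({..<3} \<times> {..<2 ^ K})"
  proof (rule indep_vars_Times[where h = ?h and X = ?X, OF X])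
    show "indep_vars (\<lambda>_. borel) (\<lambda>i \<omega>. ?h k i (?X k \<omega>)) {..<2 ^ K}" if "k \<in> {..<3}" for k
      using that by (rule Y)
    show "?h k i \<in> borel_measurable (PiM {0..1} (\<lambda>_. borel))" if "i \<in> {..<2 ^ K}" for k i
      using g[of i] that by (intro borel_measurable_diff measurable_component_singleton) auto
  qed auto
  then show ?thesis
    by (rule iffD1[OF indep_vars_cong[OF refl _ refl], rotated])
      (use g in \<open>auto simp: cell_def fun_eq_iff\<close>)
qed

text \<open>The weights of the three motions in the two copies of the data: \<open>s = 1\<close> for
  localization, \<open>s = - 1\<close> for stopping.\<close>

definition coef :: "real \<Rightarrow> nat \<Rightarrow> real" where
  "coef s k = [1, sqrt 2 / 2, s * sqrt 6 / 2] ! k"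

definition noise :: "real \<Rightarrow> real \<Rightarrow> 'w \<Rightarrow> real" where
  "noise s t \<omega> = (\<Sum>k<3. coef s k * V k t \<omega>)"

lemma noise_eq: "noise s t \<omega> = W t \<omega> + sqrt 2 / 2 * B1 t \<omega> + s * sqrt 6 / 2 * B2 t \<omega>"
  by (simp add: noise_def coef_def numeral_3_eq_3)

definition dnoise :: "real \<Rightarrow> nat \<Rightarrow> int \<Rightarrow> int \<Rightarrow> 'w \<Rightarrow> real" where
  "dnoise s j b g \<omega> = (noise s (grid j b) \<omega> - noise s (grid j (b - 1)) \<omega>)
     - (noise s (grid j g) \<omega> - noise s (grid j (g - 1)) \<omega>)"

text \<open>The squared weights sum to 1 + 1/2 + 3/2 = 3 and two distinct cells contribute, whence
  the 6 in \<open>stop_sd\<close>.\<close>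

lemma dnoise_normal:
  assumes s: "s = 1 \<or> s = -1" and b: "1 \<le> b" "b \<le> 2 ^ j" and g: "1 \<le> g" "g \<le> 2 ^ j" and ne: "b \<noteq> g"
  shows "distributed \<Omega> lborel (dnoise s j b g) (normal_density 0 (sqrt (6 * mesh j)))"
proof -
  define p where "p = nat (b - 1)"
  define q where "q = nat (g - 1)"
  have bp: "b = int p + 1" "g = int q + 1" using b g by (auto simp: p_def q_def)
  have lt: "nat (i - 1) < 2 ^ j" if "1 \<le> i" "i \<le> 2 ^ j" for i
    using that by (simp add: nat_less_iff)
  have pq: "p < 2 ^ j" "q < 2 ^ j" "p \<noteq> q"
    using lt[of b] lt[of g] b g ne by (auto simp: p_def q_def)
  let ?S = "{..<3::nat} \<times> {p, q}"
  define c where "c = (\<lambda>(k, i). (if i = p then 1 else -1) * coef s k)"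
  have cpq: "c (k, p) = coef s k" "c (k, q) = - coef s k" for k
    using pq(3) by (simp_all add: c_def)
  have coef_ne: "coef s k \<noteq> 0" if "k < 3" for k
  proof -
    consider "k = 0" | "k = 1" | "k = 2" using \<open>k < 3\<close> by linarith
    then show ?thesis using s by cases (auto simp: coef_def)
  qed
  have c_ne: "c i \<noteq> 0" if "i \<in> ?S" for i
    using that coef_ne cpq by (cases i) auto
  have "indep_vars (\<lambda>_. borel) (cell j) ?S"
    using pq by (intro indep_vars_subset[OF cell_indep]) auto
  then have ind: "indep_vars (\<lambda>_. borel) (\<lambda>i \<omega>. c i * cell j i \<omega>) ?S"
    by (rule indep_vars_compose2) simp
  have nrm: "distributed \<Omega> lborel (\<lambda>\<omega>. c i * cell j i \<omega>) (normal_density 0 (\<bar>c i\<bar> * sqrt (mesh j)))"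
    if i: "i \<in> ?S" for i
  proof -
    obtain k l where kl: "i = (k, l)" "k < 3" "l < 2 ^ j"
      using i pq by (cases i) auto
    show ?thesis
      using normal_density_affine[OF cell_normal[OF kl(2,3)] _ c_ne[OF i], of 0] mesh_pos[of j]
      unfolding kl(1) by simp
  qed
  have split: "sum F ?S = (\<Sum>k<3. F (k, p) + F (k, q))" for F :: "nat \<times> nat \<Rightarrow> real"
    unfolding sum.cartesian_product' using pq(3) by simp
  have "distributed \<Omega> lborel (\<lambda>\<omega>. \<Sum>i\<in>?S. c i * cell j i \<omega>)
     (normal_density (\<Sum>i\<in>?S. 0) (sqrt (\<Sum>i\<in>?S. (\<bar>c i\<bar> * sqrt (mesh j))\<^sup>2)))"
  proof (intro sum_indep_normal ind nrm)
    show "0 < \<bar>c i\<bar> * sqrt (mesh j)" if "i \<in> ?S" for i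
      using c_ne[OF that] mesh_pos[of j] by simp
  qed (simp_all add: lessThan_empty_iff)
  moreover have "(\<Sum>i\<in>?S. c i * cell j i \<omega>) = dnoise s j b g \<omega>" for \<omega>
    unfolding split cpq dnoise_def noise_def cell_def sum_subtractf[symmetric] bp
    by (intro sum.cong refl) (simp add: algebra_simps)
  moreover have "(\<Sum>i\<in>?S. (\<bar>c i\<bar> * sqrt (mesh j))\<^sup>2) = 6 * mesh j"
    unfolding split cpq using s mesh_pos[of j]
    by (elim disjE) (simp_all add: coef_def numeral_3_eq_3 power_mult_distrib power_divide)
  ultimately show ?thesis by (simp only: sum.neutral_const)
qed

lemma dnoise_measurable:
  assumes "1 \<le> b" "b \<le> 2 ^ j" "1 \<le> g" "g \<le> 2 ^ j"
  shows "dnoise s j b g \<in> borel_measurable \<Omega>"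
proof -
  have "noise s (grid j i) \<in> borel_measurable \<Omega>" if "0 \<le> i" "i \<le> 2 ^ j" for i
    unfolding noise_def using that by (intro borel_measurable_sum borel_measurable_times V_measurable grid_01) auto
  then show ?thesis
    unfolding dnoise_def using assms by (intro borel_measurable_diff) auto
qed

lemma dnoise_swap: "dnoise s j g b \<omega> = - dnoise s j b g \<omega>"
  by (simp add: dnoise_def)

text \<open>Differences taken at different levels are functions of disjoint sets of cells of the finest level.\<close>

lemma dnoise_indep:
  fixes a :: "nat \<Rightarrow> nat" and sg :: "nat \<Rightarrow> real"
  assumes le: "\<And>k. k \<le> n \<Longrightarrow> a k + 2 \<le> 2 ^ (J + k)"
    and dis: "\<And>k l. k < l \<Longrightarrow> l \<le> n \<Longrightarrow>
      {a k * 2 ^ (n - k) ..< (a k + 2) * 2 ^ (n - k)} \<inter> {a l * 2 ^ (n - l) ..< (a l + 2) * 2 ^ (n - l)} = {}"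
  shows "indep_vars (\<lambda>_. borel) (\<lambda>k \<omega>. sg k * dnoise s (J + k) (int (a k) + 2) (int (a k) + 1) \<omega>) {..n}"
proof -
  \<comment> \<open>As \<open>a k\<close> counts from 0, the cells \<open>a k + 1\<close> and
    \<open>a k + 2\<close> of level \<open>J + k\<close>, counted from 1, consist of exactly these
    cells of the finest level.\<close>
  let ?I = "\<lambda>k. {a k * 2 ^ (n - k) ..< (a k + 2) * 2 ^ (n - k)}"
  let ?m = "\<lambda>k. (a k + 1) * 2 ^ (n - k)"
  let ?K = "\<lambda>k. {..<3::nat} \<times> ?I k"
  let ?Y = "\<lambda>k x. sg k * (\<Sum>c<3. coef s c * ((\<Sum>i\<in>{?m k ..< (a k + 2) * 2 ^ (n - k)}. x (c, i))
      - (\<Sum>i\<in>{a k * 2 ^ (n - k) ..< ?m k}. x (c, i))))"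
  have sub: "?K k \<subseteq> {..<3} \<times> {..<2 ^ (J + n)}" if "k \<in> {..n}" for k
  proof -
    have "(a k + 2) * 2 ^ (n - k) \<le> 2 ^ (J + k) * 2 ^ (n - k)"
      using le that by (intro mult_right_mono) auto
    also have "\<dots> = 2 ^ (J + n)" using that by (simp flip: power_add)
    finally show ?thesis by auto
  qed
  have dis': "disjoint_family_on ?K {..n}"
    unfolding disjoint_family_on_def
  proof (intro ballI impI)
    fix k l assume "k \<in> {..n}" "l \<in> {..n}" "k \<noteq> l"
    then have "?I k \<inter> ?I l = {}" using dis[of k l] dis[of l k] by (cases k l rule: linorder_cases) auto
    then show "?K k \<inter> ?K l = {}" by blast
  qed
  have "indep_vars (\<lambda>k. PiM (?K k) (\<lambda>_. borel)) (\<lambda>k \<omega>. restrict (\<lambda>i. cell (J + n) i \<omega>) (?K k)) {..n}"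
    by (rule indep_vars_restrict[OF cell_indep sub dis'])
  then have ind: "indep_vars (\<lambda>_. borel) (\<lambda>k \<omega>. ?Y k (restrict (\<lambda>i. cell (J + n) i \<omega>) (?K k))) {..n}"
  proof (rule indep_vars_compose2)
    fix k assume "k \<in> {..n}"
    show "?Y k \<in> borel_measurable (PiM (?K k) (\<lambda>_. borel))"
      by (intro borel_measurable_times borel_measurable_sum borel_measurable_diff
          borel_measurable_const measurable_component_singleton) auto
  qed
  have "?Y k (restrict (\<lambda>i. cell (J + n) i \<omega>) (?K k))
      = sg k * dnoise s (J + k) (int (a k) + 2) (int (a k) + 1) \<omega>" if k: "k \<in> {..n}" for k \<omega>
  proof -
    have tele: "(\<Sum>i\<in>{p..<q}. restrict (\<lambda>i. cell (J + n) i \<omega>) (?K k) (c, i))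
        = V c (grid (J + n) (int q)) \<omega> - V c (grid (J + n) (int p)) \<omega>"
      if "p \<le> q" "{p..<q} \<subseteq> ?I k" "c < 3" for p q c
    proof -
      have "(\<Sum>i\<in>{p..<q}. restrict (\<lambda>i. cell (J + n) i \<omega>) (?K k) (c, i))
         = (\<Sum>i\<in>{p..<q}. V c (grid (J + n) (int (Suc i))) \<omega> - V c (grid (J + n) (int i)) \<omega>)"
        using that by (intro sum.cong refl) (auto simp: cell_def add.commute)
      also have "\<dots> = V c (grid (J + n) (int q)) \<omega> - V c (grid (J + n) (int p)) \<omega>"
        by (rule sum_Suc_diff'[OF that(1)])
      finally show ?thesis .
    qed
    have gr: "grid (J + n) (int (p * 2 ^ (n - k))) = grid (J + k) (int p)" for p
      using grid_refine[of "J + k" "n - k" "int p"] k by simp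
    have "?Y k (restrict (\<lambda>i. cell (J + n) i \<omega>) (?K k))
       = sg k * (\<Sum>c<3. coef s c * ((V c (grid (J + k) (int (a k + 2))) \<omega> - V c (grid (J + k) (int (a k + 1))) \<omega>)
         - (V c (grid (J + k) (int (a k + 1))) \<omega> - V c (grid (J + k) (int (a k))) \<omega>)))"
    proof -
      have 1: "?m k \<le> (a k + 2) * 2 ^ (n - k)" "a k * 2 ^ (n - k) \<le> ?m k" by auto
      have "(\<Sum>i\<in>{?m k ..< (a k + 2) * 2 ^ (n - k)}. restrict (\<lambda>i. cell (J + n) i \<omega>) (?K k) (c, i))
         = V c (grid (J + k) (int (a k + 2))) \<omega> - V c (grid (J + k) (int (a k + 1))) \<omega>" if "c < 3" for c
        using tele[OF 1(1) _ that] 1 unfolding gr by auto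
      moreover have "(\<Sum>i\<in>{a k * 2 ^ (n - k) ..< ?m k}. restrict (\<lambda>i. cell (J + n) i \<omega>) (?K k) (c, i))
         = V c (grid (J + k) (int (a k + 1))) \<omega> - V c (grid (J + k) (int (a k))) \<omega>" if "c < 3" for c
        using tele[OF 1(2) _ that] 1 unfolding gr by auto
      ultimately show ?thesis by (intro arg_cong[where f = "\<lambda>x. sg k * x"] sum.cong refl) simp
    qed
    also have "\<dots> = sg k * dnoise s (J + k) (int (a k) + 2) (int (a k) + 1) \<omega>"
      unfolding dnoise_def noise_def sum_subtractf[symmetric]
      by (intro arg_cong[where f = "\<lambda>x. sg k * x"] sum.cong refl) (simp add: algebra_simps)
    finally show ?thesis .
  qed
  then show ?thesis
    by (intro iffD1[OF indep_vars_cong[OF refl _ refl] ind] ext)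
qed

end

section \<open>The index path of the localization step\<close>

lemma abs_diff_triangle: "\<bar>x - y\<bar> \<le> \<bar>x - w\<bar> + \<bar>w - y\<bar>" for x y w :: real
  by linarith

definition center :: "nat \<Rightarrow> int \<Rightarrow> real" where
  "center j i = (grid j i + grid j (i - 1)) / 2"

lemma center_eq: "center j i = (of_int i - 1 / 2) * mesh j"
  by (simp add: center_def grid_def field_simps)

lemma zhat_center: "zhat \<epsilon> yl ys = center (jhat \<epsilon> yl ys) (ihat yl (jhat \<epsilon> yl ys))"
  by (simp add: zhat_def center_def Let_def)

lemma ihat_Suc_in: "ihat yl (Suc j) \<in> {2 * ihat yl j - 2 .. 2 * ihat yl j + 1}"
  unfolding ihat.simps by (rule arg_min_if_finite(1)) auto

lemma ihat_Suc_min: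
  "k \<in> {2 * ihat yl j - 2 .. 2 * ihat yl j + 1} \<Longrightarrow>
    grid_increment yl (Suc j) (ihat yl (Suc j)) \<le> grid_increment yl (Suc j) k"
  unfolding ihat.simps
  using arg_min_if_finite(2)[of "{2 * ihat yl j - 2 .. 2 * ihat yl j + 1}" "grid_increment yl (Suc j)"]
  by (force simp: not_less)

lemma ihat_range: "1 \<le> ihat yl j \<and> ihat yl j \<le> 2 ^ j"
proof (induction j)
  case (Suc j)
  have "grid_increment yl (Suc j) (ihat yl (Suc j)) \<le> grid_increment yl (Suc j) (2 * ihat yl j)"
    by (rule ihat_Suc_min) auto
  also have "\<dots> < \<infinity>" using Suc by (simp add: grid_increment_def)
  finally show ?case by (auto simp: grid_increment_def simp del: ihat.simps split: if_splits)
qed simp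

text \<open>The four candidates have their centers at -3/2, -1/2, 1/2 and 3/2 new meshes from the
  old center. The new mesh is written as a difference of meshes so that the steps telescope in
  \<open>center_ihat\<close>.\<close>

lemma center_ihat_Suc:
  "\<bar>center (Suc j) (ihat yl (Suc j)) - center j (ihat yl j)\<bar> \<le> 3 / 2 * (mesh j - mesh (Suc j))"
proof -
  define e where "e = ihat yl (Suc j) - 2 * ihat yl j"
  have "-2 \<le> e" "e \<le> 1" using ihat_Suc_in[of yl j] by (auto simp: e_def)
  then have e: "-2 \<le> real_of_int e" "real_of_int e \<le> 1" by linarith+
  have i: "ihat yl (Suc j) = 2 * ihat yl j + e" by (simp add: e_def)
  have "center (Suc j) (ihat yl (Suc j)) - center j (ihat yl j) = (of_int e + 1/2) * (mesh j / 2)"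
    unfolding center_eq i mesh_Suc by (simp add: algebra_simps)
  also have "\<bar>\<dots>\<bar> = \<bar>of_int e + 1/2\<bar> * (mesh j / 2)"
    using mesh_pos[of j] by (simp add: abs_mult)
  also have "\<dots> \<le> 3/2 * (mesh j / 2)"
  proof (rule mult_right_mono)
    show "\<bar>real_of_int e + 1 / 2\<bar> \<le> 3 / 2" using e unfolding abs_le_iff by linarith
  qed (use mesh_pos[of j] in simp)
  finally show ?thesis by (simp add: mesh_Suc)
qed

lemma center_ihat:
  assumes "j \<le> k"
  shows "\<bar>center k (ihat yl k) - center j (ihat yl j)\<bar> \<le> 3 / 2 * (mesh j - mesh k)"
  using assms
proof (induction rule: dec_induct)
  case (step n)
  have "\<bar>center (Suc n) (ihat yl (Suc n)) - center j (ihat yl j)\<bar>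
      \<le> 3 / 2 * (mesh n - mesh (Suc n)) + 3 / 2 * (mesh j - mesh n)"
    by (rule order_trans[OF abs_diff_triangle add_mono[OF center_ihat_Suc step.IH]])
  then show ?case by (simp only: distrib_left[symmetric]) simp
qed simp

lemma center_01: "1 \<le> i \<Longrightarrow> i \<le> 2 ^ j \<Longrightarrow> center j i \<in> {0..1}"
  using grid_01[of i j] grid_01[of "i - 1" j] by (simp add: center_def)

text \<open>The index, counted from 1, of a cell containing \<open>z\<close>. The maximum takes care
  of \<open>z = 0\<close>, where the ceiling is 0.\<close>

definition istar :: "real \<Rightarrow> nat \<Rightarrow> int" where
  "istar z j = max 1 \<lceil>z * 2 ^ j\<rceil>"

lemma istar_range: "z \<le> 1 \<Longrightarrow> 1 \<le> istar z j \<and> istar z j \<le> 2 ^ j"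
proof -
  assume "z \<le> 1"
  then have "z * 2 ^ j \<le> real_of_int (2 ^ j)" by simp
  then have "\<lceil>z * 2 ^ j\<rceil> \<le> 2 ^ j" by (simp only: ceiling_le_iff)
  then show ?thesis by (simp add: istar_def)
qed

lemma istar_grid:
  assumes "0 \<le> z"
  shows "grid j (istar z j - 1) \<le> z" "z \<le> grid j (istar z j)"
proof -
  have p: "(0::real) < 2 ^ j" by simp
  have "z * 2 ^ j \<le> of_int (istar z j)"
  proof -
    have "\<lceil>z * 2 ^ j\<rceil> \<le> istar z j" by (simp add: istar_def)
    then show ?thesis by (simp only: ceiling_le_iff)
  qed
  then show "z \<le> grid j (istar z j)"
    using p by (simp add: grid_def mesh_def power_one_over field_simps)
  have "real_of_int (istar z j - 1) \<le> z * 2 ^ j"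
  proof (cases "\<lceil>z * 2 ^ j\<rceil> \<le> 1")
    case True
    then show ?thesis using assms by (simp add: istar_def max_def)
  next
    case False
    then have "istar z j = \<lceil>z * 2 ^ j\<rceil>" by (simp add: istar_def)
    then show ?thesis by linarith
  qed
  then show "grid j (istar z j - 1) \<le> z"
    using p by (simp add: grid_def mesh_def power_one_over field_simps)
qed

lemma istar_Suc:
  assumes "0 \<le> z"
  shows "istar z (Suc j) = 2 * istar z j - 1 \<or> istar z (Suc j) = 2 * istar z j"
proof -
  have "z * 2 ^ Suc j = 2 * (z * 2 ^ j)" by simp
  moreover have "0 \<le> z * 2 ^ j" using assms by simp
  moreover have "\<lceil>2 * x\<rceil> = 2 * \<lceil>x\<rceil> - 1 \<or> \<lceil>2 * x\<rceil> = 2 * \<lceil>x\<rceil>" for x :: real by linarith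
  ultimately have "\<lceil>z * 2 ^ Suc j\<rceil> = 2 * \<lceil>z * 2 ^ j\<rceil> - 1 \<or> \<lceil>z * 2 ^ Suc j\<rceil> = 2 * \<lceil>z * 2 ^ j\<rceil>" by metis
  moreover have "0 \<le> \<lceil>z * 2 ^ j\<rceil>" using \<open>0 \<le> z * 2 ^ j\<close> by linarith
  ultimately show ?thesis unfolding istar_def max_def by presburger
qed

lemma center_near_istar:
  assumes "0 \<le> z" "\<bar>i - istar z j\<bar> \<le> d"
  shows "\<bar>center j i - z\<bar> \<le> (of_int d + 1 / 2) * mesh j"
proof -
  have "center j i - center j (istar z j) = of_int (i - istar z j) * mesh j"
    by (simp add: center_eq algebra_simps)
  then have "\<bar>center j i - center j (istar z j)\<bar> \<le> of_int d * mesh j"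
    using mesh_pos[of j] assms(2) by (simp add: abs_mult flip: of_int_abs)
  moreover have "\<bar>center j (istar z j) - z\<bar> \<le> 1 / 2 * mesh j"
    using istar_grid[OF assms(1), of j] unfolding abs_le_iff center_eq grid_def
    by (simp add: field_simps)
  ultimately have "\<bar>center j i - z\<bar> \<le> of_int d * mesh j + 1 / 2 * mesh j"
    by (rule order_trans[OF abs_diff_triangle add_mono])
  then show ?thesis by (simp only: distrib_right)
qed

section \<open>Comparisons of increments and the pathwise error bound\<close>

definition in_range :: "nat \<Rightarrow> int \<Rightarrow> bool" where
  "in_range j i \<longleftrightarrow> 1 \<le> i \<and> i \<le> 2 ^ j"

definition incr :: "(real \<Rightarrow> real) \<Rightarrow> nat \<Rightarrow> int \<Rightarrow> real" where
  "incr y j i = y (grid j i) - y (grid j (i - 1))"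

lemma grid_increment_in: "in_range j i \<Longrightarrow> grid_increment y j i = ereal (incr y j i)"
  by (simp add: grid_increment_def in_range_def incr_def)

lemma grid_increment_out: "\<not> in_range j i \<Longrightarrow> grid_increment y j i = \<infinity>"
  by (auto simp: grid_increment_def in_range_def)

text \<open>Pairs \<open>(b, g)\<close> with \<open>g\<close> between \<open>b\<close> and the cell \<open>c\<close> of the minimizer: those whose
  comparison can derail the localization, and those used by the stopping rule near \<open>c\<close>.\<close>

definition loc_pairs :: "int \<Rightarrow> (int \<times> int) set" where
  "loc_pairs c = (\<lambda>(s, d). (c + s * (1 + d), c + s)) ` ({1, -1} \<times> {1, 2, 3})"

definition stop_pairs :: "int \<Rightarrow> (int \<times> int) set" where
  "stop_pairs c = (\<lambda>(s, d). (c + d + 6 * s, c + d + 5 * s)) ` ({1, -1} \<times> {-1, 0, 1})"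

definition uphill :: "int \<Rightarrow> int \<times> int \<Rightarrow> bool" where
  "uphill c = (\<lambda>(b, g). c < g \<and> g < b \<or> b < g \<and> g < c)"

lemma uphill_loc_pairs: "p \<in> loc_pairs c \<Longrightarrow> uphill c p"
  by (auto simp: loc_pairs_def uphill_def)

lemma uphill_stop_pairs: "p \<in> stop_pairs c \<Longrightarrow> uphill c p"
  by (auto simp: stop_pairs_def uphill_def)

lemma finite_pairs: "finite (loc_pairs c)" "finite (stop_pairs c)"
  by (simp_all add: loc_pairs_def stop_pairs_def)

lemma card_pairs: "card (loc_pairs c) \<le> 6" "card (stop_pairs c) \<le> 6"
  using card_image_le[of "{1, -1 :: int} \<times> {1, 2, 3 :: int}" "\<lambda>(s, d). (c + s * (1 + d), c + s)"]
    card_image_le[of "{1, -1 :: int} \<times> {-1, 0, 1 :: int}" "\<lambda>(s, d). (c + d + 6 * s, c + d + 5 * s)"]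
  by (simp_all add: loc_pairs_def stop_pairs_def card_cartesian_product)

definition crossing :: "(real \<Rightarrow> real) \<Rightarrow> nat \<Rightarrow> real \<Rightarrow> (int \<times> int) set \<Rightarrow> bool" where
  "crossing y j c P \<longleftrightarrow> (\<exists>(b, g)\<in>P. in_range j b \<and> in_range j g \<and> incr y j b - incr y j g \<le> c)"

text \<open>The chosen cell \<open>b\<close> has beaten the neighbor \<open>c + s\<close> of the
  cell \<open>c\<close> of the minimizer. The comparison is with \<open>c + s\<close> rather than
  \<open>c\<close> because \<open>c + s\<close> and \<open>b\<close> both lie entirely on one side
  of the minimizer, where the function is monotone.\<close>

lemma localization_step:
  assumes "0 \<le> z" "z \<le> 1" and good: "\<bar>ihat yl j - istar z j\<bar> \<le> 1"
    and bad: "\<not> \<bar>ihat yl (Suc j) - istar z (Suc j)\<bar> \<le> 1"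
  shows "crossing yl (Suc j) 0 (loc_pairs (istar z (Suc j)))"
    and "\<bar>ihat yl (Suc j) - istar z (Suc j)\<bar> \<le> 4"
proof -
  let ?b = "ihat yl (Suc j)" and ?c = "istar z (Suc j)" and ?i = "ihat yl j"
  define s :: int where "s = (if ?c < ?b then 1 else -1)"
  let ?g = "?c + s"
  have b_in: "?b \<in> {2 * ?i - 2 .. 2 * ?i + 1}" by (rule ihat_Suc_in)
  have c: "?c = 2 * istar z j - 1 \<or> ?c = 2 * istar z j" by (rule istar_Suc[OF assms(1)])
  show "\<bar>?b - ?c\<bar> \<le> 4" using b_in c good by auto
  have b_range: "in_range (Suc j) ?b" using ihat_range[of yl "Suc j"] by (simp add: in_range_def del: ihat.simps)
  have c_range: "1 \<le> ?c" "?c \<le> 2 ^ Suc j" using istar_range[OF assms(2), of "Suc j"] by auto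
  have g_range: "in_range (Suc j) ?g"
    using b_range c_range bad by (auto simp: in_range_def s_def simp del: ihat.simps)
  \<comment> \<open>The window may miss \<open>?c\<close>, but as an interval that contains
    \<open>?b\<close> and reaches at least to the neighbor of \<open>?c\<close> it contains
    \<open>?g\<close>.\<close>
  have g_in: "?g \<in> {2 * ?i - 2 .. 2 * ?i + 1}"
    using b_in c good bad by (auto simp: s_def)
  have "incr yl (Suc j) ?b \<le> incr yl (Suc j) ?g"
    using ihat_Suc_min[OF g_in] b_range g_range by (simp add: grid_increment_in)
  moreover have "(?b, ?g) \<in> loc_pairs ?c"
  proof -
    define d where "d = s * (?b - ?c) - 1"
    have "d \<in> {1, 2, 3}" using \<open>\<bar>?b - ?c\<bar> \<le> 4\<close> bad by (auto simp: d_def s_def simp del: ihat.simps)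
    moreover have "s \<in> {1, -1}" by (simp add: s_def)
    moreover have "?b = ?c + s * (1 + d)" by (auto simp: d_def s_def)
    ultimately show ?thesis unfolding loc_pairs_def by (force simp del: ihat.simps)
  qed
  ultimately show "crossing yl (Suc j) 0 (loc_pairs ?c)"
    using b_range g_range unfolding crossing_def by (intro bexI[of _ "(?b, ?g)"]) auto
qed

text \<open>Here \<open>k\<close> is the level at which the run of bad levels ending in
  \<open>j\<close> begins. The level before it is good, so \<open>localization_step\<close>
  applies.\<close>

lemma localization:
  assumes "0 \<le> z" "z \<le> 1" "\<not> \<bar>ihat yl j - istar z j\<bar> \<le> 1"
  shows "\<exists>k\<in>{1..j}. crossing yl k 0 (loc_pairs (istar z k)) \<and> \<bar>ihat yl k - istar z k\<bar> \<le> 4"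
  using assms(3)
proof (induction j)
  case 0
  have "istar z 0 = 1" using istar_range[OF assms(2), of 0] by simp
  then show ?case using 0 by simp
next
  case (Suc j)
  show ?case
  proof (cases "\<bar>ihat yl j - istar z j\<bar> \<le> 1")
    case True
    then show ?thesis using localization_step[OF assms(1,2) True Suc.prems]
      by (intro bexI[of _ "Suc j"]) (auto simp del: ihat.simps)
  next
    case False
    then obtain k where "k \<in> {1..j}" "crossing yl k 0 (loc_pairs (istar z k)) \<and> \<bar>ihat yl k - istar z k\<bar> \<le> 4"
      using Suc.IH by blast
    then show ?thesis by (intro bexI[of _ k]) auto
  qed
qed

text \<open>Removes the extended reals. A side whose outer cell is off the grid has statistic
  infinity and cannot trigger a stop; if the outer cell is on the grid, so is the inner one, since
  it lies between the outer cell and \<open>ihat yl j\<close>.\<close>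

lemma stop_stat_le_iff:
  assumes "0 < d"
  shows "stop_stat yl ys j / ereal d \<le> 2 \<longleftrightarrow> (\<exists>s\<in>{1, -1}. in_range j (ihat yl j + 6 * s) \<and>
    incr ys j (ihat yl j + 6 * s) - incr ys j (ihat yl j + 5 * s) \<le> 2 * d)"
proof -
  let ?i = "ihat yl j"
  have r: "1 \<le> ?i" "?i \<le> 2 ^ j" using ihat_range by auto
  have side: "grid_increment ys j (?i + 6 * s) - grid_increment ys j (?i + 5 * s) \<le> ereal (2 * d) \<longleftrightarrow>
      in_range j (?i + 6 * s) \<and> incr ys j (?i + 6 * s) - incr ys j (?i + 5 * s) \<le> 2 * d"
    if "s \<in> {1, -1}" for s
  proof (cases "in_range j (?i + 6 * s)")
    case True
    then have "in_range j (?i + 5 * s)" using that r by (auto simp: in_range_def)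
    then show ?thesis using True by (simp add: grid_increment_in)
  next
    case False
    then show ?thesis by (simp add: grid_increment_out)
  qed
  have "stop_stat yl ys j / ereal d \<le> 2 \<longleftrightarrow> stop_stat yl ys j \<le> ereal (2 * d)"
    using assms by (subst ereal_divide_le_pos) (auto simp: mult.commute)
  also have "\<dots> \<longleftrightarrow> (\<exists>s\<in>{1, -1}. grid_increment ys j (?i + 6 * s) - grid_increment ys j (?i + 5 * s) \<le> ereal (2 * d))"
    by (simp add: stop_stat_def Let_def min_le_iff_disj)
  also have "\<dots> \<longleftrightarrow> (\<exists>s\<in>{1, -1}. in_range j (?i + 6 * s) \<and>
      incr ys j (?i + 6 * s) - incr ys j (?i + 5 * s) \<le> 2 * d)"
    by (intro bex_cong refl side)
  finally show ?thesis .
qed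

text \<open>Bounds the error path by path, so that taking expectations only needs the probabilities
  of crossings at fixed cells. \<open>N\<close> is a free reference level: a correct index at level
  \<open>min j N\<close> is either close enough already or reveals a premature stop.\<close>

lemma zhat_error:
  assumes z: "0 \<le> z" "z \<le> 1" and \<epsilon>: "0 < \<epsilon>"
    and stop: "\<exists>j. stop_stat yl ys j / ereal (stop_sd \<epsilon> j) \<le> 2"
  shows "\<bar>zhat \<epsilon> yl ys - z\<bar> \<le> 3 * mesh N
    + (\<Sum>k\<in>{1..N}. 6 * mesh k * of_bool (crossing yl k 0 (loc_pairs (istar z k))))
    + (\<Sum>k\<in>{k. k + 2 \<le> N}. 3 / 2 * mesh k * of_bool (crossing ys k (2 * stop_sd \<epsilon> k) (stop_pairs (istar z k))))"
    (is "?err \<le> _ + ?A + ?B")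
proof -
  define j where "j = jhat \<epsilon> yl ys"
  define n where "n = min j N"
  have zh: "zhat \<epsilon> yl ys = center j (ihat yl j)" by (simp add: zhat_center j_def)
  have stop_j: "stop_stat yl ys j / ereal (stop_sd \<epsilon> j) \<le> 2"
    unfolding j_def jhat_def using stop by (rule LeastI_ex)
  have mp: "0 < mesh k" for k by (rule mesh_pos)
  have mp0: "0 \<le> mesh k" for k using mesh_pos[of k] by simp
  have fin: "finite {k. k + 2 \<le> N}" by (rule finite_subset[of _ "{..N}"]) auto
  have A0: "0 \<le> ?A" and B0: "0 \<le> ?B"
    using mp0 by (auto intro!: sum_nonneg mult_nonneg_nonneg)
  have move: "\<bar>zhat \<epsilon> yl ys - center k (ihat yl k)\<bar> \<le> 3 / 2 * mesh k" if "k \<le> j" for k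
    using center_ihat[OF that, of yl] mp[of j] by (simp add: zh)
  show ?thesis
  proof (cases "\<bar>ihat yl n - istar z n\<bar> \<le> 1")
    case True
    then have near: "\<bar>center n (ihat yl n) - z\<bar> \<le> 3 / 2 * mesh n"
      using center_near_istar[OF z(1), of "ihat yl n" n 1] by simp
    \<comment> \<open>Stopping one level above \<open>N\<close> with a correct index costs
      \<open>3 / 2 * mesh j = 3 * mesh N\<close>, as much as reaching \<open>N\<close>. Hence only
      levels with \<open>k + 2 \<le> N\<close> are charged for a premature stop.\<close>
    consider "n = N" | "j < N" "n = j" "N = Suc j" | "j < N" "n = j" "j + 2 \<le> N"
      unfolding n_def by linarith
    then show ?thesis
    proof cases
      case 1
      then have "n \<le> j" by (simp add: n_def)
      from order_trans[OF abs_diff_triangle add_mono[OF move[OF this] near]]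
      have "?err \<le> 3 * mesh N" using 1 by simp
      then show ?thesis using A0 B0 by linarith
    next
      case 2
      then have "?err \<le> 3 / 2 * mesh j" using near by (simp add: zh)
      also have "\<dots> = 3 * mesh N" using 2 by (simp add: mesh_Suc)
      finally show ?thesis using A0 B0 by linarith
    next
      case 3
      have sd: "0 < stop_sd \<epsilon> j" using \<epsilon> mp by (simp add: stop_sd_def)
      obtain s where s: "s \<in> {1, -1}" "in_range j (ihat yl j + 6 * s)"
        "incr ys j (ihat yl j + 6 * s) - incr ys j (ihat yl j + 5 * s) \<le> 2 * stop_sd \<epsilon> j"
        using iffD1[OF stop_stat_le_iff[OF sd] stop_j] by blast
      have "crossing ys j (2 * stop_sd \<epsilon> j) (stop_pairs (istar z j))"
        unfolding crossing_def
      proof (intro bexI[of _ "(ihat yl j + 6 * s, ihat yl j + 5 * s)"], clarify, intro conjI)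
        show "in_range j (ihat yl j + 5 * s)"
          using s ihat_range[of yl j] by (auto simp: in_range_def)
        have "ihat yl j - istar z j \<in> {-1, 0, 1}" using True 3 by auto
        moreover have "ihat yl j = istar z j + (ihat yl j - istar z j)" by simp
        ultimately show "(ihat yl j + 6 * s, ihat yl j + 5 * s) \<in> stop_pairs (istar z j)"
          using s(1) unfolding stop_pairs_def by (intro image_eqI[of _ _ "(s, ihat yl j - istar z j)"]) auto
      qed (use s in auto)
      then have "3 / 2 * mesh j \<le> ?B"
        using member_le_sum[of j "{k. k + 2 \<le> N}" "\<lambda>k. 3 / 2 * mesh k *
          of_bool (crossing ys k (2 * stop_sd \<epsilon> k) (stop_pairs (istar z k)))"] 3 fin mp0
        by simp
      moreover have "?err \<le> 3 / 2 * mesh j" using near 3 by (simp add: zh)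
      ultimately show ?thesis using A0 mp[of N] by linarith
    qed
  next
    case False
    then obtain k where k: "k \<in> {1..n}" "crossing yl k 0 (loc_pairs (istar z k))" "\<bar>ihat yl k - istar z k\<bar> \<le> 4"
      using localization[OF z False] by blast
    have "k \<le> j" using k(1) by (simp add: n_def)
    \<comment> \<open>All later moves contribute \<open>3 / 2 * mesh k\<close>, and an index at most
      4 cells off contributes \<open>9 / 2 * mesh k\<close>.\<close>
    from order_trans[OF abs_diff_triangle add_mono[OF move[OF this] center_near_istar[OF z(1) k(3)]]]
    have "?err \<le> 6 * mesh k" by simp
    also have "6 * mesh k \<le> ?A"
      using member_le_sum[of k "{1..N}" "\<lambda>k. 6 * mesh k * of_bool (crossing yl k 0 (loc_pairs (istar z k)))"]
        k mp0 by (simp add: n_def)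
    finally show ?thesis using B0 mp[of N] by linarith
  qed
qed

section \<open>Increments of the drift\<close>

context convex_fn begin

definition drift :: "nat \<Rightarrow> int \<Rightarrow> real" where
  "drift j i = (LINT u:{grid j (i - 1)<..grid j i}|lborel. f u)"

lemma drift_eq:
  assumes "in_range j i"
  shows "(LINT u:{0..grid j i}|lborel. f u) - (LINT u:{0..grid j (i - 1)}|lborel. f u) = drift j i"
  unfolding drift_def
  using assms grid_01[of i j] grid_01[of "i - 1" j] grid_mono[of "i - 1" i j]
  by (intro set_integral_Ioc_diff f_set_integrable) (auto simp: in_range_def)

lemma cell_subset: "in_range j i \<Longrightarrow> {grid j (i - 1)<..grid j i} \<subseteq> {0..1}"
  using grid_01[of i j] grid_01[of "i - 1" j] by (auto simp: in_range_def)

lemma abs_drift_le: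
  assumes "in_range j i"
  shows "\<bar>drift j i\<bar> \<le> (\<bar>fmax\<bar> + \<bar>M\<bar>) * mesh j"
proof -
  let ?A = "{grid j (i - 1)<..grid j i}"
  have i: "set_integrable lborel ?A f"
    using cell_subset[OF assms] by (intro f_set_integrable) auto
  have m: "measure lborel ?A = mesh j"
    using grid_mono[of "i - 1" i j] grid_diff[of j i "i - 1"] by simp
  have "\<bar>drift j i\<bar> \<le> (LINT u:?A|lborel. \<bar>f u\<bar>)"
    unfolding drift_def using set_integral_norm_bound[OF i] by simp
  also have "\<dots> \<le> (LINT u:?A|lborel. \<bar>fmax\<bar> + \<bar>M\<bar>)"
  proof (rule set_integral_mono)
    show "set_integrable lborel ?A (\<lambda>u. \<bar>f u\<bar>)" using set_integrable_abs[OF i] .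
    show "set_integrable lborel ?A (\<lambda>u. \<bar>fmax\<bar> + \<bar>M\<bar>)"
      using grid_mono[of "i - 1" i j] by (simp add: set_integrable_def integrable_real_indicator)
    show "\<bar>f u\<bar> \<le> \<bar>fmax\<bar> + \<bar>M\<bar>" if "u \<in> ?A" for u
      using that cell_subset[OF assms] by (intro abs_f_le) auto
  qed
  also have "\<dots> = (\<bar>fmax\<bar> + \<bar>M\<bar>) * mesh j"
    unfolding set_lebesgue_integral_def using m by simp
  finally show ?thesis .
qed

end

context convex_fn_eps begin

text \<open>Moves the integral over cell \<open>b\<close> to cell \<open>g\<close>, so that the two
  drifts can be compared pointwise.\<close>

lemma drift_shift:
  "drift j b = (LINT u:{grid j (g - 1)<..grid j g}|lborel. f (u + (grid j b - grid j g)))"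
proof -
  let ?h = "grid j b - grid j g"
  have "drift j b = (\<integral>x. indicator {grid j (b - 1)<..grid j b} (?h + 1 * x) *\<^sub>R f (?h + 1 * x) \<partial>lborel)"
    unfolding drift_def set_lebesgue_integral_def
    by (subst lborel_integral_real_affine[of 1 _ ?h]) simp_all
  also have "\<dots> = (LINT u:{grid j (g - 1)<..grid j g}|lborel. f (u + ?h))"
    unfolding set_lebesgue_integral_def
    by (intro Bochner_Integration.integral_cong refl)
       (auto simp: indicator_def grid_def algebra_simps)
  finally show ?thesis .
qed

text \<open>Every point of cell \<open>g\<close> lies on one side of \<open>Z\<close>, and the shift
  to cell \<open>b\<close> leads further away by at least one mesh, which exceeds \<rho>. So
  \<open>steep\<close> gives \<open>\<mu> * mesh j / \<rho>\<close> pointwise; integration over the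
  cell adds one more factor \<open>mesh j\<close>.\<close>

lemma drift_gap:
  assumes r: "in_range j b" "in_range j g" and up: "uphill (istar Z j) (b, g)" and m: "\<rho> < mesh j"
  shows "\<mu> * (mesh j)\<^sup>2 / \<rho> \<le> drift j b - drift j g"
proof -
  let ?A = "{grid j (g - 1)<..grid j g}" and ?h = "grid j b - grid j g"
  have sub: "?A \<subseteq> {0..1}" by (rule cell_subset[OF r(2)])
  have h: "?h = of_int (b - g) * mesh j" by (rule grid_diff)
  have mp: "0 < mesh j" by (rule mesh_pos)
  have h_ge: "mesh j \<le> \<bar>?h\<bar>"
  proof -
    have "1 \<le> \<bar>b - g\<bar>" using up by (auto simp: uphill_def)
    then have "1 \<le> \<bar>real_of_int (b - g)\<bar>" by (simp flip: of_int_abs)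
    then show ?thesis using mp unfolding h abs_mult by simp
  qed
  have moved: "u + ?h \<in> {grid j (b - 1)<..grid j b}" if "u \<in> ?A" for u
    using that by (auto simp: grid_def algebra_simps)
  have c: "\<mu> * mesh j / \<rho> \<le> f (u + ?h) - f u" if u: "u \<in> ?A" for u
  proof -
    have "0 \<le> (u - Z) * ?h"
    proof (cases "istar Z j < g \<and> g < b")
      case True
      have "grid j (istar Z j) \<le> grid j (g - 1)"
        using True mp by (simp add: grid_def)
      then have "Z \<le> u" using istar_grid(2)[OF Z_bounds(1), of j] u by auto
      moreover have "0 \<le> ?h" using True grid_mono[of g b j] by simp
      ultimately show ?thesis by simp
    next
      case False
      then have lt: "b < g" "g < istar Z j" using up by (auto simp: uphill_def)
      have "grid j g \<le> grid j (istar Z j - 1)"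
        using lt mp by (simp add: grid_def)
      then have "u \<le> Z" using istar_grid(1)[OF Z_bounds(1), of j] u by auto
      moreover have "?h \<le> 0" using lt grid_mono[of b g j] by simp
      ultimately show ?thesis by (simp add: mult_nonpos_nonpos)
    qed
    moreover have "u \<in> {0..1}" "u + ?h \<in> {0..1}"
      using sub u moved[OF u] cell_subset[OF r(1)] by blast+
    ultimately have "\<mu> * \<bar>?h\<bar> / \<rho> \<le> f (u + ?h) - f u"
      using steep[of u "u + ?h"] m h_ge by simp
    moreover have "\<mu> * mesh j / \<rho> \<le> \<mu> * \<bar>?h\<bar> / \<rho>"
      using h_ge rho_m_pos rho_z_pos by (intro divide_right_mono mult_left_mono) auto
    ultimately show ?thesis by linarith
  qed
  have i1: "set_integrable lborel ?A f" using sub by (intro f_set_integrable) auto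
  have i2: "set_integrable lborel ?A (\<lambda>u. f (u + ?h))"
  proof -
    have "integrable lborel (\<lambda>x. indicator {grid j (b - 1)<..grid j b} x *\<^sub>R f x)"
      using f_set_integrable[of "{grid j (b - 1)<..grid j b}"] cell_subset[OF r(1)]
      by (simp add: set_integrable_def)
    then have "integrable lborel (\<lambda>x. indicator {grid j (b - 1)<..grid j b} (?h + 1 * x) *\<^sub>R f (?h + 1 * x))"
      by (rule lborel_integrable_real_affine) simp
    moreover have "(\<lambda>x. indicator {grid j (b - 1)<..grid j b} (?h + 1 * x) *\<^sub>R f (?h + 1 * x))
       = (\<lambda>u. indicator ?A u *\<^sub>R f (u + ?h))"
      by (auto simp: fun_eq_iff indicator_def grid_def algebra_simps)
    ultimately show ?thesis by (simp add: set_integrable_def)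
  qed
  have meas: "measure lborel ?A = mesh j"
    using grid_mono[of "g - 1" g j] grid_diff[of j g "g - 1"] by simp
  have "\<mu> * (mesh j)\<^sup>2 / \<rho> = (LINT u:?A|lborel. \<mu> * mesh j / \<rho>)"
    unfolding set_lebesgue_integral_def using meas by (simp add: power2_eq_square)
  also have "\<dots> \<le> (LINT u:?A|lborel. f (u + ?h) - f u)"
  proof (rule set_integral_mono)
    show "set_integrable lborel ?A (\<lambda>u. \<mu> * mesh j / \<rho>)"
      using grid_mono[of "g - 1" g j] by (simp add: set_integrable_def integrable_real_indicator)
    show "set_integrable lborel ?A (\<lambda>u. f (u + ?h) - f u)"
      by (rule set_integral_diff(1)[OF i2 i1])
  qed (rule c)
  also have "\<dots> = drift j b - drift j g"
    unfolding set_integral_diff(2)[OF i2 i1] drift_shift[of j b g] by (simp add: drift_def)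
  finally show ?thesis .
qed

end

section \<open>Localization and stopping errors\<close>

locale estimation = convex_fn_eps f \<epsilon> + white_noise_copies \<Omega> W B1 B2
  for f :: "real \<Rightarrow> real" and \<epsilon> :: real and \<Omega> :: "'w measure" and W B1 B2 :: "real \<Rightarrow> 'w \<Rightarrow> real"
begin

definition copy :: "real \<Rightarrow> 'w \<Rightarrow> real \<Rightarrow> real" where
  "copy s \<omega> t = (LINT u:{0..t}|lborel. f u) + \<epsilon> * noise s t \<omega>"

lemma estimator_copy:
  "minimizer_estimator \<epsilon> (white_noise \<epsilon> f (\<lambda>t. W t \<omega>)) (\<lambda>t. B1 t \<omega>) (\<lambda>t. B2 t \<omega>)
    = zhat \<epsilon> (copy 1 \<omega>) (copy (- 1) \<omega>)"
proof -
  have "localization_copy \<epsilon> (white_noise \<epsilon> f (\<lambda>t. W t \<omega>)) (\<lambda>t. B1 t \<omega>) (\<lambda>t. B2 t \<omega>) = copy 1 \<omega>"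
    by (simp add: fun_eq_iff localization_copy_def white_noise_def copy_def noise_eq algebra_simps)
  moreover have "stopping_copy \<epsilon> (white_noise \<epsilon> f (\<lambda>t. W t \<omega>)) (\<lambda>t. B1 t \<omega>) (\<lambda>t. B2 t \<omega>) = copy (- 1) \<omega>"
    by (simp add: fun_eq_iff stopping_copy_def white_noise_def copy_def noise_eq algebra_simps)
  ultimately show ?thesis by (simp add: minimizer_estimator_def)
qed

lemma incr_copy_diff:
  assumes "in_range j b" "in_range j g"
  shows "incr (copy s \<omega>) j b - incr (copy s \<omega>) j g = (drift j b - drift j g) + \<epsilon> * dnoise s j b g \<omega>"
  using drift_eq[OF assms(1)] drift_eq[OF assms(2)]
  by (simp add: incr_def copy_def dnoise_def algebra_simps)

lemma stop_sd_eq: "stop_sd \<epsilon> j = \<epsilon> * sqrt (6 * mesh j)"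
  using eps by (simp add: stop_sd_def real_sqrt_mult)

text \<open>A signal-to-noise ratio: the mean increase guaranteed by \<open>drift_gap\<close>, in
  standard deviations of the difference of two increments.\<close>

definition snr :: "nat \<Rightarrow> real" where
  "snr j = \<mu> * (mesh j)\<^sup>2 / \<rho> / stop_sd \<epsilon> j"

lemma snr_pos: "0 < snr j"
  using rho_m_pos rho_z_pos eps mesh_pos[of j] by (simp add: snr_def stop_sd_eq)

text \<open>The square equals \<open>\<mu>\<^sup>2 * mesh j ^ 3 / (6 * \<rho>\<^sup>2 *
  \<epsilon>\<^sup>2)\<close>; \<open>eps_le\<close> eliminates \<mu> and \<epsilon> and doubles the
  6.\<close>

lemma snr_ge: "(mesh j / \<rho>) ^ 3 / 12 \<le> (snr j)\<^sup>2"
proof -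
  let ?m = "mesh j"
  have mp: "0 < ?m" by (rule mesh_pos)
  have "(snr j)\<^sup>2 = \<mu>\<^sup>2 * ?m ^ 3 / (6 * \<rho>\<^sup>2 * \<epsilon>\<^sup>2)"
    using mp eps rho_z_pos
    by (simp add: snr_def stop_sd_eq power_divide power_mult_distrib field_simps power2_eq_square power3_eq_cube)
  moreover have "(?m / \<rho>) ^ 3 / 12 = ?m ^ 3 * \<epsilon>\<^sup>2 / (12 * \<rho> ^ 3 * \<epsilon>\<^sup>2)"
    using eps by (simp add: power_divide)
  moreover have "?m ^ 3 * \<epsilon>\<^sup>2 / (12 * \<rho> ^ 3 * \<epsilon>\<^sup>2) \<le> ?m ^ 3 * (2 * \<rho> * \<mu>\<^sup>2) / (12 * \<rho> ^ 3 * \<epsilon>\<^sup>2)"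
    using mp rho_z_pos eps by (intro divide_right_mono mult_left_mono eps_le) auto
  moreover have "?m ^ 3 * (2 * \<rho> * \<mu>\<^sup>2) / (12 * \<rho> ^ 3 * \<epsilon>\<^sup>2) = \<mu>\<^sup>2 * ?m ^ 3 / (6 * \<rho>\<^sup>2 * \<epsilon>\<^sup>2)"
    using rho_z_pos eps by (simp add: field_simps power2_eq_square power3_eq_cube)
  ultimately show ?thesis by linarith
qed

lemma crossing_sets:
  "{\<omega> \<in> space \<Omega>. in_range j b \<and> in_range j g \<and> incr (copy s \<omega>) j b - incr (copy s \<omega>) j g \<le> c} \<in> sets \<Omega>"
proof (cases "in_range j b \<and> in_range j g")
  case True
  then have [measurable]: "dnoise s j b g \<in> borel_measurable \<Omega>"
    by (intro dnoise_measurable) (auto simp: in_range_def)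
  have "{\<omega> \<in> space \<Omega>. (drift j b - drift j g) + \<epsilon> * dnoise s j b g \<omega> \<le> c} \<in> sets \<Omega>"
    by measurable
  then show ?thesis using True by (simp add: incr_copy_diff)
next
  case False
  then show ?thesis by auto
qed

text \<open>A crossing forces the centered noise beyond \<open>snr j - c\<close> standard
  deviations. The offset is \<open>c = 0\<close> for localization and \<open>c = 2\<close> for the
  stopping threshold.\<close>

lemma pair_prob:
  assumes s: "s = 1 \<or> s = -1" and up: "uphill (istar Z j) (b, g)" and m: "\<rho> < mesh j"
    and c: "0 < snr j - c"
  shows "prob {\<omega> \<in> space \<Omega>. in_range j b \<and> in_range j g \<and>
     incr (copy s \<omega>) j b - incr (copy s \<omega>) j g \<le> c * stop_sd \<epsilon> j} \<le> 1 / (snr j - c)\<^sup>2"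
proof (cases "in_range j b \<and> in_range j g")
  case True
  let ?d = "sqrt (6 * mesh j)" and ?x = "(snr j - c) * sqrt (6 * mesh j)"
  have d: "0 < ?d" using mesh_pos[of j] by simp
  have ne: "g \<noteq> b" using up by (auto simp: uphill_def)
  have nrm: "distributed \<Omega> lborel (dnoise s j g b) (normal_density 0 ?d)"
    using True ne by (intro dnoise_normal[OF s]) (auto simp: in_range_def)
  have [measurable]: "dnoise s j g b \<in> borel_measurable \<Omega>"
    using True by (intro dnoise_measurable) (auto simp: in_range_def)
  have sd: "0 < stop_sd \<epsilon> j" using d eps by (simp add: stop_sd_eq)
  have "?x \<le> dnoise s j g b \<omega>" if le: "incr (copy s \<omega>) j b - incr (copy s \<omega>) j g \<le> c * stop_sd \<epsilon> j" for \<omega>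
  proof -
    have "snr j * stop_sd \<epsilon> j \<le> drift j b - drift j g"
      using drift_gap[of j b g] True up m sd by (simp add: snr_def)
    then have "snr j * stop_sd \<epsilon> j + \<epsilon> * dnoise s j b g \<omega> \<le> c * stop_sd \<epsilon> j"
      using le True by (simp add: incr_copy_diff)
    then have "\<epsilon> * ?x \<le> \<epsilon> * dnoise s j g b \<omega>"
      by (simp add: dnoise_swap[of s j g b] stop_sd_eq algebra_simps)
    then show ?thesis using eps by simp
  qed
  then have "prob {\<omega> \<in> space \<Omega>. in_range j b \<and> in_range j g \<and>
     incr (copy s \<omega>) j b - incr (copy s \<omega>) j g \<le> c * stop_sd \<epsilon> j} \<le> prob {\<omega> \<in> space \<Omega>. ?x \<le> dnoise s j g b \<omega>}"
    by (intro finite_measure_mono) auto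
  also have "\<dots> \<le> ?d\<^sup>2 / (?d\<^sup>2 + ?x\<^sup>2)"
    using c d by (intro normal_upper_tail[OF nrm]) auto
  also have "\<dots> = 1 / (1 + (snr j - c)\<^sup>2)"
  proof -
    have "?d\<^sup>2 + ?x\<^sup>2 = ?d\<^sup>2 * (1 + (snr j - c)\<^sup>2)" by (simp only: power_mult_distrib) (simp add: algebra_simps)
    moreover have "?d\<^sup>2 / (?d\<^sup>2 * (1 + (snr j - c)\<^sup>2)) = 1 / (1 + (snr j - c)\<^sup>2)"
      by (rule nonzero_divide_mult_cancel_left) (use d in simp)
    ultimately show ?thesis by (simp only:)
  qed
  also have "\<dots> \<le> 1 / (snr j - c)\<^sup>2"
    using c by (intro divide_left_mono mult_pos_pos) (auto simp: add_pos_nonneg)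
  finally show ?thesis .
next
  case False
  then have "{\<omega> \<in> space \<Omega>. in_range j b \<and> in_range j g \<and>
     incr (copy s \<omega>) j b - incr (copy s \<omega>) j g \<le> c * stop_sd \<epsilon> j} = {}" by auto
  then show ?thesis by (simp only: measure_empty) simp
qed

definition pair_event :: "real \<Rightarrow> nat \<Rightarrow> real \<Rightarrow> int \<times> int \<Rightarrow> 'w set" where
  "pair_event s j c p = {\<omega> \<in> space \<Omega>. in_range j (fst p) \<and> in_range j (snd p) \<and>
     incr (copy s \<omega>) j (fst p) - incr (copy s \<omega>) j (snd p) \<le> c}"

lemma crossing_UN:
  "{\<omega> \<in> space \<Omega>. crossing (copy s \<omega>) j c P} = (\<Union>p\<in>P. pair_event s j c p)"
  unfolding crossing_def pair_event_def case_prod_beta by blast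

lemma pair_event_sets: "pair_event s j c p \<in> sets \<Omega>"
  unfolding pair_event_def by (rule crossing_sets)

lemma crossing_event:
  "finite P \<Longrightarrow> {\<omega> \<in> space \<Omega>. crossing (copy s \<omega>) j c P} \<in> sets \<Omega>"
  unfolding crossing_UN by (intro sets.finite_UN pair_event_sets)

lemma crossing_prob:
  assumes P: "finite P" "card P \<le> 6" "\<And>p. p \<in> P \<Longrightarrow> uphill (istar Z j) p"
    and s: "s = 1 \<or> s = -1" and m: "\<rho> < mesh j" and c: "0 < snr j - c"
  shows "prob {\<omega> \<in> space \<Omega>. crossing (copy s \<omega>) j (c * stop_sd \<epsilon> j) P} \<le> 6 / (snr j - c)\<^sup>2"
proof -
  let ?E = "pair_event s j (c * stop_sd \<epsilon> j)"
  have "prob {\<omega> \<in> space \<Omega>. crossing (copy s \<omega>) j (c * stop_sd \<epsilon> j) P} \<le> (\<Sum>p\<in>P. prob (?E p))"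
    unfolding crossing_UN using pair_event_sets
    by (intro finite_measure_subadditive_finite P(1)) blast
  also have "\<dots> \<le> (\<Sum>p\<in>P. 1 / (snr j - c)\<^sup>2)"
  proof (rule sum_mono)
    fix p assume "p \<in> P"
    then have "uphill (istar Z j) (fst p, snd p)" using P(3) by simp
    then show "prob (?E p) \<le> 1 / (snr j - c)\<^sup>2"
      unfolding pair_event_def by (rule pair_prob[OF s _ m c])
  qed
  also have "\<dots> = real (card P) * (1 / (snr j - c)\<^sup>2)" by simp
  also have "\<dots> \<le> 6 * (1 / (snr j - c)\<^sup>2)"
    using P(2) by (intro mult_right_mono) auto
  finally show ?thesis by simp
qed

lemma loc_prob:
  assumes "\<rho> < mesh j"
  shows "prob {\<omega> \<in> space \<Omega>. crossing (copy 1 \<omega>) j 0 (loc_pairs (istar Z j))} \<le> 72 * (\<rho> / mesh j) ^ 3"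
proof -
  have mp: "0 < mesh j" by (rule mesh_pos)
  have "prob {\<omega> \<in> space \<Omega>. crossing (copy 1 \<omega>) j (0 * stop_sd \<epsilon> j) (loc_pairs (istar Z j))} \<le> 6 / (snr j - 0)\<^sup>2"
    using finite_pairs card_pairs uphill_loc_pairs snr_pos[of j] assms by (intro crossing_prob) auto
  also have "\<dots> \<le> 6 / ((mesh j / \<rho>) ^ 3 / 12)"
    using snr_ge[of j] snr_pos[of j] mp rho_z_pos by (intro divide_left_mono mult_pos_pos) auto
  also have "\<dots> = 72 * (\<rho> / mesh j) ^ 3"
    by (simp add: power_divide)
  finally show ?thesis by simp
qed

text \<open>A mesh of at least \<open>6 * \<rho>\<close> makes \<open>(snr j)\<^sup>2\<close> at
  least 216 / 12 = 18, hence \<open>snr j \<ge> 4\<close>. Subtracting the threshold 2 then costs at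
  most half of it, a factor 4 against \<open>loc_prob\<close>: 288 = 4 * 72.\<close>

lemma stop_prob:
  assumes "6 * \<rho> \<le> mesh j"
  shows "prob {\<omega> \<in> space \<Omega>. crossing (copy (- 1) \<omega>) j (2 * stop_sd \<epsilon> j) (stop_pairs (istar Z j))}
    \<le> 288 * (\<rho> / mesh j) ^ 3"
proof -
  have mp: "0 < mesh j" by (rule mesh_pos)
  have "6 \<le> mesh j / \<rho>" using assms rho_z_pos by (simp add: pos_le_divide_eq)
  then have "6 ^ 3 \<le> (mesh j / \<rho>) ^ 3" by (rule power_mono) simp
  then have "4\<^sup>2 \<le> (snr j)\<^sup>2" using snr_ge[of j] by simp
  then have ge: "4 \<le> snr j" using snr_pos[of j] by (rule power2_le_imp_le[OF _ less_imp_le])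
  have "\<rho> < mesh j" using assms rho_z_pos by linarith
  then have "prob {\<omega> \<in> space \<Omega>. crossing (copy (- 1) \<omega>) j (2 * stop_sd \<epsilon> j) (stop_pairs (istar Z j))}
      \<le> 6 / (snr j - 2)\<^sup>2"
    using ge by (intro crossing_prob finite_pairs card_pairs uphill_stop_pairs) auto
  also have "\<dots> \<le> 6 / (snr j / 2)\<^sup>2"
  proof (rule divide_left_mono)
    show "(snr j / 2)\<^sup>2 \<le> (snr j - 2)\<^sup>2" using ge by (intro power_mono) auto
    show "0 < (snr j - 2)\<^sup>2 * (snr j / 2)\<^sup>2"
      using ge by (intro mult_pos_pos zero_less_power) auto
  qed simp
  also have "\<dots> = 24 / (snr j)\<^sup>2" by (simp add: power_divide)
  also have "\<dots> \<le> 24 / ((mesh j / \<rho>) ^ 3 / 12)"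
    using snr_ge[of j] snr_pos[of j] mp rho_z_pos by (intro divide_left_mono mult_pos_pos) auto
  also have "\<dots> = 288 * (\<rho> / mesh j) ^ 3"
    by (simp add: power_divide)
  finally show ?thesis .
qed

end

section \<open>The stopping level exists almost surely\<close>

text \<open>A value \<open>e k\<close> in \<open>{0..3}\<close> selects one of the four candidates
  of \<open>ihat\<close>. Fixing the steps makes the cells inspected by the stopping rule
  deterministic, so that independence can be used; a union over all \<open>e\<close> recovers the
  random path.\<close>

primrec walk :: "int \<Rightarrow> (nat \<Rightarrow> int) \<Rightarrow> nat \<Rightarrow> int" where
  "walk i e 0 = i"
| "walk i e (Suc k) = 2 * walk i e k - 2 + e k"

lemma walk_cong: "(\<And>l. l < k \<Longrightarrow> e l = e' l) \<Longrightarrow> walk i e k = walk i e' k"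
  by (induction k) auto

text \<open>Twice the centers of the cells of a walk, in units of the cells of level \<open>n\<close>.\<close>

lemma walk_center:
  assumes e: "\<And>l. l < n \<Longrightarrow> e l \<in> {0..3}" and "k \<le> l" "l \<le> n"
  shows "\<bar>(2 * walk i e l - 1) * 2 ^ (n - l) - (2 * walk i e k - 1) * 2 ^ (n - k)\<bar>
    \<le> 3 * (2 ^ (n - k) - 2 ^ (n - l))"
  using assms(2,3)
proof (induction l rule: dec_induct)
  case (step l)
  define q :: int where "q = 2 ^ (n - Suc l)"
  have q: "0 < q" "2 ^ (n - l) = 2 * q"
    using step.prems by (simp_all add: q_def flip: power_Suc Suc_diff_Suc)
  have "(2 * walk i e (Suc l) - 1) * q - (2 * walk i e l - 1) * (2 * q) = (2 * e l - 3) * q"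
    by (simp add: algebra_simps)
  moreover have "\<bar>(2 * e l - 3) * q\<bar> \<le> 3 * q"
    using e[of l] step.prems q(1) by (auto simp: abs_mult intro!: mult_right_mono)
  ultimately have 1: "\<bar>(2 * walk i e (Suc l) - 1) * q - (2 * walk i e l - 1) * (2 * q)\<bar> \<le> 3 * q" by simp
  have 2: "\<bar>(2 * walk i e l - 1) * (2 * q) - (2 * walk i e k - 1) * 2 ^ (n - k)\<bar> \<le> 3 * (2 ^ (n - k) - 2 * q)"
    using step.IH step.prems q(2) by simp
  have tri: "\<bar>x - y\<bar> \<le> \<bar>x - w\<bar> + \<bar>w - y\<bar>" for x y w :: int by linarith
  show ?case
    using order_trans[OF tri add_mono[OF 1 2]] by (simp add: q_def)
qed simp

text \<open>Left edge of the two cells compared on one side of cell \<open>i\<close>, counted from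
  0: the upper side if it fits on the grid, otherwise the lower. On the lower side the outer cell is
  the left one, which reverses the sign recorded in \<open>stop_side\<close>.\<close>

definition stop_base :: "nat \<Rightarrow> int \<Rightarrow> int" where
  "stop_base j i = (if in_range j (i + 6) then i + 4 else i - 7)"

definition stop_side :: "nat \<Rightarrow> int \<Rightarrow> real" where
  "stop_side j i = (if in_range j (i + 6) then 1 else -1)"

text \<open>Level 4 is the first with room: among 16 cells each has six neighbors on at least one
  side, while among 8 cells the fourth has not.\<close>

lemma stop_base_range:
  assumes "4 \<le> j" "in_range j i"
  shows "0 \<le> stop_base j i" "stop_base j i + 2 \<le> 2 ^ j"
    "\<not> in_range j (i + 6) \<Longrightarrow> in_range j (i - 6)"
proof -
  have "(2::int) ^ 4 \<le> 2 ^ j" using assms(1) by (intro power_increasing) auto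
  then have "(16::int) \<le> 2 ^ j" by simp
  then show "0 \<le> stop_base j i" "stop_base j i + 2 \<le> 2 ^ j"
    "\<not> in_range j (i + 6) \<Longrightarrow> in_range j (i - 6)"
    using assms(2) by (auto simp: stop_base_def in_range_def)
qed

text \<open>In doubled coordinates, with \<open>c\<close>, \<open>d\<close> the centers and
  \<open>q\<close>, \<open>r\<close> the cell lengths at levels \<open>k\<close> and
  \<open>l\<close>, the pair of level \<open>k\<close> covers distances from 9 q to 13 q from
  \<open>c\<close>, and that of level \<open>l\<close> stays within 13 r of \<open>d\<close>. Since
  \<bar>d - c\<bar> \<le> 3 (q - r) and 2 r \<le> q, the latter is within 3 q + 10 r \<le> 8 q of
  \<open>c\<close>.\<close>

lemma walk_disjoint:
  assumes e: "\<And>l. l < n \<Longrightarrow> e l \<in> {0..3}" and kl: "k < l" "l \<le> n"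
    and a: "\<And>k. k \<le> n \<Longrightarrow> int (a k) = stop_base (J + k) (walk i e k)"
  shows "{a k * 2 ^ (n - k) ..< (a k + 2) * 2 ^ (n - k)} \<inter> {a l * 2 ^ (n - l) ..< (a l + 2) * 2 ^ (n - l)} = {}"
proof -
  define q r :: nat where "q = 2 ^ (n - k)" and "r = 2 ^ (n - l)"
  have "2 ^ (n - Suc k) * 2 = q" using kl by (simp add: q_def flip: power_Suc2 Suc_diff_Suc)
  moreover have "r \<le> 2 ^ (n - Suc k)" unfolding r_def using kl by (intro power_increasing) auto
  ultimately have qr: "2 * int r \<le> int q" "0 < int r" by (auto simp: r_def)
  define c d where "c = (2 * walk i e k - 1) * int q" and "d = (2 * walk i e l - 1) * int r"
  have cd: "\<bar>d - c\<bar> \<le> 3 * (int q - int r)"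
    using walk_center[of n e k l i] e kl by (simp add: c_def d_def q_def r_def)
  have K: "2 * int (a k) * int q = c + 9 * int q \<or> 2 * int (a k) * int q = c - 13 * int q"
    using a[of k] kl by (auto simp: stop_base_def c_def algebra_simps)
  have L: "2 * int (a l) * int r = d + 9 * int r \<or> 2 * int (a l) * int r = d - 13 * int r"
    using a[of l] kl by (auto simp: stop_base_def d_def algebra_simps)
  have "False" if x: "a k * q \<le> x" "x < (a k + 2) * q" "a l * r \<le> x" "x < (a l + 2) * r" for x
  proof -
    have "int (a k * q) \<le> int x" "int x < int ((a k + 2) * q)" "int (a l * r) \<le> int x" "int x < int ((a l + 2) * r)"
      using x by (simp_all only: of_nat_le_iff of_nat_less_iff)
    then have "2 * int (a k) * int q \<le> 2 * int x" "2 * int x < 2 * int (a k) * int q + 4 * int q"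
      "2 * int (a l) * int r \<le> 2 * int x" "2 * int x < 2 * int (a l) * int r + 4 * int r"
      by (simp_all add: algebra_simps)
    moreover have "False" if "P \<le> X" "X < P + 4 * q" "P = c + 9 * q \<or> P = c - 13 * q" "Q \<le> X" "X < Q + 4 * r"
      "Q = d + 9 * r \<or> Q = d - 13 * r" "\<bar>d - c\<bar> \<le> 3 * (q - r)" "2 * r \<le> q" "0 < r"
      for P Q X c d q r :: int
    proof -
      have 1: "P < Q + 4 * r" "Q < P + 4 * q" using that by linarith+
      have 2: "d - c \<le> 3 * q - 3 * r" "c - d \<le> 3 * q - 3 * r"
        using that(7) unfolding abs_le_iff by simp_all
      have 3: False if "P = c + 9 * q" "Q = d + 9 * r" using 1 2 \<open>2 * r \<le> q\<close> \<open>0 < r\<close> unfolding that by linarith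
      have 4: False if "P = c + 9 * q" "Q = d - 13 * r" using 1 2 \<open>2 * r \<le> q\<close> \<open>0 < r\<close> unfolding that by linarith
      have 5: False if "P = c - 13 * q" "Q = d + 9 * r" using 1 2 \<open>2 * r \<le> q\<close> \<open>0 < r\<close> unfolding that by linarith
      have 6: False if "P = c - 13 * q" "Q = d - 13 * r" using 1 2 \<open>2 * r \<le> q\<close> \<open>0 < r\<close> unfolding that by linarith
      show False using that(3,6) 3 4 5 6 by blast
    qed
    ultimately show False using K L cd qr by blast
  qed
  then have "{a k * q ..< (a k + 2) * q} \<inter> {a l * r ..< (a l + 2) * r} = {}"
    unfolding disjoint_iff atLeastLessThan_iff by blast
  then show ?thesis unfolding q_def r_def .
qed

context estimation begin

text \<open>The threshold is 1.9 instead of 2 standard deviations because 0.1 is conceded to the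
  drift, see \<open>drift_negligible\<close>. A walk that leaves the grid has the empty
  event.\<close>

definition walk_event :: "nat \<Rightarrow> nat \<Rightarrow> int \<Rightarrow> (nat \<Rightarrow> int) \<Rightarrow> 'w set" where
  "walk_event J n i e = {\<omega> \<in> space \<Omega>. \<forall>k\<le>n. in_range (J + k) (walk i e k) \<and>
     1.9 * sqrt (6 * mesh (J + k)) \<le> stop_side (J + k) (walk i e k) *
       dnoise (-1) (J + k) (stop_base (J + k) (walk i e k) + 2) (stop_base (J + k) (walk i e k) + 1) \<omega>}"

text \<open>At 1.9 standard deviations Cantelli's bound is 1 / (1 + 3.61), while the plain Chebyshev
  bound 1 / 3.61 would exceed the critical value 1/4.\<close>

lemma side_tail:
  assumes "4 \<le> j" "in_range j i"
  shows "prob {\<omega> \<in> space \<Omega>. 1.9 * sqrt (6 * mesh j) \<le> stop_side j i *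
       dnoise (-1) j (stop_base j i + 2) (stop_base j i + 1) \<omega>} \<le> 9 / 40"
proof -
  let ?b = "stop_base j i" and ?d = "sqrt (6 * mesh j)"
  have d: "0 < ?d" using mesh_pos[of j] by simp
  have b: "0 \<le> ?b" "?b + 2 \<le> 2 ^ j" using stop_base_range[OF assms] by auto
  have "distributed \<Omega> lborel (\<lambda>\<omega>. stop_side j i * dnoise (-1) j (?b + 2) (?b + 1) \<omega>) (normal_density 0 ?d)"
  proof (cases "in_range j (i + 6)")
    case True
    then show ?thesis using dnoise_normal[of "-1" "?b + 2" j "?b + 1"] b by (simp add: stop_side_def)
  next
    case False
    then show ?thesis using dnoise_normal[of "-1" "?b + 1" j "?b + 2"] b
      by (simp add: stop_side_def flip: dnoise_swap)
  qed
  then have "prob {\<omega> \<in> space \<Omega>. 1.9 * ?d \<le> stop_side j i * dnoise (-1) j (?b + 2) (?b + 1) \<omega>}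
      \<le> ?d\<^sup>2 / (?d\<^sup>2 + (1.9 * ?d)\<^sup>2)"
    using d by (intro normal_upper_tail) auto
  also have "\<dots> = ?d\<^sup>2 / (?d\<^sup>2 * 4.61)"
    by (simp add: power_mult_distrib power2_eq_square)
  also have "\<dots> = 1 / 4.61"
    by (rule nonzero_divide_mult_cancel_left) (use d in simp)
  also have "\<dots> \<le> 9 / 40" by simp
  finally show ?thesis .
qed

lemma walk_event_prob:
  assumes J: "4 \<le> J" and e: "\<And>l. l < n \<Longrightarrow> e l \<in> {0..3}"
  shows "walk_event J n i e \<in> sets \<Omega>" "prob (walk_event J n i e) \<le> (9 / 40) ^ Suc n"
proof -
  have "walk_event J n i e \<in> sets \<Omega> \<and> prob (walk_event J n i e) \<le> (9 / 40) ^ Suc n"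
  proof (cases "\<forall>k\<le>n. in_range (J + k) (walk i e k)")
    case False
    then have "walk_event J n i e = {}" by (auto simp: walk_event_def)
    then show ?thesis by simp
  next
    case True
    define b where "b k = stop_base (J + k) (walk i e k)" for k
    define a where "a k = nat (b k)" for k
    have br: "0 \<le> b k" "b k + 2 \<le> 2 ^ (J + k)" if "k \<le> n" for k
      using stop_base_range[of "J + k" "walk i e k"] True that J by (auto simp: b_def)
    have a: "int (a k) = b k" if "k \<le> n" for k using br(1)[OF that] by (simp add: a_def)
    let ?D = "\<lambda>k \<omega>. stop_side (J + k) (walk i e k) * dnoise (-1) (J + k) (int (a k) + 2) (int (a k) + 1) \<omega>"
    let ?A = "\<lambda>k. {1.9 * sqrt (6 * mesh (J + k))..}"
    have ind: "indep_vars (\<lambda>_. borel) ?D {..n}"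
    proof (rule dnoise_indep)
      show "a k + 2 \<le> 2 ^ (J + k)" if "k \<le> n" for k
      proof -
        have "int (a k + 2) \<le> int (2 ^ (J + k))" using a[OF that] br(2)[OF that] by simp
        then show ?thesis by (simp only: of_nat_le_iff)
      qed
      show "{a k * 2 ^ (n - k) ..< (a k + 2) * 2 ^ (n - k)} \<inter> {a l * 2 ^ (n - l) ..< (a l + 2) * 2 ^ (n - l)} = {}"
        if "k < l" "l \<le> n" for k l
        using e that a unfolding b_def by (rule walk_disjoint)
    qed
    have ev: "walk_event J n i e = (\<Inter>k\<in>{..n}. ?D k -` ?A k \<inter> space \<Omega>)"
    proof -
      have "walk_event J n i e = {\<omega> \<in> space \<Omega>. \<forall>k\<in>{..n}. 1.9 * sqrt (6 * mesh (J + k)) \<le> ?D k \<omega>}"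
        unfolding walk_event_def using True a[unfolded b_def] by auto
      then show ?thesis by auto
    qed
    have "prob (walk_event J n i e) = (\<Prod>k\<in>{..n}. prob (?D k -` ?A k \<inter> space \<Omega>))"
      unfolding ev by (rule indep_varsD_finite[OF ind]) auto
    also have "\<dots> \<le> (\<Prod>k\<in>{..n}. 9 / 40)"
    proof (rule prod_mono, intro conjI measure_nonneg)
      fix k assume "k \<in> {..n}"
      then have "k \<le> n" by simp
      then have "in_range (J + k) (walk i e k)" "int (a k) = stop_base (J + k) (walk i e k)" "4 \<le> J + k"
        using True a[unfolded b_def] J by auto
      moreover have "?D k -` ?A k \<inter> space \<Omega> = {\<omega> \<in> space \<Omega>. 1.9 * sqrt (6 * mesh (J + k)) \<le> ?D k \<omega>}" by auto
      ultimately show "prob (?D k -` ?A k \<inter> space \<Omega>) \<le> 9 / 40"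
        using side_tail[of "J + k" "walk i e k"] by presburger
    qed
    also have "\<dots> = (9 / 40) ^ Suc n" by simp
    finally have "prob (walk_event J n i e) \<le> (9 / 40) ^ Suc n" .
    moreover have "walk_event J n i e \<in> sets \<Omega>"
      unfolding ev
    proof (rule sets.finite_INT)
      show "?D k -` ?A k \<inter> space \<Omega> \<in> sets \<Omega>" if "k \<in> {..n}" for k
        using ind that unfolding indep_vars_def2 by (intro measurable_sets[of _ _ borel]) auto
    qed auto
    ultimately show ?thesis by blast
  qed
  then show "walk_event J n i e \<in> sets \<Omega>" "prob (walk_event J n i e) \<le> (9 / 40) ^ Suc n" by auto
qed

text \<open>The function is bounded, so drifts are of order \<open>mesh j\<close>, whereas the noise
  is of order \<open>sqrt (mesh j)\<close>.\<close>

lemma drift_negligible: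
  obtains J where "4 \<le> J" "\<And>j b g. J \<le> j \<Longrightarrow> in_range j b \<Longrightarrow> in_range j g \<Longrightarrow>
    drift j b - drift j g \<le> 0.1 * stop_sd \<epsilon> j"
proof -
  define B where "B = \<bar>fmax\<bar> + \<bar>M\<bar>"
  have "(\<lambda>j. 2 * B * sqrt (mesh j)) \<longlonglongrightarrow> 2 * B * sqrt 0"
    unfolding mesh_def by (intro tendsto_intros LIMSEQ_power_zero) simp
  then have "(\<lambda>j. 2 * B * sqrt (mesh j)) \<longlonglongrightarrow> 0" by simp
  then have "\<forall>\<^sub>F j in sequentially. 2 * B * sqrt (mesh j) < 0.2 * \<epsilon>"
    using eps by (intro order_tendstoD(2)) auto
  then obtain J where J: "\<And>j. J \<le> j \<Longrightarrow> 2 * B * sqrt (mesh j) < 0.2 * \<epsilon>"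
    unfolding eventually_sequentially by blast
  show ?thesis
  proof (rule that[of "max 4 J"])
    fix j b g assume j: "max 4 J \<le> j" and r: "in_range j b" "in_range j g"
    have mp: "0 < mesh j" by (rule mesh_pos)
    have "drift j b - drift j g \<le> 2 * B * mesh j"
      using abs_drift_le[OF r(1)] abs_drift_le[OF r(2)] unfolding B_def by linarith
    also have "\<dots> = (2 * B * sqrt (mesh j)) * sqrt (mesh j)"
      using mp by simp
    also have "\<dots> \<le> (0.2 * \<epsilon>) * sqrt (mesh j)"
      using J[of j] j mp by (intro mult_right_mono) auto
    also have "\<dots> = 0.1 * \<epsilon> * (2 * sqrt (mesh j))" by simp
    also have "\<dots> \<le> 0.1 * \<epsilon> * (sqrt 6 * sqrt (mesh j))"
      using eps mp by (intro mult_left_mono mult_right_mono real_le_rsqrt) auto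
    also have "\<dots> = 0.1 * stop_sd \<epsilon> j" by (simp add: stop_sd_eq real_sqrt_mult)
    finally show "drift j b - drift j g \<le> 0.1 * stop_sd \<epsilon> j" .
  qed simp
qed

text \<open>A sample point without a stop lies in the event of its own walk: the recorded side is on
  the grid, its statistic exceeds two standard deviations, and at most 0.1 of this comes from the
  drift.\<close>

lemma no_stop_subset:
  assumes J: "4 \<le> J" and neg: "\<And>j b g. J \<le> j \<Longrightarrow> in_range j b \<Longrightarrow> in_range j g \<Longrightarrow>
      drift j b - drift j g \<le> 0.1 * stop_sd \<epsilon> j"
    and \<omega>: "\<omega> \<in> space \<Omega>"
    and no: "\<And>j. \<not> stop_stat (copy 1 \<omega>) (copy (- 1) \<omega>) j / ereal (stop_sd \<epsilon> j) \<le> 2"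
  shows "\<exists>i\<in>{1..2 ^ J}. \<exists>e\<in>PiE {..<n} (\<lambda>_. {0..3}). \<omega> \<in> walk_event J n i e"
proof -
  let ?ih = "ihat (copy 1 \<omega>)"
  define i where "i = ?ih J"
  define e0 where "e0 k = ?ih (Suc (J + k)) - 2 * ?ih (J + k) + 2" for k
  define e where "e = restrict e0 {..<n}"
  have "e0 k \<in> {0..3}" for k
    using ihat_Suc_in[of "copy 1 \<omega>" "J + k"] by (auto simp: e0_def simp del: ihat.simps)
  then have e: "e \<in> PiE {..<n} (\<lambda>_. {0..3})" by (auto simp: e_def)
  have "walk i e0 k = ?ih (J + k)" for k
    by (induction k) (simp_all add: i_def e0_def del: ihat.simps)
  moreover have "walk i e k = walk i e0 k" if "k \<le> n" for k
    using that by (intro walk_cong) (simp add: e_def)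
  ultimately have walk: "walk i e k = ?ih (J + k)" if "k \<le> n" for k using that by simp
  have i: "i \<in> {1..2 ^ J}" using ihat_range[of "copy 1 \<omega>" J] by (simp add: i_def)
  have "1.9 * sqrt (6 * mesh j) \<le> stop_side j (?ih j) *
       dnoise (-1) j (stop_base j (?ih j) + 2) (stop_base j (?ih j) + 1) \<omega>" if j: "J \<le> j" for j
  proof -
    have ir: "in_range j (?ih j)" using ihat_range[of "copy 1 \<omega>" j] by (simp add: in_range_def)
    have sd: "0 < stop_sd \<epsilon> j" using eps mesh_pos[of j] by (simp add: stop_sd_eq)
    have key: "1.9 * sqrt (6 * mesh j) \<le> dnoise (-1) j (?ih j + 6 * s) (?ih j + 5 * s) \<omega>"
      if s: "s \<in> {1, -1}" and r: "in_range j (?ih j + 6 * s)" for s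
    proof -
      have r': "in_range j (?ih j + 5 * s)" using ir r s by (auto simp: in_range_def)
      have "\<not> (\<exists>s\<in>{1, -1}. in_range j (?ih j + 6 * s) \<and>
          incr (copy (-1) \<omega>) j (?ih j + 6 * s) - incr (copy (-1) \<omega>) j (?ih j + 5 * s) \<le> 2 * stop_sd \<epsilon> j)"
        using no[of j] unfolding stop_stat_le_iff[OF sd] .
      then have "2 * stop_sd \<epsilon> j < incr (copy (-1) \<omega>) j (?ih j + 6 * s) - incr (copy (-1) \<omega>) j (?ih j + 5 * s)"
        using s r by (meson not_less)
      also have "\<dots> = (drift j (?ih j + 6 * s) - drift j (?ih j + 5 * s))
          + \<epsilon> * dnoise (-1) j (?ih j + 6 * s) (?ih j + 5 * s) \<omega>"
        by (rule incr_copy_diff[OF r r'])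
      also have "\<dots> \<le> 0.1 * stop_sd \<epsilon> j + \<epsilon> * dnoise (-1) j (?ih j + 6 * s) (?ih j + 5 * s) \<omega>"
        using neg[OF j r r'] by simp
      finally have "\<epsilon> * (1.9 * sqrt (6 * mesh j)) \<le> \<epsilon> * dnoise (-1) j (?ih j + 6 * s) (?ih j + 5 * s) \<omega>"
        by (simp add: stop_sd_eq)
      then show ?thesis using eps by (simp only: mult_le_cancel_left_pos)
    qed
    show ?thesis
    proof (cases "in_range j (?ih j + 6)")
      case True
      have eq: "stop_base j (?ih j) + 2 = ?ih j + 6 * 1" "stop_base j (?ih j) + 1 = ?ih j + 5 * 1"
        "stop_side j (?ih j) = 1"
        using True by (simp_all add: stop_base_def stop_side_def)
      show ?thesis unfolding eq using key[of 1] True by simp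
    next
      case False
      have "4 \<le> j" using J j by simp
      then have r: "in_range j (?ih j + 6 * (-1))"
        using stop_base_range(3)[of j "?ih j"] ir False by simp
      have eq: "stop_base j (?ih j) + 2 = ?ih j + 5 * (-1)" "stop_base j (?ih j) + 1 = ?ih j + 6 * (-1)"
        "stop_side j (?ih j) = -1"
        using False by (simp_all add: stop_base_def stop_side_def)
      show ?thesis unfolding eq
        using key[OF _ r] dnoise_swap[of "-1" j "?ih j + 6 * (-1)" "?ih j + 5 * (-1)" \<omega>] by simp
    qed
  qed
  then have "\<omega> \<in> walk_event J n i e"
    unfolding walk_event_def using walk \<omega> ihat_range[of "copy 1 \<omega>"] by (auto simp: in_range_def)
  then show ?thesis using i e by blast
qed

lemma AE_stop: "AE \<omega> in \<Omega>. \<exists>j. stop_stat (copy 1 \<omega>) (copy (- 1) \<omega>) j / ereal (stop_sd \<epsilon> j) \<le> 2"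
proof -
  obtain J where J: "4 \<le> J" and neg: "\<And>j b g. J \<le> j \<Longrightarrow> in_range j b \<Longrightarrow> in_range j g \<Longrightarrow>
      drift j b - drift j g \<le> 0.1 * stop_sd \<epsilon> j"
    using drift_negligible by blast
  let ?I = "\<lambda>n::nat. {1..2 ^ J :: int} \<times> PiE {..<n} (\<lambda>_. {0..3 :: int})"
  define U where "U n = (\<Union>p\<in>?I n. walk_event J n (fst p) (snd p))" for n
  have fin: "finite (?I n)" for n by (intro finite_cartesian_product finite_PiE finite_lessThan) auto
  have card: "real (card (?I n)) = 2 ^ J * 4 ^ n" for n
  proof -
    have "card {1..2 ^ J :: int} = 2 ^ J" by (simp add: nat_power_eq)
    moreover have "card (PiE {..<n} (\<lambda>_. {0..3 :: int})) = 4 ^ n" by (subst card_PiE) simp_all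
    ultimately show ?thesis by (simp only: card_cartesian_product of_nat_mult of_nat_power of_nat_numeral)
  qed
  have e: "snd p l \<in> {0..3}" if "p \<in> ?I n" "l < n" for p l n
  proof -
    have "snd p \<in> PiE {..<n} (\<lambda>_. {0..3})" using that(1) by (simp only: mem_Times_iff)
    moreover have "l \<in> {..<n}" using that(2) by simp
    ultimately show ?thesis by (rule PiE_mem)
  qed
  have ev: "walk_event J n (fst p) (snd p) \<in> sets \<Omega>"
    "prob (walk_event J n (fst p) (snd p)) \<le> (9 / 40) ^ Suc n" if p: "p \<in> ?I n" for p n
    by (rule walk_event_prob[OF J e[OF p]], assumption)+
  have U_sets: "U n \<in> sets \<Omega>" for n
    unfolding U_def by (intro sets.finite_UN fin ev(1))
  have U_prob: "prob (U n) \<le> 2 ^ J * (9 / 40) * (9 / 10) ^ n" for n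
  proof -
    have "prob (U n) \<le> (\<Sum>p\<in>?I n. prob (walk_event J n (fst p) (snd p)))"
      unfolding U_def by (intro finite_measure_subadditive_finite fin image_subsetI ev(1))
    also have "\<dots> \<le> (\<Sum>p\<in>?I n. (9 / 40) ^ Suc n)"
      by (intro sum_mono ev(2))
    also have "\<dots> = (2 ^ J * 4 ^ n) * (9 / 40) ^ Suc n"
      by (simp only: sum_constant card)
    \<comment> \<open>Four choices per level against a probability of 9/40 per level leave the ratio
      9/10.\<close>
    also have "\<dots> = 2 ^ J * (9 / 40) * (4 * (9 / 40)) ^ n"
      unfolding power_mult_distrib power_Suc by (simp only: ac_simps)
    finally show ?thesis by simp
  qed
  have "prob (\<Inter>n. U n) \<le> 0"
  proof (rule LIMSEQ_le_const)
    show "(\<lambda>n. 2 ^ J * (9 / 40) * (9 / 10) ^ n :: real) \<longlonglongrightarrow> 0"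
      by (intro tendsto_mult_right_zero LIMSEQ_power_zero) simp
    have "prob (\<Inter>n. U n) \<le> prob (U n)" for n
      using U_sets by (intro finite_measure_mono) auto
    then show "\<exists>N. \<forall>n\<ge>N. prob (\<Inter>n. U n) \<le> 2 ^ J * (9 / 40) * (9 / 10) ^ n"
      using order_trans[OF _ U_prob] by blast
  qed
  then have "prob (\<Inter>n. U n) = 0" using measure_nonneg[of \<Omega> "\<Inter>n. U n"] by linarith
  moreover have "(\<Inter>n. U n) \<in> sets \<Omega>" using U_sets by auto
  ultimately have null: "(\<Inter>n. U n) \<in> null_sets \<Omega>"
    by (simp add: null_sets_def emeasure_eq_measure)
  show ?thesis
  proof (rule AE_I'[OF null], clarify)
    fix \<omega> n assume "\<omega> \<in> space \<Omega>" "\<not> (\<exists>j. stop_stat (copy 1 \<omega>) (copy (- 1) \<omega>) j / ereal (stop_sd \<epsilon> j) \<le> 2)"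
    then obtain i e where "i \<in> {1..2 ^ J}" "e \<in> PiE {..<n} (\<lambda>_. {0..3})" "\<omega> \<in> walk_event J n i e"
      using no_stop_subset[OF J neg] by blast
    then show "\<omega> \<in> U n" unfolding U_def by (intro UN_I[of "(i, e)"]) auto
  qed
qed

end

section \<open>The risk of the estimator\<close>

text \<open>Consecutive terms have ratio 4, so the sum is at most 1 / (1 - 1/4) = 4/3 times its last
  term.\<close>

lemma sum_mesh_inverse:
  "(\<Sum>k\<in>{..N}. 1 / (mesh k)\<^sup>2) \<le> 4 / 3 / (mesh N)\<^sup>2"
proof (induction N)
  case 0
  then show ?case by (simp add: mesh_def)
next
  case (Suc N)
  have "(\<Sum>k\<in>{..Suc N}. 1 / (mesh k)\<^sup>2) \<le> 4 / 3 / (mesh N)\<^sup>2 + 1 / (mesh (Suc N))\<^sup>2"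
    using Suc by simp
  also have "\<dots> \<le> 4 / 3 / (mesh (Suc N))\<^sup>2"
    using mesh_pos[of N] by (simp add: mesh_Suc power_divide field_simps)
  finally show ?case .
qed

context estimation begin

text \<open>\<open>N\<close> is the last level whose mesh is at least \<open>5 * \<rho>\<close>; the
  next level, with half the mesh, gives the upper bound.\<close>

lemma level_exists:
  assumes "5 * \<rho> \<le> 1"
  obtains N where "5 * \<rho> \<le> mesh N" "mesh N < 10 * \<rho>"
proof -
  have pos: "0 < 5 * \<rho>" using rho_z_pos by simp
  then have "\<exists>n. mesh n < 5 * \<rho>"
    unfolding mesh_def by (intro real_arch_pow_inv) auto
  then obtain n where n: "mesh n < 5 * \<rho>" "\<And>k. k < n \<Longrightarrow> \<not> mesh k < 5 * \<rho>"
    using exists_least_iff[of "\<lambda>n. mesh n < 5 * \<rho>"] by blast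
  have "n \<noteq> 0"
  proof
    assume "n = 0"
    then show False using n(1) assms by (simp add: mesh_def)
  qed
  then obtain N where N: "n = Suc N" using not0_implies_Suc by blast
  have "5 * \<rho> \<le> mesh N" using n(2)[of N] N by simp
  moreover have "mesh N < 10 * \<rho>" using n(1) unfolding N mesh_Suc by simp
  ultimately show ?thesis by (rule that)
qed

abbreviation "err \<omega> \<equiv> \<bar>zhat \<epsilon> (copy 1 \<omega>) (copy (- 1) \<omega>) - Z\<bar>"

lemma err_le_1: "err \<omega> \<le> 1"
proof -
  have "zhat \<epsilon> (copy 1 \<omega>) (copy (- 1) \<omega>) \<in> {0..1}"
    unfolding zhat_center using ihat_range by (intro center_01) blast+
  then show ?thesis using Z_bounds by auto
qed

text \<open>Cost times probability is \<open>432 * \<rho> ^ 3 / (mesh k)\<^sup>2\<close> for both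
  kinds of error, as 6 * 72 = 3/2 * 288 = 432. Summation multiplies by 4/3, giving 576 at level
  \<open>N\<close>. Stopping errors end at level \<open>N - 2\<close>, where the mesh is four times
  larger: 576 / 16 = 36. Together these make 612.\<close>

lemma expected_err_le:
  assumes N: "5 * \<rho> \<le> mesh N"
  shows "(\<integral>\<^sup>+ \<omega>. ennreal (err \<omega>) \<partial>\<Omega>) \<le> ennreal (3 * mesh N + 612 * \<rho> ^ 3 / (mesh N)\<^sup>2)"
proof -
  define L where "L k = {\<omega> \<in> space \<Omega>. crossing (copy 1 \<omega>) k 0 (loc_pairs (istar Z k))}" for k
  define S where "S k = {\<omega> \<in> space \<Omega>. crossing (copy (- 1) \<omega>) k (2 * stop_sd \<epsilon> k) (stop_pairs (istar Z k))}" for k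
  define K where "K = {k. k + 2 \<le> N}"
  have K_fin: "finite K" unfolding K_def by (rule finite_subset[of _ "{..N}"]) auto
  have meas [measurable]: "L k \<in> sets \<Omega>" "S k \<in> sets \<Omega>" for k
    unfolding L_def S_def by (intro crossing_event finite_pairs)+
  have mp: "0 < mesh k" for k by (rule mesh_pos)
  have mN: "mesh N \<le> mesh k" if "k \<le> N" for k
    unfolding mesh_def using that by (intro power_decreasing) auto
  define G where "G \<omega> = 3 * mesh N + (\<Sum>k\<in>{1..N}. 6 * mesh k * indicator (L k) \<omega>)
      + (\<Sum>k\<in>K. 3 / 2 * mesh k * indicator (S k) \<omega>)" for \<omega>
  have le: "AE \<omega> in \<Omega>. ennreal (err \<omega>) \<le> ennreal (G \<omega>)"
    using AE_stop AE_space
  proof eventually_elim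
    case (elim \<omega>)
    have "err \<omega> \<le> G \<omega>"
      using zhat_error[OF Z_bounds eps elim(1), of N] elim(2)
      unfolding G_def K_def L_def S_def by (simp add: indicator_def of_bool_def)
    then show ?case by (rule ennreal_leI)
  qed
  have sum_ind: "integrable \<Omega> (\<lambda>\<omega>. \<Sum>k\<in>A. c k * indicator (F k) \<omega>)"
      "expectation (\<lambda>\<omega>. \<Sum>k\<in>A. c k * indicator (F k) \<omega>) = (\<Sum>k\<in>A. c k * prob (F k))"
    if F: "\<And>k. F k \<in> sets \<Omega>" for A :: "nat set" and c :: "nat \<Rightarrow> real" and F
  proof -
    have i: "integrable \<Omega> (\<lambda>\<omega>. c k * indicator (F k) \<omega>)" for k
      using F by (intro integrable_mult_right integrable_real_indicator) (auto simp: less_top[symmetric])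
    then show "integrable \<Omega> (\<lambda>\<omega>. \<Sum>k\<in>A. c k * indicator (F k) \<omega>)"
      by (rule Bochner_Integration.integrable_sum)
    have "expectation (\<lambda>\<omega>. c k * indicator (F k) \<omega>) = c k * prob (F k)" for k
      using F[of k] by (simp add: sets.Int_space_eq2)
    then show "expectation (\<lambda>\<omega>. \<Sum>k\<in>A. c k * indicator (F k) \<omega>) = (\<Sum>k\<in>A. c k * prob (F k))"
      by (subst Bochner_Integration.integral_sum[OF i]) (simp only:)
  qed
  have G_int: "integrable \<Omega> G"
    unfolding G_def by (intro Bochner_Integration.integrable_add sum_ind(1) meas integrable_const)
  have G_nonneg: "0 \<le> G \<omega>" for \<omega>
    unfolding G_def using mp less_imp_le[OF mp] by (intro add_nonneg_nonneg sum_nonneg mult_nonneg_nonneg) simp_all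
  have G_exp: "expectation G = 3 * mesh N + (\<Sum>k\<in>{1..N}. 6 * mesh k * prob (L k))
      + (\<Sum>k\<in>K. 3 / 2 * mesh k * prob (S k))"
    unfolding G_def
    by (subst Bochner_Integration.integral_add,
        (intro Bochner_Integration.integrable_add sum_ind(1) meas integrable_const)+,
        subst Bochner_Integration.integral_add, (intro sum_ind(1) meas integrable_const)+,
        simp only: sum_ind(2)[OF meas(1)] sum_ind(2)[OF meas(2)]) (simp add: prob_space)
  have sumL: "(\<Sum>k\<in>{1..N}. 6 * mesh k * prob (L k)) \<le> 576 * \<rho> ^ 3 / (mesh N)\<^sup>2"
  proof -
    have "(\<Sum>k\<in>{1..N}. 6 * mesh k * prob (L k)) \<le> (\<Sum>k\<in>{1..N}. 432 * \<rho> ^ 3 * (1 / (mesh k)\<^sup>2))"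
    proof (rule sum_mono)
      fix k assume "k \<in> {1..N}"
      then have "\<rho> < mesh k" using mN[of k] N rho_z_pos by simp
      then have "6 * mesh k * prob (L k) \<le> 6 * mesh k * (72 * (\<rho> / mesh k) ^ 3)"
        unfolding L_def using mp[of k] by (intro mult_left_mono loc_prob) auto
      also have "\<dots> = 432 * \<rho> ^ 3 * (1 / (mesh k)\<^sup>2)"
        using mp[of k] by (simp add: power_divide power3_eq_cube power2_eq_square)
      finally show "6 * mesh k * prob (L k) \<le> 432 * \<rho> ^ 3 * (1 / (mesh k)\<^sup>2)" .
    qed
    also have "\<dots> = 432 * \<rho> ^ 3 * (\<Sum>k\<in>{1..N}. 1 / (mesh k)\<^sup>2)" by (simp only: sum_distrib_left)
    also have "\<dots> \<le> 432 * \<rho> ^ 3 * (\<Sum>k\<in>{..N}. 1 / (mesh k)\<^sup>2)"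
      using rho_z_pos by (intro mult_left_mono sum_mono2) auto
    also have "\<dots> \<le> 432 * \<rho> ^ 3 * (4 / 3 / (mesh N)\<^sup>2)"
      using rho_z_pos by (intro mult_left_mono sum_mesh_inverse) auto
    finally show ?thesis by simp
  qed
  have sumS: "(\<Sum>k\<in>K. 3 / 2 * mesh k * prob (S k)) \<le> 36 * \<rho> ^ 3 / (mesh N)\<^sup>2"
  proof (cases "2 \<le> N")
    case False
    then have "K = {}" by (auto simp: K_def)
    then show ?thesis using rho_z_pos by simp
  next
    case True
    define n where "n = N - 2"
    have Nn: "N = Suc (Suc n)" using True by (simp add: n_def)
    have Kn: "K = {..n}" unfolding K_def Nn by auto
    have "(\<Sum>k\<in>K. 3 / 2 * mesh k * prob (S k)) \<le> (\<Sum>k\<in>K. 432 * \<rho> ^ 3 * (1 / (mesh k)\<^sup>2))"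
    proof (rule sum_mono)
      fix k assume "k \<in> K"
      then have "mesh n \<le> mesh k"
        unfolding mesh_def Kn by (intro power_decreasing) auto
      moreover have "mesh n = 4 * mesh N" unfolding Nn mesh_Suc by simp
      ultimately have "6 * \<rho> \<le> mesh k" using N rho_z_pos by linarith
      then have "3 / 2 * mesh k * prob (S k) \<le> 3 / 2 * mesh k * (288 * (\<rho> / mesh k) ^ 3)"
        unfolding S_def using mp[of k] by (intro mult_left_mono stop_prob) auto
      also have "\<dots> = 432 * \<rho> ^ 3 * (1 / (mesh k)\<^sup>2)"
        using mp[of k] by (simp add: power_divide power3_eq_cube power2_eq_square)
      finally show "3 / 2 * mesh k * prob (S k) \<le> 432 * \<rho> ^ 3 * (1 / (mesh k)\<^sup>2)" .
    qed
    also have "\<dots> = 432 * \<rho> ^ 3 * (\<Sum>k\<in>{..n}. 1 / (mesh k)\<^sup>2)" unfolding Kn by (simp only: sum_distrib_left)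
    also have "\<dots> \<le> 432 * \<rho> ^ 3 * (4 / 3 / (mesh n)\<^sup>2)"
      using rho_z_pos by (intro mult_left_mono sum_mesh_inverse) auto
    also have "\<dots> = 36 * \<rho> ^ 3 / (mesh N)\<^sup>2"
      unfolding Nn mesh_Suc by (simp add: power_divide)
    finally show ?thesis .
  qed
  have "(\<integral>\<^sup>+ \<omega>. ennreal (err \<omega>) \<partial>\<Omega>) \<le> (\<integral>\<^sup>+ \<omega>. ennreal (G \<omega>) \<partial>\<Omega>)"
    by (rule nn_integral_mono_AE[OF le])
  also have "\<dots> = ennreal (expectation G)"
    using G_int G_nonneg by (intro nn_integral_eq_integral AE_I2)
  also have "\<dots> \<le> ennreal (3 * mesh N + 612 * \<rho> ^ 3 / (mesh N)\<^sup>2)"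
    using sumL sumS unfolding G_exp by (intro ennreal_leI) (simp add: add_divide_distrib[symmetric])
  finally show ?thesis .
qed

lemma estimator_risk:
  "(\<integral>\<^sup>+ \<omega>. ennreal \<bar>minimizer_estimator \<epsilon> (white_noise \<epsilon> f (\<lambda>t. W t \<omega>)) (\<lambda>t. B1 t \<omega>) (\<lambda>t. B2 t \<omega>) - Z\<bar> \<partial>\<Omega>)
    < ennreal (53 * \<rho>)"
  unfolding estimator_copy
proof (cases "5 * \<rho> \<le> 1")
  case False
  have "(\<integral>\<^sup>+ \<omega>. ennreal (err \<omega>) \<partial>\<Omega>) \<le> (\<integral>\<^sup>+ \<omega>. 1 \<partial>\<Omega>)"
    using err_le_1 by (intro nn_integral_mono) (simp add: ennreal_le_1)
  also have "\<dots> = ennreal 1" by (simp add: emeasure_space_1)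
  also have "\<dots> < ennreal (53 * \<rho>)" using False by (intro ennreal_lessI) auto
  finally show "(\<integral>\<^sup>+ \<omega>. ennreal (err \<omega>) \<partial>\<Omega>) < ennreal (53 * \<rho>)" .
next
  case True
  then obtain N where N: "5 * \<rho> \<le> mesh N" "mesh N < 10 * \<rho>" using level_exists by blast
  define r where "r = mesh N / \<rho>"
  have m: "mesh N = r * \<rho>" using rho_z_pos by (simp add: r_def)
  have r: "5 \<le> r" "r < 10" using N rho_z_pos unfolding m by simp_all
  \<comment> \<open>Up to 7 the sum is at most 21 + 612 / 25 < 46, beyond 7 at most 30 + 612 / 49 <
    43.\<close>
  have "3 * r + 612 / r\<^sup>2 < 53"
  proof (cases "r \<le> 7")
    case True
    have "5\<^sup>2 \<le> r\<^sup>2" using r by (intro power_mono) auto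
    then have "612 / r\<^sup>2 \<le> 612 / 25" by (intro divide_left_mono) auto
    then show ?thesis using True by simp
  next
    case False
    have "7\<^sup>2 \<le> r\<^sup>2" using False by (intro power_mono) auto
    then have "612 / r\<^sup>2 \<le> 612 / 49" by (intro divide_left_mono) auto
    then show ?thesis using r by simp
  qed
  then have "\<rho> * (3 * r + 612 / r\<^sup>2) < \<rho> * 53" using rho_z_pos by (intro mult_strict_left_mono)
  moreover have "3 * mesh N + 612 * \<rho> ^ 3 / (mesh N)\<^sup>2 = \<rho> * (3 * r + 612 / r\<^sup>2)"
    using rho_z_pos r unfolding m by (simp add: power_mult_distrib power3_eq_cube power2_eq_square distrib_left)
  ultimately have "ennreal (3 * mesh N + 612 * \<rho> ^ 3 / (mesh N)\<^sup>2) < ennreal (53 * \<rho>)"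
    using rho_z_pos by (intro ennreal_lessI) auto
  then show "(\<integral>\<^sup>+ \<omega>. ennreal (err \<omega>) \<partial>\<Omega>) < ennreal (53 * \<rho>)"
    using expected_err_le[OF N(1)] by (rule le_less_trans[rotated])
qed

end

section \<open>A competitor\<close>

lemma convex_on_max:
  fixes f g :: "'a :: real_vector \<Rightarrow> real"
  assumes "convex_on S f" "convex_on S g"
  shows "convex_on S (\<lambda>x. max (f x) (g x))"
proof (rule convex_onI)
  fix t :: real and x y assume t: "0 < t" "t < 1" and xy: "x \<in> S" "y \<in> S"
  have "f ((1 - t) *\<^sub>R x + t *\<^sub>R y) \<le> (1 - t) * f x + t * f y"
    using convex_onD[OF assms(1), of t x y] t xy by simp
  also have "\<dots> \<le> (1 - t) * max (f x) (g x) + t * max (f y) (g y)"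
    using t by (intro add_mono mult_left_mono) auto
  finally have 1: "f ((1 - t) *\<^sub>R x + t *\<^sub>R y) \<le> (1 - t) * max (f x) (g x) + t * max (f y) (g y)" .
  have "g ((1 - t) *\<^sub>R x + t *\<^sub>R y) \<le> (1 - t) * g x + t * g y"
    using convex_onD[OF assms(2), of t x y] t xy by simp
  also have "\<dots> \<le> (1 - t) * max (f x) (g x) + t * max (f y) (g y)"
    using t by (intro add_mono mult_left_mono) auto
  finally show "max (f ((1 - t) *\<^sub>R x + t *\<^sub>R y)) (g ((1 - t) *\<^sub>R x + t *\<^sub>R y))
      \<le> (1 - t) * max (f x) (g x) + t * max (f y) (g y)" using 1 by simp
qed (use assms(1) convex_on_imp_convex in blast)

lemma convex_class_strict_min:
  assumes "convex_on {0..1} g" "t0 \<in> {0..1}" "\<And>t. t \<in> {0..1} \<Longrightarrow> t \<noteq> t0 \<Longrightarrow> g t0 < g t"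
  shows "g \<in> convex_class" "minimizer g = t0"
proof -
  have le: "g t0 \<le> g t" if "t \<in> {0..1}" for t
    using assms(3)[OF that] by (cases "t = t0") simp_all
  have "is_arg_min g (\<lambda>t. t \<in> {0..1}) t0"
    unfolding is_arg_min_def using assms(2) le by (simp add: not_less)
  moreover have "t = t0" if "is_arg_min g (\<lambda>t. t \<in> {0..1}) t" for t
  proof (rule ccontr)
    assume "t \<noteq> t0"
    then show False using that assms(2) assms(3)[of t] unfolding is_arg_min_def by blast
  qed
  ultimately show "g \<in> convex_class"
    using assms(1) unfolding convex_class_def by (intro CollectI conjI ex1I[of _ t0])
  then show "minimizer g = t0"
    using assms(2) le by (rule minimizer_eqI)
qed

context convex_fn_eps begin

text \<open>The competitor is \<open>f\<close> cut off below by a line through \<open>(t0, f t0)\<close>, with \<open>t0\<close> near the edge of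
  the level set, that is slightly tilted so that \<open>t0\<close> becomes the unique minimizer.\<close>

lemma competitor:
  obtains g where "g \<in> convex_class" "\<rho> / 2 \<le> \<bar>minimizer g - Z\<bar>"
    "(LINT t:{0..1}|lborel. (g t - f t)\<^sup>2) \<le> 4000 * \<epsilon>\<^sup>2"
proof -
  obtain t0 where t0: "t0 \<in> {0..1}" "f t0 \<le> M + \<mu>" "\<rho> / 2 < \<bar>t0 - Z\<bar>"
    using rho_z_witness[of "\<rho> / 2"] rho_z_pos by auto
  define s where "s = t0 - Z"
  have s: "\<rho> / 2 < \<bar>s\<bar>" "s \<noteq> 0" using t0(3) rho_z_pos by (auto simp: s_def)
  \<comment> \<open>The slope makes the line higher by \<open>\<mu> / 4\<close> at \<open>Z\<close>
    than at \<open>t0\<close>.\<close>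
  define b where "b = \<mu> / 4 / s"
  define l where "l t = f t0 + b * (t0 - t)" for t
  define g where "g t = max (f t) (l t)" for t
  have "convex_on {0..1} l"
  proof (rule convex_onI)
    fix t x y :: real
    show "l ((1 - t) *\<^sub>R x + t *\<^sub>R y) \<le> (1 - t) * l x + t * l y"
      by (simp add: l_def algebra_simps)
  qed simp
  then have "convex_on {0..1} g" unfolding g_def by (rule convex_on_max[OF convex])
  \<comment> \<open>On the side of \<open>t0\<close> towards \<open>Z\<close> the line rises above
    \<open>f t0\<close>; on the far side \<open>f\<close> itself does, by
    \<open>ge_scaled\<close>.\<close>
  moreover have "g t0 < g t" if t: "t \<in> {0..1}" "t \<noteq> t0" for t
  proof (cases "0 < (t0 - t) / s")
    case True
    have "b * (t0 - t) = \<mu> / 4 * ((t0 - t) / s)" by (simp add: b_def)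
    moreover have "0 < \<mu> / 4 * ((t0 - t) / s)" using True rho_m_pos by (intro mult_pos_pos) simp_all
    ultimately have "0 < b * (t0 - t)" by (simp only:)
    then show ?thesis by (simp add: g_def l_def)
  next
    case False
    define c where "c = (t - Z) / s"
    have "c - 1 = - ((t0 - t) / s)" using s(2) by (simp add: c_def s_def field_simps)
    moreover have "(t0 - t) / s \<noteq> 0" using t(2) s(2) by simp
    ultimately have c: "1 < c" using False by linarith
    have "t - Z = c * s" using s(2) by (simp add: c_def)
    then have "t0 - Z = (t - Z) / c" using c by (simp add: s_def)
    then have "c * (f t0 - M) \<le> f t - M"
      using ge_scaled[OF t(1), of c t0] c by simp
    moreover have "0 < f t0 - M" using M_less[OF t0(1)] s(2) by (simp add: s_def)
    then have "1 * (f t0 - M) < c * (f t0 - M)" using c by (intro mult_strict_right_mono)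
    ultimately have "f t0 < f t" by simp
    then show ?thesis by (simp add: g_def l_def)
  qed
  ultimately have g: "g \<in> convex_class" "minimizer g = t0"
    using convex_class_strict_min[of g t0] t0(1) by blast+
  \<comment> \<open>At distance \<open>x * \<rho>\<close> from \<open>Z\<close> the line is at most
    \<open>M + 5 / 4 * \<mu> + \<mu> * x / 2\<close>, while beyond \<rho> the function is at least
    \<open>M + \<mu> * x\<close>. So the cut-off acts only for \<open>x \<le> 5 / 2\<close>.\<close>
  let ?A = "{Z - 5 / 2 * \<rho>..Z + 5 / 2 * \<rho>}"
  have bnd: "(g t - f t)\<^sup>2 \<le> indicator ?A t * (5 / 2 * \<mu>)\<^sup>2" if t: "t \<in> {0..1}" for t
  proof (cases "f t < l t")
    case False
    then show ?thesis by (simp add: g_def)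
  next
    case True
    define x where "x = \<bar>t - Z\<bar> / \<rho>"
    have x0: "0 \<le> x" using rho_z_pos by (simp add: x_def)
    have "b * (t0 - t) = \<mu> / 4 * (1 + (Z - t) / s)"
      using s(2) by (simp add: b_def s_def field_simps)
    also have "\<dots> \<le> \<mu> / 4 * (1 + 2 * x)"
    proof (intro mult_left_mono add_left_mono)
      have "(Z - t) / s \<le> \<bar>(Z - t) / s\<bar>" by (rule abs_ge_self)
      also have "\<dots> = \<bar>t - Z\<bar> / \<bar>s\<bar>" by (simp only: abs_divide abs_minus_commute)
      also have "\<dots> \<le> \<bar>t - Z\<bar> / (\<rho> / 2)"
        using s rho_z_pos by (intro divide_left_mono mult_pos_pos) auto
      finally show "(Z - t) / s \<le> 2 * x" by (simp add: x_def mult.commute)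
    qed (use rho_m_pos in simp)
    also have "\<dots> = \<mu> / 4 + \<mu> * x / 2" by (simp add: algebra_simps)
    finally have lt: "l t \<le> M + 5 / 4 * \<mu> + \<mu> * x / 2"
      using t0(2) by (simp add: l_def)
    have x: "x \<le> 5 / 2"
    proof (rule ccontr)
      assume x: "\<not> x \<le> 5 / 2"
      then have "\<rho> < \<bar>t - Z\<bar>" using rho_z_pos unfolding x_def by (simp add: not_le field_simps)
      then have "\<mu> * x \<le> f t - M" using growth[OF t] by (simp add: x_def)
      then have "\<mu> * x / 2 < 5 / 4 * \<mu>" using True lt by linarith
      then have "\<mu> * x < \<mu> * (5 / 2)" by linarith
      then show False using x rho_m_pos by simp
    qed
    have "\<mu> * x \<le> \<mu> * (5 / 2)" using x rho_m_pos by (intro mult_left_mono) auto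
    then have "g t - f t \<le> 5 / 2 * \<mu>"
      using lt M_le[OF t] True by (simp add: g_def)
    moreover have "0 \<le> g t - f t" by (simp add: g_def)
    ultimately have "(g t - f t)\<^sup>2 \<le> (5 / 2 * \<mu>)\<^sup>2" by (intro power_mono)
    moreover have "\<bar>t - Z\<bar> \<le> 5 / 2 * \<rho>" using x rho_z_pos by (simp add: x_def pos_divide_le_eq)
    then have "t - Z \<le> 5 / 2 * \<rho>" "- (t - Z) \<le> 5 / 2 * \<rho>" unfolding abs_le_iff by blast+
    then have "t \<in> ?A" by simp
    ultimately show ?thesis by simp
  qed
  have "(LINT t:{0..1}|lborel. (g t - f t)\<^sup>2) \<le> (\<integral>t. indicator ?A t *\<^sub>R (5 / 2 * \<mu>)\<^sup>2 \<partial>lborel)"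
    unfolding set_lebesgue_integral_def
  proof (rule integral_mono_AE')
    show "integrable lborel (\<lambda>t. indicator ?A t *\<^sub>R (5 / 2 * \<mu>)\<^sup>2)"
      using rho_z_pos by (simp add: integrable_real_indicator)
    show "AE t in lborel. indicator {0..1} t *\<^sub>R (g t - f t)\<^sup>2 \<le> indicator ?A t *\<^sub>R (5 / 2 * \<mu>)\<^sup>2"
    proof (rule AE_I2)
      fix t :: real
      show "indicator {0..1} t *\<^sub>R (g t - f t)\<^sup>2 \<le> indicator ?A t *\<^sub>R (5 / 2 * \<mu>)\<^sup>2"
        using bnd[of t] by (cases "t \<in> {0..1}") simp_all
    qed
    show "AE t in lborel. 0 \<le> indicator ?A t *\<^sub>R (5 / 2 * \<mu>)\<^sup>2" by simp
  qed
  also have "\<dots> = 5 * \<rho> * (5 / 2 * \<mu>)\<^sup>2"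
    using rho_z_pos by (simp add: content_real)
  also have "\<dots> = 125 / 4 * (\<rho> * \<mu>\<^sup>2)" by (simp add: power2_eq_square)
  \<comment> \<open>Origin of 4000: 125 / 4 * 128.\<close>
  also have "\<dots> \<le> 125 / 4 * (128 * \<epsilon>\<^sup>2)" by (intro mult_left_mono rho_mu_le) simp
  finally have "(LINT t:{0..1}|lborel. (g t - f t)\<^sup>2) \<le> 4000 * \<epsilon>\<^sup>2" by simp
  then show ?thesis using g t0(3) by (intro that[of g]) auto
qed

end

section \<open>Shifted Gaussian product measures\<close>

text \<open>The likelihood ratio of the normal laws with means \<open>a + d\<close> and
  \<open>a\<close> and common standard deviation \<open>s\<close>.\<close>

definition tilt :: "real \<Rightarrow> real \<Rightarrow> real \<Rightarrow> real \<Rightarrow> real" where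
  "tilt a d s x = exp (d * (x - a) / s\<^sup>2 - d\<^sup>2 / (2 * s\<^sup>2))"

lemma normal_density_shift:
  assumes "0 < s"
  shows "normal_density (a + d) s x = tilt a d s x * normal_density a s x"
proof -
  have "- (x - (a + d))\<^sup>2 / (2 * s\<^sup>2) = (d * (x - a) / s\<^sup>2 - d\<^sup>2 / (2 * s\<^sup>2)) + - (x - a)\<^sup>2 / (2 * s\<^sup>2)"
    using assms by (simp add: field_simps power2_eq_square)
  then have "exp (- (x - (a + d))\<^sup>2 / (2 * s\<^sup>2)) = tilt a d s x * exp (- (x - a)\<^sup>2 / (2 * s\<^sup>2))"
    unfolding tilt_def by (simp only: exp_add)
  then show ?thesis unfolding normal_density_def by simp
qed

text \<open>The square of a likelihood ratio is a constant times the likelihood ratio for the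
  doubled shift, so its second moment is that constant.\<close>

lemma tilt_square:
  assumes "0 < s"
  shows "(tilt a d s x)\<^sup>2 = exp (d\<^sup>2 / s\<^sup>2) * tilt a (2 * d) s x"
proof -
  have "2 * (d * (x - a) / s\<^sup>2 - d\<^sup>2 / (2 * s\<^sup>2)) = d\<^sup>2 / s\<^sup>2 + (2 * d * (x - a) / s\<^sup>2 - (2 * d)\<^sup>2 / (2 * s\<^sup>2))"
    using assms by (simp add: field_simps power2_eq_square)
  then show ?thesis unfolding tilt_def by (simp only: exp_add exp_double[symmetric])
qed

lemma tilt_pos: "0 < tilt a d s x" by (simp add: tilt_def)

lemma tilt_measurable [measurable]: "tilt a d s \<in> borel_measurable borel"
  unfolding tilt_def by measurable

abbreviation gauss :: "real \<Rightarrow> real \<Rightarrow> real measure" where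
  "gauss a s \<equiv> density lborel (normal_density a s)"

lemma nn_integral_gauss_tilt:
  assumes "0 < s" and [measurable]: "h \<in> borel_measurable borel"
  shows "(\<integral>\<^sup>+ x. ennreal (tilt a d s x) * h x \<partial>gauss a s) = (\<integral>\<^sup>+ x. h x \<partial>gauss (a + d) s)"
proof -
  have "(\<integral>\<^sup>+ x. ennreal (tilt a d s x) * h x \<partial>gauss a s)
      = (\<integral>\<^sup>+ x. ennreal (normal_density a s x) * (ennreal (tilt a d s x) * h x) \<partial>lborel)"
    by (intro nn_integral_density) measurable
  also have "\<dots> = (\<integral>\<^sup>+ x. ennreal (normal_density (a + d) s x) * h x \<partial>lborel)"
    unfolding normal_density_shift[OF assms(1)]
      ennreal_mult[OF less_imp_le[OF tilt_pos] normal_density_nonneg]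
    by (intro nn_integral_cong) (simp only: mult_ac)
  also have "\<dots> = (\<integral>\<^sup>+ x. h x \<partial>gauss (a + d) s)"
    by (intro nn_integral_density[symmetric]) measurable
  finally show ?thesis .
qed

lemma nn_integral_gauss_tilt_square:
  assumes "0 < s"
  shows "(\<integral>\<^sup>+ x. (ennreal (tilt a d s x))\<^sup>2 \<partial>gauss a s) = ennreal (exp (d\<^sup>2 / s\<^sup>2))"
proof -
  interpret prob_space "gauss (a + 2 * d) s" by (rule prob_space_normal_density[OF assms])
  have "(\<integral>\<^sup>+ x. (ennreal (tilt a d s x))\<^sup>2 \<partial>gauss a s)
      = (\<integral>\<^sup>+ x. ennreal (tilt a (2 * d) s x) * ennreal (exp (d\<^sup>2 / s\<^sup>2)) \<partial>gauss a s)"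
  proof (intro nn_integral_cong)
    fix x
    have "(ennreal (tilt a d s x))\<^sup>2 = ennreal ((tilt a d s x)\<^sup>2)"
      by (rule ennreal_power[OF less_imp_le[OF tilt_pos]])
    also have "\<dots> = ennreal (tilt a (2 * d) s x) * ennreal (exp (d\<^sup>2 / s\<^sup>2))"
      unfolding tilt_square[OF assms] by (simp add: ennreal_mult less_imp_le[OF tilt_pos] mult.commute)
    finally show "(ennreal (tilt a d s x))\<^sup>2 = ennreal (tilt a (2 * d) s x) * ennreal (exp (d\<^sup>2 / s\<^sup>2))" .
  qed
  also have "\<dots> = (\<integral>\<^sup>+ x. ennreal (exp (d\<^sup>2 / s\<^sup>2)) \<partial>gauss (a + 2 * d) s)"
    by (rule nn_integral_gauss_tilt[OF assms]) simp
  also have "\<dots> = ennreal (exp (d\<^sup>2 / s\<^sup>2))"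
    using emeasure_space_1 by simp
  finally show ?thesis .
qed

text \<open>Both measures agree on rectangles, where the product of likelihood ratios integrates
  factor by factor.\<close>

lemma PiM_gauss_shift:
  assumes I: "finite I" and s: "\<And>i. 0 < s i"
  shows "PiM I (\<lambda>i. gauss (a i + d i) (s i))
    = density (PiM I (\<lambda>i. gauss (a i) (s i))) (\<lambda>x. \<Prod>i\<in>I. ennreal (tilt (a i) (d i) (s i) (x i)))"
proof -
  have ps: "prob_space (gauss b (s i))" for b i by (rule prob_space_normal_density[OF s])
  interpret N: product_prob_space "\<lambda>i. gauss (a i) (s i)" I
    using ps by (rule product_prob_spaceI)
  interpret N': product_prob_space "\<lambda>i. gauss (a i + d i) (s i)" I
    using ps by (rule product_prob_spaceI)
  let ?P = "PiM I (\<lambda>i. gauss (a i) (s i))"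
  let ?L = "\<lambda>x. \<Prod>i\<in>I. ennreal (tilt (a i) (d i) (s i) (x i))"
  have m: "(\<lambda>x. ennreal (tilt (a i) (d i) (s i) (x i))) \<in> borel_measurable ?P" if "i \<in> I" for i
    by (rule measurable_compose[OF measurable_component_singleton[OF that]]) simp
  have Lm [measurable]: "?L \<in> borel_measurable ?P"
    using m by (rule borel_measurable_prod_ennreal)
  have "density ?P ?L = PiM I (\<lambda>i. gauss (a i + d i) (s i))"
  proof (rule N'.PiM_eqI[OF I])
    show "sets (density ?P ?L) = sets (PiM I (\<lambda>i. gauss (a i + d i) (s i)))"
      unfolding sets_density by (rule sets_PiM_cong) simp_all
    fix A assume A: "\<And>i. i \<in> I \<Longrightarrow> A i \<in> sets (gauss (a i + d i) (s i))"
    then have A': "\<And>i. i \<in> I \<Longrightarrow> A i \<in> sets borel" by simp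
    have PA: "Pi\<^sub>E I A \<in> sets ?P" using A' by (intro sets_PiM_I_finite I) simp
    have "emeasure (density ?P ?L) (Pi\<^sub>E I A) = (\<integral>\<^sup>+ x. ?L x * indicator (Pi\<^sub>E I A) x \<partial>?P)"
      by (rule emeasure_density[OF Lm PA])
    also have "\<dots> = (\<integral>\<^sup>+ x. (\<Prod>i\<in>I. ennreal (tilt (a i) (d i) (s i) (x i)) * indicator (A i) (x i)) \<partial>?P)"
    proof (rule nn_integral_cong)
      fix x assume x: "x \<in> space ?P"
      have "indicator (Pi\<^sub>E I A) x = (\<Prod>i\<in>I. indicator (A i) (x i) :: ennreal)"
      proof (cases "\<forall>i\<in>I. x i \<in> A i")
        case True
        then have "x \<in> Pi\<^sub>E I A" using x by (auto simp: space_PiM PiE_iff)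
        then show ?thesis using True by simp
      next
        case False
        then have "x \<notin> Pi\<^sub>E I A" by (auto simp: PiE_iff)
        moreover have "(\<Prod>i\<in>I. indicator (A i) (x i) :: ennreal) = 0"
        proof -
          obtain i where "i \<in> I" "x i \<notin> A i" using False by blast
          then have "\<exists>i\<in>I. indicator (A i) (x i) = (0 :: ennreal)" by (intro bexI[of _ i]) simp_all
          then show ?thesis by (rule prod_zero[OF I])
        qed
        ultimately show ?thesis by simp
      qed
      then show "?L x * indicator (Pi\<^sub>E I A) x
          = (\<Prod>i\<in>I. ennreal (tilt (a i) (d i) (s i) (x i)) * indicator (A i) (x i))"
        by (simp only: prod.distrib)
    qed
    also have "\<dots> = (\<Prod>i\<in>I. \<integral>\<^sup>+ x. ennreal (tilt (a i) (d i) (s i) x) * indicator (A i) x \<partial>gauss (a i) (s i))"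
    proof (intro N.product_nn_integral_prod I)
      fix i assume "i \<in> I"
      then have [measurable]: "A i \<in> sets borel" using A' by blast
      show "(\<lambda>x. ennreal (tilt (a i) (d i) (s i) x) * indicator (A i) x) \<in> borel_measurable (gauss (a i) (s i))"
        by measurable
    qed
    also have "\<dots> = (\<Prod>i\<in>I. emeasure (gauss (a i + d i) (s i)) (A i))"
    proof (rule prod.cong[OF refl])
      fix i assume "i \<in> I"
      then have [measurable]: "A i \<in> sets borel" using A' by blast
      show "(\<integral>\<^sup>+ x. ennreal (tilt (a i) (d i) (s i) x) * indicator (A i) x \<partial>gauss (a i) (s i))
          = emeasure (gauss (a i + d i) (s i)) (A i)"
        by (subst nn_integral_gauss_tilt[OF s]) simp_all
    qed
    finally show "emeasure (density ?P ?L) (Pi\<^sub>E I A) = (\<Prod>i\<in>I. emeasure (gauss (a i + d i) (s i)) (A i))" .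
  qed
  then show ?thesis by simp
qed

text \<open>Integrate \<open>L \<le> \<lambda> L\<^sup>2 / 2 + 1 / (2 \<lambda>)\<close> for the likelihood ratio \<open>L\<close> over \<open>S\<close>,
  with \<open>\<lambda> = exp (- \<kappa>) / 2\<close>.\<close>

lemma PiM_gauss_contiguous:
  assumes I: "finite I" and s: "\<And>i. 0 < s i" and \<kappa>: "(\<Sum>i\<in>I. (d i)\<^sup>2 / (s i)\<^sup>2) \<le> \<kappa>"
    and S: "S \<in> sets (PiM I (\<lambda>_. borel))"
  shows "emeasure (PiM I (\<lambda>i. gauss (a i + d i) (s i))) S
    \<le> ennreal (1 / 4) + ennreal (exp \<kappa>) * emeasure (PiM I (\<lambda>i. gauss (a i) (s i))) S"
proof -
  let ?P = "PiM I (\<lambda>i. gauss (a i) (s i))"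
  let ?l = "\<lambda>x. \<Prod>i\<in>I. tilt (a i) (d i) (s i) (x i)"
  let ?L = "\<lambda>x. \<Prod>i\<in>I. ennreal (tilt (a i) (d i) (s i) (x i))"
  have ps: "prob_space (gauss b (s i))" for b i by (rule prob_space_normal_density[OF s])
  interpret N: product_prob_space "\<lambda>i. gauss (a i) (s i)" I
    using ps by (rule product_prob_spaceI)
  have "sets ?P = sets (PiM I (\<lambda>_. borel))" by (rule sets_PiM_cong) simp_all
  then have SP [measurable]: "S \<in> sets ?P" using S by simp
  have m: "(\<lambda>x. ennreal (tilt (a i) (d i) (s i) (x i))) \<in> borel_measurable ?P" if "i \<in> I" for i
    by (rule measurable_compose[OF measurable_component_singleton[OF that]]) simp
  have Lm [measurable]: "?L \<in> borel_measurable ?P"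
    using m by (rule borel_measurable_prod_ennreal)
  have Ll: "?L x = ennreal (?l x)" for x
    using less_imp_le[OF tilt_pos] by (intro prod_ennreal)
  have ineq: "?L x * indicator S x \<le> ennreal (exp (- \<kappa>) / 4) * (?L x)\<^sup>2 + ennreal (exp \<kappa>) * indicator S x" for x
  proof (cases "x \<in> S")
    case True
    have pos: "0 \<le> ?l x" using less_imp_le[OF tilt_pos] by (intro prod_nonneg)
    have "0 \<le> (?l x * (exp (- \<kappa>) / 2) - 1)\<^sup>2" by simp
    also have "\<dots> = exp (- \<kappa>) * (exp (- \<kappa>) / 4 * (?l x)\<^sup>2 - ?l x + exp \<kappa>)"
      by (simp add: power2_eq_square algebra_simps flip: exp_add)
    finally have "?l x \<le> exp (- \<kappa>) / 4 * (?l x)\<^sup>2 + exp \<kappa>"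
      by (simp add: zero_le_mult_iff)
    then have "ennreal (?l x) \<le> ennreal (exp (- \<kappa>) / 4 * (?l x)\<^sup>2 + exp \<kappa>)" by (rule ennreal_leI)
    also have "\<dots> = ennreal (exp (- \<kappa>) / 4) * (ennreal (?l x))\<^sup>2 + ennreal (exp \<kappa>)"
      unfolding ennreal_power[OF pos]
      by (subst ennreal_plus, simp, simp, subst ennreal_mult, simp, simp, rule refl)
    finally show ?thesis using True unfolding Ll by simp
  qed simp
  have sq: "(\<integral>\<^sup>+ x. (?L x)\<^sup>2 \<partial>?P) \<le> ennreal (exp \<kappa>)"
  proof -
    have "(\<integral>\<^sup>+ x. (?L x)\<^sup>2 \<partial>?P) = (\<integral>\<^sup>+ x. (\<Prod>i\<in>I. (ennreal (tilt (a i) (d i) (s i) (x i)))\<^sup>2) \<partial>?P)"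
      by (simp only: prod_power_distrib)
    also have "\<dots> = (\<Prod>i\<in>I. \<integral>\<^sup>+ x. (ennreal (tilt (a i) (d i) (s i) x))\<^sup>2 \<partial>gauss (a i) (s i))"
      by (intro N.product_nn_integral_prod I) measurable
    also have "\<dots> = (\<Prod>i\<in>I. ennreal (exp ((d i)\<^sup>2 / (s i)\<^sup>2)))"
      by (simp only: nn_integral_gauss_tilt_square[OF s])
    also have "\<dots> = ennreal (exp (\<Sum>i\<in>I. (d i)\<^sup>2 / (s i)\<^sup>2))"
      by (simp add: prod_ennreal exp_sum[OF I])
    also have "\<dots> \<le> ennreal (exp \<kappa>)" using \<kappa> by (intro ennreal_leI) simp
    finally show ?thesis .
  qed
  have "emeasure (PiM I (\<lambda>i. gauss (a i + d i) (s i))) S = (\<integral>\<^sup>+ x. ?L x * indicator S x \<partial>?P)"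
    unfolding PiM_gauss_shift[OF I s] by (rule emeasure_density[OF Lm SP])
  also have "\<dots> \<le> (\<integral>\<^sup>+ x. ennreal (exp (- \<kappa>) / 4) * (?L x)\<^sup>2 + ennreal (exp \<kappa>) * indicator S x \<partial>?P)"
    by (intro nn_integral_mono ineq)
  also have "\<dots> = ennreal (exp (- \<kappa>) / 4) * (\<integral>\<^sup>+ x. (?L x)\<^sup>2 \<partial>?P) + ennreal (exp \<kappa>) * emeasure ?P S"
    by (subst nn_integral_add) (simp_all add: nn_integral_cmult nn_integral_cmult_indicator)
  also have "\<dots> \<le> ennreal (exp (- \<kappa>) / 4) * ennreal (exp \<kappa>) + ennreal (exp \<kappa>) * emeasure ?P S"
    by (intro add_right_mono mult_left_mono sq) simp
  also have "ennreal (exp (- \<kappa>) / 4) * ennreal (exp \<kappa>) = ennreal (1 / 4)"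
    by (simp add: exp_minus flip: ennreal_mult)
  finally show ?thesis .
qed

section \<open>Approximation by a generating algebra\<close>

text \<open>One set \<open>C\<close> has to serve both measures at once, so that an inequality
  between them can be transferred. A countable union is first cut to finitely many sets by
  continuity from below, then each of these is approximated.\<close>

lemma approx_by_algebra:
  assumes alg: "algebra \<Omega> A" and M: "sets M = sigma_sets \<Omega> A" "finite_measure M"
    and N: "sets N = sets M" "finite_measure N"
    and B: "B \<in> sigma_sets \<Omega> A" and e: "0 < (e :: real)"
  shows "\<exists>C\<in>A. measure M (sym_diff B C) < e \<and> measure N (sym_diff B C) < e"
  using B e
proof (induction arbitrary: e)
  case (Basic B)
  then show ?case by (intro bexI[of _ B]) simp_all
next
  case Empty
  interpret algebra \<Omega> A by fact
  show ?case using Empty by (intro bexI[of _ "{}"]) simp_all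
next
  case (Compl B)
  interpret algebra \<Omega> A by fact
  obtain C where C: "C \<in> A" "measure M (sym_diff B C) < e" "measure N (sym_diff B C) < e"
    using Compl by blast
  have "B \<subseteq> \<Omega>" "C \<subseteq> \<Omega>"
    using sigma_sets_into_sp[OF space_closed Compl.hyps] C(1) space_closed by auto
  then have "sym_diff (\<Omega> - B) (\<Omega> - C) = sym_diff B C" by blast
  then show ?case using C by (intro bexI[of _ "\<Omega> - C"]) auto
next
  case (Union B)
  interpret algebra \<Omega> A by fact
  interpret M: finite_measure M by fact
  interpret N: finite_measure N by fact
  have BM: "B i \<in> sets M" for i using Union.hyps M(1) by simp
  then have BN: "B i \<in> sets N" for i using N(1) by simp
  define U where "U n = (\<Union>i<n. B i)" for n
  have UM: "U n \<in> sets M" for n unfolding U_def using BM by blast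
  have inc: "incseq U" unfolding U_def by (intro monoI UN_mono) auto
  have UB: "(\<Union>n. U n) = (\<Union>i. B i)" unfolding U_def by blast
  have VM: "(\<Union>i. B i) \<in> sets M" using BM by blast
  have lM: "(\<lambda>n. measure M (U n)) \<longlonglongrightarrow> measure M (\<Union>i. B i)"
    unfolding UB[symmetric] using UM inc by (intro M.finite_Lim_measure_incseq) blast+
  have lN: "(\<lambda>n. measure N (U n)) \<longlonglongrightarrow> measure N (\<Union>i. B i)"
    unfolding UB[symmetric] using UM inc N(1) by (intro N.finite_Lim_measure_incseq) blast+
  have "measure M (\<Union>i. B i) - e / 2 < measure M (\<Union>i. B i)"
      "measure N (\<Union>i. B i) - e / 2 < measure N (\<Union>i. B i)"
    using Union.prems by linarith+
  then have "\<forall>\<^sub>F n in sequentially. measure M (\<Union>i. B i) - e / 2 < measure M (U n) \<and>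
      measure N (\<Union>i. B i) - e / 2 < measure N (U n)"
    by (intro eventually_conj order_tendstoD(1)[OF lM] order_tendstoD(1)[OF lN])
  then obtain n where n: "measure M (\<Union>i. B i) - e / 2 < measure M (U n)"
      "measure N (\<Union>i. B i) - e / 2 < measure N (U n)"
    using eventually_happens'[OF sequentially_bot] by blast
  define d where "d = e / (2 * real (Suc n))"
  have d: "0 < d" "real n * d < e / 2" using Union.prems by (simp_all add: d_def field_simps)
  have "\<forall>i. \<exists>C. C \<in> A \<and> measure M (sym_diff (B i) C) < d \<and> measure N (sym_diff (B i) C) < d"
    using Union.IH d(1) by blast
  then obtain C where C: "\<And>i. C i \<in> A" "\<And>i. measure M (sym_diff (B i) (C i)) < d"
    "\<And>i. measure N (sym_diff (B i) (C i)) < d"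
    by metis
  define D where "D = (\<Union>i<n. C i)"
  have DA: "D \<in> A" unfolding D_def using C(1) by (intro finite_UN) auto
  have CM: "C i \<in> sets M" for i using C(1) M(1) by (simp add: sigma_sets.Basic)
  have sub: "sym_diff (\<Union>i. B i) D \<subseteq> ((\<Union>i. B i) - U n) \<union> (\<Union>i\<in>{..<n}. sym_diff (B i) (C i))"
    unfolding U_def D_def by blast
  have bound: "measure K (sym_diff (\<Union>i. B i) D) < e"
    if K: "finite_measure K" "sets K = sets M" and nK: "measure K (\<Union>i. B i) - e / 2 < measure K (U n)"
      and CK: "\<And>i. measure K (sym_diff (B i) (C i)) < d" for K
  proof -
    interpret K: finite_measure K by fact
    have m: "sym_diff (B i) (C i) \<in> sets K" for i
      using BM CM K(2) by simp
    have "measure K (sym_diff (\<Union>i. B i) D) \<le> measure K (((\<Union>i. B i) - U n) \<union> (\<Union>i\<in>{..<n}. sym_diff (B i) (C i)))"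
      using m VM UM K(2) by (intro K.finite_measure_mono sub) blast
    also have "\<dots> \<le> measure K ((\<Union>i. B i) - U n) + measure K (\<Union>i\<in>{..<n}. sym_diff (B i) (C i))"
      using m VM UM K(2) by (intro measure_Un_le) blast+
    also have "measure K ((\<Union>i. B i) - U n) = measure K (\<Union>i. B i) - measure K (U n)"
      using VM UM K(2) by (intro K.finite_measure_Diff) (auto simp: U_def)
    also have "measure K (\<Union>i\<in>{..<n}. sym_diff (B i) (C i)) \<le> (\<Sum>i\<in>{..<n}. measure K (sym_diff (B i) (C i)))"
      using m by (intro K.finite_measure_subadditive_finite) blast+
    also have "(\<Sum>i\<in>{..<n}. measure K (sym_diff (B i) (C i))) \<le> (\<Sum>i\<in>{..<n}. d)"
      using CK less_imp_le by (intro sum_mono) blast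
    also have "\<dots> = real n * d" by simp
    finally show ?thesis using nK d(2) by simp
  qed
  show ?case
    using DA bound[OF M(2) refl n(1) C(2)] bound[OF N(2,1) n(2) C(3)] by blast
qed

text \<open>Passing from \<open>B\<close> to an approximating \<open>C\<close> costs
  \<open>d\<close> on the left and \<open>K * d\<close> on the right, hence the choice
  \<open>d = e / (K + 1)\<close>.\<close>

lemma measure_bound_from_algebra:
  fixes c K :: real
  assumes alg: "algebra \<Omega> A" and M: "sets M = sigma_sets \<Omega> A" "finite_measure M"
    and N: "sets N = sets M" "finite_measure N" and K: "0 \<le> K"
    and le: "\<And>C. C \<in> A \<Longrightarrow> measure N C \<le> c + K * measure M C"
    and B: "B \<in> sets M"
  shows "measure N B \<le> c + K * measure M B"
proof (rule field_le_epsilon)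
  fix e :: real assume e: "0 < e"
  interpret M: finite_measure M by fact
  interpret N: finite_measure N by fact
  define d where "d = e / (K + 1)"
  have d: "0 < d" "(K + 1) * d = e" using e K by (simp_all add: d_def add_nonneg_eq_0_iff)
  obtain C where C: "C \<in> A" "measure M (sym_diff B C) < d" "measure N (sym_diff B C) < d"
    using approx_by_algebra[OF alg M N _ d(1), of B] B M(1) by blast
  have CM: "C \<in> sets M" using C(1) M(1) by (simp add: sigma_sets.Basic)
  have BN: "B \<in> sets N" and CN: "C \<in> sets N" using B CM N(1) by simp_all
  have "measure N B \<le> measure N (C \<union> sym_diff B C)"
    using BN CN by (intro N.finite_measure_mono) blast+
  also have "\<dots> \<le> measure N C + measure N (sym_diff B C)"
    using BN CN by (intro measure_Un_le) blast+
  finally have 1: "measure N B \<le> measure N C + d" using C(3) by simp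
  have "measure M C \<le> measure M (B \<union> sym_diff B C)"
    using B CM by (intro M.finite_measure_mono) blast+
  also have "\<dots> \<le> measure M B + measure M (sym_diff B C)"
    using B CM by (intro measure_Un_le) blast+
  finally have "measure M C \<le> measure M B + d" using C(2) by simp
  then have "K * measure M C \<le> K * (measure M B + d)" using K by (rule mult_left_mono)
  then have "measure N B \<le> c + K * measure M B + (K + 1) * d"
    using 1 le[OF C(1)] by (simp add: algebra_simps)
  then show "measure N B \<le> c + K * measure M B + e" using d(2) by simp
qed

section \<open>Contiguity of white noise laws\<close>

text \<open>The Cauchy-Schwarz inequality, read off from the nonnegative integral of the squared
  deviation of \<phi> from its mean \<open>c\<close>.\<close>

lemma square_set_integral_le:
  fixes \<phi> :: "real \<Rightarrow> real"
  assumes i1: "set_integrable lborel {a<..b} \<phi>" and i2: "set_integrable lborel {a<..b} (\<lambda>u. (\<phi> u)\<^sup>2)" and ab: "a < b"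
  shows "(LINT u:{a<..b}|lborel. \<phi> u)\<^sup>2 / (b - a) \<le> (LINT u:{a<..b}|lborel. (\<phi> u)\<^sup>2)"
proof -
  let ?A = "{a<..b}" and ?I = "LINT u:{a<..b}|lborel. \<phi> u"
  define c where "c = ?I / (b - a)"
  have ic: "set_integrable lborel ?A (\<lambda>u. c\<^sup>2)"
    using ab by (simp add: set_integrable_def integrable_real_indicator)
  have i3: "set_integrable lborel ?A (\<lambda>u. 2 * c * \<phi> u)" using i1 by (intro set_integrable_mult_right)
  have i4: "set_integrable lborel ?A (\<lambda>u. (\<phi> u)\<^sup>2 - 2 * c * \<phi> u)" by (rule set_integral_diff(1)[OF i2 i3])
  have "0 \<le> (LINT u:?A|lborel. (\<phi> u)\<^sup>2 - 2 * c * \<phi> u + c\<^sup>2)"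
  proof -
    have "0 \<le> indicator ?A u *\<^sub>R ((\<phi> u)\<^sup>2 - 2 * c * \<phi> u + c\<^sup>2)" for u
    proof -
      have "(\<phi> u)\<^sup>2 - 2 * c * \<phi> u + c\<^sup>2 = (\<phi> u - c)\<^sup>2" by (simp add: power2_eq_square algebra_simps)
      then show ?thesis by simp
    qed
    then show ?thesis unfolding set_lebesgue_integral_def by (intro integral_nonneg_AE AE_I2)
  qed
  also have "\<dots> = (LINT u:?A|lborel. (\<phi> u)\<^sup>2) - 2 * c * ?I + c\<^sup>2 * (b - a)"
  proof -
    have "(LINT u:?A|lborel. c\<^sup>2) = c\<^sup>2 * (b - a)"
      using ab by (simp add: set_lebesgue_integral_def)
    then show ?thesis
      unfolding set_integral_add(2)[OF i4 ic] set_integral_diff(2)[OF i2 i3] by simp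
  qed
  also have "\<dots> = (LINT u:?A|lborel. (\<phi> u)\<^sup>2) - ?I\<^sup>2 / (b - a)"
  proof -
    have "c * (b - a) = ?I" using ab by (simp add: c_def)
    then have "c\<^sup>2 * (b - a) = c * ?I" by (simp add: power2_eq_square mult.assoc)
    moreover have "c * ?I = ?I\<^sup>2 / (b - a)" by (simp add: c_def power2_eq_square)
    ultimately show ?thesis by linarith
  qed
  finally show ?thesis by simp
qed

lemma (in convex_fn) continuous_primitive:
  "continuous_on {0..1} (\<lambda>t. LINT s:{0..t}|lborel. f s)"
proof -
  have "set_integrable lborel {0..1} f" by (rule f_set_integrable) auto
  then have "f integrable_on {0..1}" by (rule set_borel_integral_eq_integral(1))
  then have "continuous_on {0..1} (\<lambda>t. integral {0..t} f)"
    by (rule indefinite_integral_continuous_1)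
  moreover have "(LINT s:{0..t}|lborel. f s) = integral {0..t} f" if "t \<in> {0..1}" for t
    using that by (intro set_borel_integral_eq_integral(2) f_set_integrable) auto
  then have "continuous_on {0..1} (\<lambda>t. LINT s:{0..t}|lborel. f s)
      \<longleftrightarrow> continuous_on {0..1} (\<lambda>t. integral {0..t} f)"
    by (intro continuous_on_cong refl)
  ultimately show ?thesis by (rule iffD2[rotated])
qed

locale wiener =
  fixes P :: "(real \<Rightarrow> real) measure" and \<epsilon> :: real
  assumes wiener: "wiener_measure P" and eps_pos: "0 < \<epsilon>"
begin

abbreviation "product_space \<equiv> PiM {0..1::real} (\<lambda>_. borel :: real measure)"

lemma bm: "standard_brownian_motion P (\<lambda>t w. w t)"
  using wiener by (simp add: wiener_measure_def)

sublocale prob_space P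
  using bm by (simp add: standard_brownian_motion_def)

lemma eval_measurable: "t \<in> {0..1} \<Longrightarrow> (\<lambda>w. w t) \<in> borel_measurable P"
  using bm unfolding standard_brownian_motion_def by blast

lemma space_P: "w \<in> space P \<Longrightarrow> continuous_on {0..1} w"
proof -
  have "space P = space path_space"
    using wiener by (intro sets_eq_imp_space_eq) (simp add: wiener_measure_def)
  moreover assume "w \<in> space P"
  ultimately show ?thesis by (simp add: path_space_def space_restrict_space)
qed

definition observe :: "(real \<Rightarrow> real) \<Rightarrow> (real \<Rightarrow> real) \<Rightarrow> real \<Rightarrow> real" where
  "observe h w = (\<lambda>t\<in>{0..1}. white_noise \<epsilon> h w t)"

lemma observe_product: "observe h \<in> measurable P product_space"
  unfolding observe_def white_noise_def
proof (rule measurable_restrict)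
  fix t :: real assume "t \<in> {0..1}"
  then have [measurable]: "(\<lambda>w. w t) \<in> borel_measurable P" by (rule eval_measurable)
  show "(\<lambda>w. (LINT s:{0..t}|lborel. h s) + \<epsilon> * w t) \<in> borel_measurable P" by measurable
qed

lemma observe_path:
  assumes "h \<in> convex_class"
  shows "observe h \<in> measurable P path_space"
  unfolding path_space_def
proof (rule measurable_restrict_space2[OF _ observe_product], intro Pi_I CollectI)
  interpret convex_fn h using assms by (rule convex_fn.intro)
  fix w assume "w \<in> space P"
  then have "continuous_on {0..1} (\<lambda>t. white_noise \<epsilon> h w t)"
    unfolding white_noise_def by (intro continuous_intros continuous_primitive space_P)
  moreover have "continuous_on {0..1} (observe h w) \<longleftrightarrow> continuous_on {0..1} (\<lambda>t. white_noise \<epsilon> h w t)"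
    by (intro continuous_on_cong refl) (simp add: observe_def)
  ultimately show "continuous_on {0..1} (observe h w)" by blast
qed

text \<open>The law on the full product space, whose sigma-algebra is generated by the algebra of
  cylinder sets. Continuity of a path is not an event there, so the passage to
  \<open>path_space\<close> goes through traces of events, in
  \<open>white_noise_law_eq\<close>.\<close>

definition law :: "(real \<Rightarrow> real) \<Rightarrow> (real \<Rightarrow> real) measure" where
  "law h = distr P product_space (observe h)"

lemma prob_space_law: "prob_space (law h)"
  unfolding law_def by (rule prob_space_distr[OF observe_product])

lemma sets_law [simp]: "sets (law h) = sets product_space"
  by (simp add: law_def)

lemma prob_space_white_noise_law:
  "h \<in> convex_class \<Longrightarrow> prob_space (white_noise_law P \<epsilon> h)"
  unfolding white_noise_law_def observe_def[symmetric] by (rule prob_space_distr[OF observe_path])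

lemma sets_white_noise_law [simp]: "sets (white_noise_law P \<epsilon> h) = sets path_space"
  by (simp add: white_noise_law_def)

text \<open>Every observed path is continuous, so intersecting an event with the continuous
  functions changes no preimage.\<close>

lemma white_noise_law_eq:
  assumes h: "h \<in> convex_class" and A: "A \<in> sets product_space"
  shows "measure (white_noise_law P \<epsilon> h) ({w. continuous_on {0..1} w} \<inter> A) = measure (law h) A"
proof -
  have "{w. continuous_on {0..1} w} \<inter> A \<in> sets path_space"
    unfolding path_space_def sets_restrict_space using A by blast
  then have "measure (white_noise_law P \<epsilon> h) ({w. continuous_on {0..1} w} \<inter> A)
      = prob (observe h -` ({w. continuous_on {0..1} w} \<inter> A) \<inter> space P)"
    unfolding white_noise_law_def observe_def[symmetric] by (intro measure_distr observe_path h)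
  also have "observe h -` ({w. continuous_on {0..1} w} \<inter> A) \<inter> space P = observe h -` A \<inter> space P"
    using measurable_space[OF observe_path[OF h]] by (auto simp: path_space_def space_restrict_space)
  also have "prob \<dots> = measure (law h) A"
    unfolding law_def by (intro measure_distr[symmetric] observe_product A)
  finally show ?thesis .
qed

text \<open>The point 0 is adjoined to express path values as sums of increments, the point 1 to
  have at least one increment.\<close>

lemma sampling_times:
  assumes "finite J" "J \<subseteq> {0..1::real}"
  obtains n :: nat and \<tau> where "0 < n" "\<tau> 0 = 0" "\<And>i. i < n \<Longrightarrow> \<tau> i < \<tau> (Suc i)"
    "\<And>i. i \<le> n \<Longrightarrow> \<tau> i \<in> {0..1}" "J \<subseteq> \<tau> ` {..n}"
proof -
  define S where "S = insert 0 (insert 1 J)"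
  define xs where "xs = sorted_list_of_set S"
  have fin: "finite S" using assms(1) by (simp add: S_def)
  have set: "set xs = S" unfolding xs_def by (rule set_sorted_list_of_set[OF fin])
  have sorted: "sorted_wrt (<) xs" unfolding xs_def by (rule strict_sorted_list_of_set)
  have S01: "S \<subseteq> {0..1}" using assms(2) by (auto simp: S_def)
  have "card {0, 1 :: real} \<le> card S" using fin by (intro card_mono) (auto simp: S_def)
  then have len: "2 \<le> length xs" unfolding xs_def using fin by simp
  define n where "n = length xs - 1"
  have less: "xs ! i < xs ! k" if "i < k" "k < length xs" for i k
    using sorted that by (simp add: sorted_wrt_iff_nth_less)
  have "0 \<in> set xs" unfolding set by (simp add: S_def)
  then obtain k where k: "k < length xs" "xs ! k = 0" by (auto simp: in_set_conv_nth)
  have "0 < length xs" using len by linarith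
  then have "xs ! 0 \<in> S" unfolding set[symmetric] by (rule nth_mem)
  then have "0 \<le> xs ! 0" using S01 by auto
  then have "k = 0" using less[of 0 k] k by (cases k) auto
  then have z: "xs ! 0 = 0" using k by simp
  show ?thesis
  proof (rule that[of n "\<lambda>i. xs ! i"])
    show "0 < n" using len by (simp add: n_def)
    show "xs ! i < xs ! Suc i" if "i < n" for i using that less by (simp add: n_def)
    show "xs ! i \<in> {0..1}" if "i \<le> n" for i
    proof -
      have "i < length xs" using that len by (simp add: n_def)
      then have "xs ! i \<in> S" unfolding set[symmetric] by (rule nth_mem)
      then show ?thesis using S01 by blast
    qed
    show "J \<subseteq> (!) xs ` {..n}"
    proof
      fix t assume "t \<in> J"
      then have "t \<in> set xs" unfolding set by (simp add: S_def)
      then obtain i where "i < length xs" "xs ! i = t" by (auto simp: in_set_conv_nth)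
      then show "t \<in> (!) xs ` {..n}" by (intro image_eqI[of _ _ i]) (auto simp: n_def)
    qed
  qed (rule z)
qed

lemma increments_law:
  assumes n: "0 < n" and \<tau>: "\<And>i. i < n \<Longrightarrow> \<tau> i < \<tau> (Suc i)" "\<And>i. i \<le> n \<Longrightarrow> \<tau> i \<in> {0..1}"
    and s: "\<And>i. i < n \<Longrightarrow> s i = \<epsilon> * sqrt (\<tau> (Suc i) - \<tau> i)"
  shows "distr P (PiM {..<n} (\<lambda>_. borel)) (\<lambda>w. \<lambda>i\<in>{..<n}. D i + \<epsilon> * (w (\<tau> (Suc i)) - w (\<tau> i)))
    = PiM {..<n} (\<lambda>i. gauss (D i) (s i))"
proof -
  let ?X = "\<lambda>i w. w (\<tau> (Suc i)) - w (\<tau> i) :: real"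
  let ?Y = "\<lambda>i w. D i + \<epsilon> * ?X i w"
  have nrm: "distributed P lborel (?Y i) (normal_density (D i) (s i))" if i: "i < n" for i
  proof -
    have "\<forall>s\<in>{0..1}. \<forall>t\<in>{0..1}. s < t \<longrightarrow>
        distributed P lborel (\<lambda>w. w t - w s) (normal_density 0 (sqrt (t - s)))"
      using bm unfolding standard_brownian_motion_def by blast
    then have "distributed P lborel (?X i) (normal_density 0 (sqrt (\<tau> (Suc i) - \<tau> i)))"
      using \<tau>(1)[OF i] \<tau>(2)[of i] \<tau>(2)[of "Suc i"] i by simp
    then show ?thesis
      using normal_density_affine[of "?X i" 0 "sqrt (\<tau> (Suc i) - \<tau> i)" \<epsilon> "D i"] \<tau>(1)[OF i] eps_pos s[OF i]
      by simp
  qed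
  have "\<forall>n (t :: nat \<Rightarrow> real). (\<forall>i\<le>n. t i \<in> {0..1}) \<and> (\<forall>i<n. t i < t (Suc i)) \<longrightarrow>
      indep_vars (\<lambda>_. borel) (\<lambda>i w. w (t (Suc i)) - w (t i)) {..<n}"
    using bm unfolding standard_brownian_motion_def by blast
  then have "indep_vars (\<lambda>_. borel) ?X {..<n}" using \<tau> by blast
  then have ind: "indep_vars (\<lambda>_. borel) ?Y {..<n}"
    by (rule indep_vars_compose2) simp
  have rv: "?Y i \<in> borel_measurable P" if "i \<in> {..<n}" for i
    using distributed_measurable[OF nrm[of i]] that by simp
  have ne: "{..<n} \<noteq> {}" using n by (simp add: lessThan_empty_iff)
  have "distr P (PiM {..<n} (\<lambda>_. borel)) (\<lambda>w. \<lambda>i\<in>{..<n}. ?Y i w) = PiM {..<n} (\<lambda>i. distr P borel (?Y i))"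
    by (rule iffD1[OF indep_vars_iff_distr_eq_PiM'[OF ne] ind]) (rule rv)
  also have "\<dots> = PiM {..<n} (\<lambda>i. gauss (D i) (s i))"
  proof (rule PiM_cong[OF refl])
    fix i assume "i \<in> {..<n}"
    then have "distr P lborel (?Y i) = gauss (D i) (s i)"
      using distributed_distr_eq_density[OF nrm[of i]] by simp
    moreover have "distr P lborel (?Y i) = distr P borel (?Y i)" by (rule distr_cong) simp_all
    ultimately show "distr P borel (?Y i) = gauss (D i) (s i)" by simp
  qed
  finally show ?thesis .
qed

text \<open>The observed values are partial sums of independent Gaussian increments. They start from
  \<open>w 0 = 0\<close>, which holds only almost surely, so the two events are compared up to a
  null set.\<close>

lemma law_cylinder:
  assumes n: "0 < n" and \<tau>: "\<tau> 0 = 0" "\<And>i. i < n \<Longrightarrow> \<tau> i < \<tau> (Suc i)" "\<And>i. i \<le> n \<Longrightarrow> \<tau> i \<in> {0..1}"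
    and s: "\<And>i. i < n \<Longrightarrow> s i = \<epsilon> * sqrt (\<tau> (Suc i) - \<tau> i)"
    and k: "\<And>t. t \<in> J \<Longrightarrow> k t \<le> n \<and> \<tau> (k t) = t" and J: "J \<subseteq> {0..1}"
    and X: "X \<in> sets (PiM J (\<lambda>_. borel))"
  shows "emeasure (law h) (prod_emb {0..1} (\<lambda>_. borel) J X)
    = emeasure (PiM {..<n} (\<lambda>i. gauss ((LINT u:{0..\<tau> (Suc i)}|lborel. h u) - (LINT u:{0..\<tau> i}|lborel. h u)) (s i)))
        ((\<lambda>x. \<lambda>t\<in>J. \<Sum>i<k t. x i) -` X \<inter> space (PiM {..<n} (\<lambda>_. borel)))"
proof -
  let ?H = "\<lambda>t. LINT u:{0..t}|lborel. h u"
  let ?D = "\<lambda>i. ?H (\<tau> (Suc i)) - ?H (\<tau> i)"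
  let ?Y = "\<lambda>w. \<lambda>i\<in>{..<n}. ?D i + \<epsilon> * (w (\<tau> (Suc i)) - w (\<tau> i))"
  let ?F = "\<lambda>x. \<lambda>t\<in>J. \<Sum>i<k t. x i :: real"
  have F: "?F \<in> measurable (PiM {..<n} (\<lambda>_. borel)) (PiM J (\<lambda>_. borel))"
    using k by (intro measurable_restrict borel_measurable_sum measurable_component_singleton) fastforce
  have Y: "?Y \<in> measurable P (PiM {..<n} (\<lambda>_. borel))"
  proof (rule measurable_restrict)
    fix i assume "i \<in> {..<n}"
    then have [measurable]: "(\<lambda>w. w (\<tau> (Suc i))) \<in> borel_measurable P" "(\<lambda>w. w (\<tau> i)) \<in> borel_measurable P"
      using \<tau>(3)[of i] \<tau>(3)[of "Suc i"] by (auto intro!: eval_measurable)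
    show "(\<lambda>w. ?D i + \<epsilon> * (w (\<tau> (Suc i)) - w (\<tau> i))) \<in> borel_measurable P" by measurable
  qed
  have H0: "?H 0 = 0"
    unfolding set_lebesgue_integral_def
  proof (rule integral_eq_zero_AE)
    show "AE u in lborel. indicator {0..0} u *\<^sub>R h u = 0"
      using AE_lborel_singleton[of 0] by eventually_elim simp
  qed
  have eq: "restrict (observe h w) J = ?F (?Y w)" if w0: "w 0 = 0" for w
  proof (rule restrict_ext)
    fix t assume t: "t \<in> J"
    have "(\<Sum>i<k t. ?Y w i) = (\<Sum>i<k t. (?H (\<tau> (Suc i)) + \<epsilon> * w (\<tau> (Suc i))) - (?H (\<tau> i) + \<epsilon> * w (\<tau> i)))"
      using k[OF t] by (intro sum.cong refl) (auto simp: algebra_simps)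
    also have "\<dots> = (?H (\<tau> (k t)) + \<epsilon> * w (\<tau> (k t))) - (?H (\<tau> 0) + \<epsilon> * w (\<tau> 0))"
      by (rule sum_lessThan_telescope)
    also have "\<dots> = white_noise \<epsilon> h w t"
      using k[OF t] \<tau>(1) w0 H0 by (simp add: white_noise_def)
    finally show "observe h w t = (\<Sum>i<k t. ?Y w i)"
      using t J by (simp add: observe_def subset_iff)
  qed
  have emb: "prod_emb {0..1} (\<lambda>_. borel) J X \<in> sets product_space"
    using J X by (rule measurable_prod_emb)
  have obs_sp: "observe h w \<in> space product_space" if "w \<in> space P" for w
    by (rule measurable_space[OF observe_product that])
  have FX: "?F -` X \<inter> space (PiM {..<n} (\<lambda>_. borel)) \<in> sets (PiM {..<n} (\<lambda>_. borel))"
    by (rule measurable_sets[OF F X])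
  have "emeasure (law h) (prod_emb {0..1} (\<lambda>_. borel) J X)
      = emeasure P (observe h -` prod_emb {0..1} (\<lambda>_. borel) J X \<inter> space P)"
    unfolding law_def by (rule emeasure_distr[OF observe_product emb])
  also have "\<dots> = emeasure P (?Y -` (?F -` X \<inter> space (PiM {..<n} (\<lambda>_. borel))) \<inter> space P)"
  proof (rule emeasure_eq_AE)
    have "AE w in P. w 0 = 0" using bm unfolding standard_brownian_motion_def by blast
    then show "AE w in P. w \<in> observe h -` prod_emb {0..1} (\<lambda>_. borel) J X \<inter> space P \<longleftrightarrow>
        w \<in> ?Y -` (?F -` X \<inter> space (PiM {..<n} (\<lambda>_. borel))) \<inter> space P"
      using AE_space
    proof eventually_elim
      case (elim w)
      have "observe h w \<in> prod_emb {0..1} (\<lambda>_. borel) J X \<longleftrightarrow> restrict (observe h w) J \<in> X"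
        using obs_sp[OF elim(2)] by (simp add: prod_emb_def space_PiM)
      moreover have "?Y w \<in> space (PiM {..<n} (\<lambda>_. borel))" by (rule measurable_space[OF Y elim(2)])
      ultimately show ?case unfolding eq[of w, OF elim(1)] using elim(2) by simp
    qed
    show "observe h -` prod_emb {0..1} (\<lambda>_. borel) J X \<inter> space P \<in> sets P"
      by (rule measurable_sets[OF observe_product emb])
    show "?Y -` (?F -` X \<inter> space (PiM {..<n} (\<lambda>_. borel))) \<inter> space P \<in> sets P"
      by (rule measurable_sets[OF Y FX])
  qed
  also have "\<dots> = emeasure (distr P (PiM {..<n} (\<lambda>_. borel)) ?Y) (?F -` X \<inter> space (PiM {..<n} (\<lambda>_. borel)))"
    by (rule emeasure_distr[OF Y FX, symmetric])
  also have "distr P (PiM {..<n} (\<lambda>_. borel)) ?Y = PiM {..<n} (\<lambda>i. gauss (?D i) (s i))"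
    using n \<tau>(2,3) s by (rule increments_law)
  finally show ?thesis .
qed

end

lemma (in convex_fn) diff_square_set_integrable:
  assumes "g \<in> convex_class"
  shows "set_integrable lborel {0..1} (\<lambda>t. g t - f t)" "set_integrable lborel {0..1} (\<lambda>t. (g t - f t)\<^sup>2)"
proof -
  interpret G: convex_fn g using assms by (rule convex_fn.intro)
  have "set_integrable lborel {0..1} g" "set_integrable lborel {0..1} f"
    by (rule G.f_set_integrable f_set_integrable; simp)+
  then show "set_integrable lborel {0..1} (\<lambda>t. g t - f t)" by (rule set_integral_diff(1))
  define b where "b = (\<bar>G.fmax\<bar> + \<bar>G.M\<bar>) + (\<bar>fmax\<bar> + \<bar>M\<bar>)"
  show "set_integrable lborel {0..1} (\<lambda>t. (g t - f t)\<^sup>2)"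
  proof (rule set_integrable_bounded_01[where B = "b\<^sup>2"])
    have "(\<lambda>t. (indicator {0..1} t * g t - indicator {0..1} t * f t)\<^sup>2) \<in> borel_measurable borel"
      using G.measurable_indicator_f measurable_indicator_f by measurable
    moreover have "(\<lambda>t. (indicator {0..1} t * g t - indicator {0..1} t * f t)\<^sup>2)
        = (\<lambda>t. indicator {0..1::real} t *\<^sub>R (g t - f t)\<^sup>2)"
      by (auto simp: fun_eq_iff indicator_def)
    ultimately show "set_borel_measurable lborel {0..1} (\<lambda>t. (g t - f t)\<^sup>2)"
      by (simp add: set_borel_measurable_def)
    fix t :: real assume t: "t \<in> {0..1}"
    have "\<bar>g t - f t\<bar> \<le> \<bar>g t\<bar> + \<bar>f t\<bar>" by (rule abs_triangle_ineq4)
    also have "\<dots> \<le> b" unfolding b_def by (intro add_mono G.abs_f_le abs_f_le t)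
    finally have "\<bar>g t - f t\<bar>\<^sup>2 \<le> b\<^sup>2" by (intro power_mono) auto
    then show "\<bar>(g t - f t)\<^sup>2\<bar> \<le> b\<^sup>2" by simp
  qed auto
qed

context wiener begin

text \<open>By Cauchy-Schwarz on each sampling interval, discretization can only decrease the energy
  of the shift; the interval energies telescope through \<open>Q\<close>. The bound is therefore the
  same for all sampling times.\<close>

lemma shift_cost:
  assumes f: "f \<in> convex_class" and g: "g \<in> convex_class"
    and \<tau>: "\<And>i. i < n \<Longrightarrow> \<tau> i < \<tau> (Suc i)" "\<And>i. i \<le> n \<Longrightarrow> \<tau> i \<in> {0..1}"
    and \<kappa>: "(LINT t:{0..1}|lborel. (g t - f t)\<^sup>2) \<le> \<kappa> * \<epsilon>\<^sup>2"
    and d: "\<And>i. d i = ((LINT u:{0..\<tau> (Suc i)}|lborel. g u) - (LINT u:{0..\<tau> i}|lborel. g u))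
      - ((LINT u:{0..\<tau> (Suc i)}|lborel. f u) - (LINT u:{0..\<tau> i}|lborel. f u))"
  shows "(\<Sum>i<n. (d i)\<^sup>2 / (\<epsilon> * sqrt (\<tau> (Suc i) - \<tau> i))\<^sup>2) \<le> \<kappa>"
proof -
  interpret F: convex_fn f using f by (rule convex_fn.intro)
  interpret G: convex_fn g using g by (rule convex_fn.intro)
  let ?\<phi> = "\<lambda>t. g t - f t"
  note i1 = F.diff_square_set_integrable(1)[OF g]
  note i2 = F.diff_square_set_integrable(2)[OF g]
  define Q where "Q t = (LINT u:{0..t}|lborel. (?\<phi> u)\<^sup>2)" for t
  have Q_diff: "Q b - Q a = (LINT u:{a<..b}|lborel. (?\<phi> u)\<^sup>2)" if "0 \<le> a" "a \<le> b" "b \<le> 1" for a b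
    unfolding Q_def using that by (rule set_integral_Ioc_diff[OF i2])
  have Q_mono: "Q a \<le> Q b" if "0 \<le> a" "a \<le> b" "b \<le> 1" for a b
  proof -
    have "0 \<le> (LINT u:{a<..b}|lborel. (?\<phi> u)\<^sup>2)"
      unfolding set_lebesgue_integral_def by (intro integral_nonneg_AE AE_I2) simp
    then show ?thesis using Q_diff[OF that] by linarith
  qed
  have cost: "(d i)\<^sup>2 / (\<epsilon> * sqrt (\<tau> (Suc i) - \<tau> i))\<^sup>2 \<le> (Q (\<tau> (Suc i)) - Q (\<tau> i)) / \<epsilon>\<^sup>2" if i: "i < n" for i
  proof -
    have r: "0 \<le> \<tau> i" "\<tau> i < \<tau> (Suc i)" "\<tau> i \<le> \<tau> (Suc i)" "\<tau> (Suc i) \<le> 1"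
      using \<tau>(1)[OF i] \<tau>(2)[of i] \<tau>(2)[of "Suc i"] i by auto
    let ?A = "{\<tau> i<..\<tau> (Suc i)}"
    have sub: "?A \<subseteq> {0..1}" "?A \<in> sets lborel" using r by auto
    have gi: "set_integrable lborel {0..1} g" "set_integrable lborel {0..1} f"
      by (rule G.f_set_integrable F.f_set_integrable; simp)+
    have "d i = (LINT u:?A|lborel. g u) - (LINT u:?A|lborel. f u)"
      unfolding d set_integral_Ioc_diff[OF gi(1) r(1,3,4)] set_integral_Ioc_diff[OF gi(2) r(1,3,4)] ..
    also have "\<dots> = (LINT u:?A|lborel. ?\<phi> u)"
      using sub by (intro set_integral_diff(2)[symmetric] set_integrable_subset[OF gi(1)]
        set_integrable_subset[OF gi(2)]) auto
    finally have "(d i)\<^sup>2 / (\<tau> (Suc i) - \<tau> i) \<le> (LINT u:?A|lborel. (?\<phi> u)\<^sup>2)"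
      using square_set_integral_le[OF set_integrable_subset[OF i1 sub(2,1)]
        set_integrable_subset[OF i2 sub(2,1)] r(2)] by simp
    also have "\<dots> = Q (\<tau> (Suc i)) - Q (\<tau> i)" using r by (intro Q_diff[symmetric]) auto
    finally have "(d i)\<^sup>2 / (\<tau> (Suc i) - \<tau> i) / \<epsilon>\<^sup>2 \<le> (Q (\<tau> (Suc i)) - Q (\<tau> i)) / \<epsilon>\<^sup>2"
      by (intro divide_right_mono) auto
    moreover have "(\<epsilon> * sqrt (\<tau> (Suc i) - \<tau> i))\<^sup>2 = (\<tau> (Suc i) - \<tau> i) * \<epsilon>\<^sup>2"
      using r by (simp add: power_mult_distrib)
    ultimately show ?thesis by (simp only: divide_divide_eq_left)
  qed
  have "(\<Sum>i<n. (d i)\<^sup>2 / (\<epsilon> * sqrt (\<tau> (Suc i) - \<tau> i))\<^sup>2) \<le> (\<Sum>i<n. (Q (\<tau> (Suc i)) - Q (\<tau> i)) / \<epsilon>\<^sup>2)"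
    by (intro sum_mono cost) simp
  also have "\<dots> = (\<Sum>i<n. Q (\<tau> (Suc i)) - Q (\<tau> i)) / \<epsilon>\<^sup>2" by (simp only: sum_divide_distrib)
  also have "(\<Sum>i<n. Q (\<tau> (Suc i)) - Q (\<tau> i)) = Q (\<tau> n) - Q (\<tau> 0)"
    by (rule sum_lessThan_telescope)
  also have "\<dots> \<le> Q 1"
  proof -
    have "0 \<le> Q (\<tau> 0)"
      unfolding Q_def set_lebesgue_integral_def by (intro integral_nonneg_AE AE_I2) simp
    moreover have "Q (\<tau> n) \<le> Q 1" using \<tau>(2)[of n] by (intro Q_mono) auto
    ultimately show ?thesis by linarith
  qed
  also have "\<dots> \<le> \<kappa> * \<epsilon>\<^sup>2" unfolding Q_def by (rule \<kappa>)
  finally show ?thesis using eps_pos by (simp add: divide_right_mono)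
qed

lemma cylinder_contiguous:
  assumes f: "f \<in> convex_class" and g: "g \<in> convex_class"
    and \<kappa>: "(LINT t:{0..1}|lborel. (g t - f t)\<^sup>2) \<le> \<kappa> * \<epsilon>\<^sup>2"
    and J: "finite J" "J \<subseteq> {0..1}" and X: "X \<in> sets (PiM J (\<lambda>_. borel))"
  shows "emeasure (law g) (prod_emb {0..1} (\<lambda>_. borel) J X)
    \<le> ennreal (1 / 4) + ennreal (exp \<kappa>) * emeasure (law f) (prod_emb {0..1} (\<lambda>_. borel) J X)"
proof -
  obtain n \<tau> where n: "0 < n" and \<tau>: "\<tau> 0 = 0" "\<And>i. i < n \<Longrightarrow> \<tau> i < \<tau> (Suc i)"
    "\<And>i. i \<le> n \<Longrightarrow> \<tau> i \<in> {0..1}" and cover: "J \<subseteq> \<tau> ` {..n}"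
    using sampling_times[OF J] by blast
  have "\<forall>t\<in>J. \<exists>k. k \<le> n \<and> \<tau> k = t" using cover by auto
  then obtain k where k: "\<And>t. t \<in> J \<Longrightarrow> k t \<le> n \<and> \<tau> (k t) = t" by metis
  \<comment> \<open>\<open>PiM_gauss_contiguous\<close> asks for a positive scale at every index;
    the value 1 beyond the range is a dummy.\<close>
  define s where "s i = (if i < n then \<epsilon> * sqrt (\<tau> (Suc i) - \<tau> i) else 1)" for i
  have s_eq: "s i = \<epsilon> * sqrt (\<tau> (Suc i) - \<tau> i)" if "i < n" for i using that by (simp add: s_def)
  have s_pos: "0 < s i" for i using eps_pos \<tau>(2)[of i] by (simp add: s_def)
  define D where "D h i = (LINT u:{0..\<tau> (Suc i)}|lborel. h u) - (LINT u:{0..\<tau> i}|lborel. h u)" for h :: "real \<Rightarrow> real" and i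
  define d where "d i = D g i - D f i" for i
  let ?F = "\<lambda>x. \<lambda>t\<in>J. \<Sum>i<k t. x i :: real"
  let ?S = "?F -` X \<inter> space (PiM {..<n} (\<lambda>_. borel))"
  have F: "?F \<in> measurable (PiM {..<n} (\<lambda>_. borel)) (PiM J (\<lambda>_. borel))"
    using k by (intro measurable_restrict borel_measurable_sum measurable_component_singleton) fastforce
  have S: "?S \<in> sets (PiM {..<n} (\<lambda>_. borel))" by (rule measurable_sets[OF F X])
  have cyl: "emeasure (law h) (prod_emb {0..1} (\<lambda>_. borel) J X) = emeasure (PiM {..<n} (\<lambda>i. gauss (D h i) (s i))) ?S" for h
    unfolding D_def using n \<tau> s_eq k J(2) X by (rule law_cylinder)
  have cost: "(\<Sum>i<n. (d i)\<^sup>2 / (s i)\<^sup>2) \<le> \<kappa>"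
  proof -
    have "(\<Sum>i<n. (d i)\<^sup>2 / (s i)\<^sup>2) = (\<Sum>i<n. (d i)\<^sup>2 / (\<epsilon> * sqrt (\<tau> (Suc i) - \<tau> i))\<^sup>2)"
      by (intro sum.cong refl) (simp add: s_eq)
    also have "\<dots> \<le> \<kappa>"
      using f g \<tau>(2,3) \<kappa> by (rule shift_cost) (simp_all add: d_def D_def)
    finally show ?thesis .
  qed
  have "emeasure (PiM {..<n} (\<lambda>i. gauss (D f i + d i) (s i))) ?S
      \<le> ennreal (1 / 4) + ennreal (exp \<kappa>) * emeasure (PiM {..<n} (\<lambda>i. gauss (D f i) (s i))) ?S"
    by (rule PiM_gauss_contiguous[OF finite_lessThan s_pos cost S])
  moreover have "D f i + d i = D g i" for i by (simp add: d_def)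
  ultimately show ?thesis unfolding cyl by (simp only:)
qed

lemma law_contiguous:
  assumes f: "f \<in> convex_class" and g: "g \<in> convex_class"
    and \<kappa>: "(LINT t:{0..1}|lborel. (g t - f t)\<^sup>2) \<le> \<kappa> * \<epsilon>\<^sup>2"
    and B: "B \<in> sets product_space"
  shows "measure (law g) B \<le> 1 / 4 + exp \<kappa> * measure (law f) B"
proof -
  interpret F: prob_space "law f" by (rule prob_space_law)
  interpret G: prob_space "law g" by (rule prob_space_law)
  have restr: "(\<lambda>w. restrict w J) \<in> measurable (law f) (PiM J (\<lambda>_. borel))" if "J \<subseteq> {0..1}" for J
    using measurable_restrict_subset[OF that, of "\<lambda>_. borel :: real measure"]
    by (simp add: law_def)
  \<comment> \<open>The projective family of marginals is formed for its algebra
    \<open>pf.generator\<close> of cylinder sets.\<close>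
  interpret pf: projective_family "{0..1::real}" "\<lambda>J. distr (law f) (PiM J (\<lambda>_. borel)) (\<lambda>w. restrict w J)"
    "\<lambda>_. borel :: real measure"
  proof (rule projective_family.intro)
    fix J H :: "real set" assume JH: "J \<subseteq> H" "finite H" "H \<subseteq> {0..1}"
    have "distr (distr (law f) (PiM H (\<lambda>_. borel)) (\<lambda>w. restrict w H)) (PiM J (\<lambda>_. borel)) (\<lambda>f. restrict f J)
        = distr (law f) (PiM J (\<lambda>_. borel)) ((\<lambda>f. restrict f J) \<circ> (\<lambda>w. restrict w H))"
      by (rule distr_distr[OF measurable_restrict_subset[OF JH(1)] restr[OF JH(3)]])
    also have "(\<lambda>f. restrict f J) \<circ> (\<lambda>w. restrict w H) = (\<lambda>w :: real \<Rightarrow> real. restrict w J)"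
      using JH(1) by (auto simp: fun_eq_iff restrict_def)
    finally show "distr (law f) (PiM J (\<lambda>_. borel)) (\<lambda>w. restrict w J)
        = distr (distr (law f) (PiM H (\<lambda>_. borel)) (\<lambda>w. restrict w H)) (PiM J (\<lambda>_. borel)) (\<lambda>f. restrict f J)"
      by (rule sym)
  next
    fix J :: "real set" assume "finite J" "J \<subseteq> {0..1}"
    then show "prob_space (distr (law f) (PiM J (\<lambda>_. borel)) (\<lambda>w. restrict w J))"
      by (intro F.prob_space_distr restr)
  qed
  show ?thesis
  proof (rule measure_bound_from_algebra[OF pf.algebra_generator])
    show "sets (law f) = sigma_sets (space product_space) pf.generator"
      unfolding sets_law by (rule pf.sets_PiM_generator)
    show "finite_measure (law f)" "finite_measure (law g)" by unfold_locales
    show "sets (law g) = sets (law f)" "B \<in> sets (law f)" using B by simp_all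
    fix C assume "C \<in> pf.generator"
    then obtain J X where C: "finite J" "J \<subseteq> {0..1}" "X \<in> sets (PiM J (\<lambda>_. borel))"
      "C = prod_emb {0..1} (\<lambda>_. borel) J X"
      by (auto elim: pf.generator.cases)
    have "ennreal (measure (law g) C) \<le> ennreal (1 / 4) + ennreal (exp \<kappa>) * ennreal (measure (law f) C)"
      using cylinder_contiguous[OF f g \<kappa> C(1-3)] C(4) by (simp add: F.emeasure_eq_measure G.emeasure_eq_measure)
    also have "\<dots> = ennreal (1 / 4 + exp \<kappa> * measure (law f) C)"
      by (subst ennreal_mult[symmetric], simp, simp, subst ennreal_plus[symmetric], simp, simp, rule refl)
    finally show "measure (law g) C \<le> 1 / 4 + exp \<kappa> * measure (law f) C"
      by (subst (asm) ennreal_le_iff) (simp_all add: add_nonneg_nonneg)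
  qed simp
qed

lemma white_noise_contiguous:
  assumes f: "f \<in> convex_class" and g: "g \<in> convex_class"
    and \<kappa>: "(LINT t:{0..1}|lborel. (g t - f t)\<^sup>2) \<le> \<kappa> * \<epsilon>\<^sup>2"
    and B: "B \<in> sets path_space"
  shows "measure (white_noise_law P \<epsilon> g) B \<le> 1 / 4 + exp \<kappa> * measure (white_noise_law P \<epsilon> f) B"
proof -
  obtain A where "A \<in> sets product_space" "B = {w. continuous_on {0..1} w} \<inter> A"
    using B unfolding path_space_def sets_restrict_space by blast
  then show ?thesis
    using law_contiguous[OF f g \<kappa>] white_noise_law_eq[OF f] white_noise_law_eq[OF g] by simp
qed

section \<open>The two-point lower bound\<close>

abbreviation randomized :: "(real \<Rightarrow> real) \<Rightarrow> ((real \<Rightarrow> real) \<times> real) measure" where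
  "randomized h \<equiv> white_noise_law P \<epsilon> h \<Otimes>\<^sub>M uniform_measure lborel {0..1}"

lemma prob_space_uniform: "prob_space (uniform_measure lborel {0..1::real})"
  by (rule prob_space_uniform_measure) simp_all

lemma sets_experiment: "sets (randomized h) = sets (path_space \<Otimes>\<^sub>M borel)"
  by (rule sets_pair_measure_cong) simp_all

text \<open>For each value of the auxiliary variable the bound holds on the section of
  \<open>A\<close>, and being affine with the same constants it survives integration over that
  variable.\<close>

lemma experiment_contiguous:
  assumes f: "f \<in> convex_class" and g: "g \<in> convex_class"
    and \<kappa>: "(LINT t:{0..1}|lborel. (g t - f t)\<^sup>2) \<le> \<kappa> * \<epsilon>\<^sup>2"
    and A: "A \<in> sets (path_space \<Otimes>\<^sub>M borel)"
  shows "emeasure (randomized g) A \<le> ennreal (1 / 4) + ennreal (exp \<kappa>) * emeasure (randomized f) A"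
proof -
  let ?U = "uniform_measure lborel {0..1::real}"
  interpret U: prob_space ?U by (rule prob_space_uniform)
  interpret F: prob_space "white_noise_law P \<epsilon> f" by (rule prob_space_white_noise_law[OF f])
  interpret G: prob_space "white_noise_law P \<epsilon> g" by (rule prob_space_white_noise_law[OF g])
  interpret FU: pair_prob_space "white_noise_law P \<epsilon> f" ?U ..
  interpret GU: pair_prob_space "white_noise_law P \<epsilon> g" ?U ..
  have AF: "A \<in> sets (randomized f)" and AG: "A \<in> sets (randomized g)"
    using A sets_experiment by simp_all
  let ?sec = "\<lambda>y. (\<lambda>x. (x, y)) -` A"
  have sect: "?sec y \<in> sets path_space" for y
    using sets_Pair2[OF AF, of y] by simp
  have le: "emeasure (white_noise_law P \<epsilon> g) (?sec y)
      \<le> ennreal (1 / 4) + ennreal (exp \<kappa>) * emeasure (white_noise_law P \<epsilon> f) (?sec y)" for y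
  proof -
    have "ennreal (measure (white_noise_law P \<epsilon> g) (?sec y))
        \<le> ennreal (1 / 4 + exp \<kappa> * measure (white_noise_law P \<epsilon> f) (?sec y))"
      by (intro ennreal_leI white_noise_contiguous[OF f g \<kappa>] sect)
    also have "\<dots> = ennreal (1 / 4) + ennreal (exp \<kappa>) * ennreal (measure (white_noise_law P \<epsilon> f) (?sec y))"
      by (subst ennreal_mult[symmetric], simp, simp, subst ennreal_plus[symmetric], simp, simp, rule refl)
    finally show ?thesis by (simp only: F.emeasure_eq_measure G.emeasure_eq_measure)
  qed
  have m: "(\<lambda>y. emeasure (white_noise_law P \<epsilon> f) (?sec y)) \<in> borel_measurable ?U"
    by (rule FU.measurable_emeasure_Pair2[OF AF])
  have "emeasure (randomized g) A = (\<integral>\<^sup>+ y. emeasure (white_noise_law P \<epsilon> g) (?sec y) \<partial>?U)"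
    by (rule GU.emeasure_pair_measure_alt2[OF AG])
  also have "\<dots> \<le> (\<integral>\<^sup>+ y. ennreal (1 / 4) + ennreal (exp \<kappa>) * emeasure (white_noise_law P \<epsilon> f) (?sec y) \<partial>?U)"
    by (intro nn_integral_mono le)
  also have "\<dots> = (\<integral>\<^sup>+ y. ennreal (1 / 4) \<partial>?U)
      + (\<integral>\<^sup>+ y. ennreal (exp \<kappa>) * emeasure (white_noise_law P \<epsilon> f) (?sec y) \<partial>?U)"
    by (intro nn_integral_add borel_measurable_times_ennreal m) simp_all
  also have "(\<integral>\<^sup>+ y. ennreal (1 / 4) \<partial>?U) = ennreal (1 / 4)"
    using U.emeasure_space_1 by simp
  also have "(\<integral>\<^sup>+ y. ennreal (exp \<kappa>) * emeasure (white_noise_law P \<epsilon> f) (?sec y) \<partial>?U)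
      = ennreal (exp \<kappa>) * (\<integral>\<^sup>+ y. emeasure (white_noise_law P \<epsilon> f) (?sec y) \<partial>?U)"
    by (rule nn_integral_cmult[OF m])
  also have "(\<integral>\<^sup>+ y. emeasure (white_noise_law P \<epsilon> f) (?sec y) \<partial>?U) = emeasure (randomized f) A"
    by (rule FU.emeasure_pair_measure_alt2[OF AF, symmetric])
  finally show ?thesis .
qed

lemma risk_ge:
  assumes "{x \<in> space (randomized h). r \<le> \<bar>\<delta> x - minimizer h\<bar>} \<in> sets (randomized h)"
  shows "ennreal r * emeasure (randomized h) {x \<in> space (randomized h). r \<le> \<bar>\<delta> x - minimizer h\<bar>} \<le> risk P \<epsilon> \<delta> h"
proof -
  let ?A = "{x \<in> space (randomized h). r \<le> \<bar>\<delta> x - minimizer h\<bar>}"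
  have "ennreal r * emeasure (randomized h) ?A = (\<integral>\<^sup>+ x. ennreal r * indicator ?A x \<partial>randomized h)"
    by (rule nn_integral_cmult_indicator[OF assms, symmetric])
  also have "\<dots> \<le> risk P \<epsilon> \<delta> h"
    unfolding risk_def
  proof (rule nn_integral_mono)
    fix x
    show "ennreal r * indicator ?A x \<le> ennreal \<bar>\<delta> x - minimizer h\<bar>"
      by (cases "x \<in> ?A") (simp_all add: ennreal_leI)
  qed
  finally show ?thesis .
qed

text \<open>An estimate closer than \<open>r\<close> to one minimizer is at least \<open>r\<close>
  away from the other. If the error event of \<open>f\<close> is unlikely under \<open>f\<close>,
  contiguity keeps its probability under \<open>g\<close> not much above 1/4, and its complement
  lies in the error event of \<open>g\<close>.\<close>

lemma two_point:
  assumes f: "f \<in> convex_class" and g: "g \<in> convex_class"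
    and \<kappa>: "(LINT t:{0..1}|lborel. (g t - f t)\<^sup>2) \<le> \<kappa> * \<epsilon>\<^sup>2"
    and r: "0 \<le> r" "2 * r \<le> \<bar>minimizer g - minimizer f\<bar>" and \<delta>: "\<delta> \<in> estimators"
  shows "ennreal (r * (3 / 4 / (1 + exp \<kappa>))) \<le> max (risk P \<epsilon> \<delta> f) (risk P \<epsilon> \<delta> g)"
proof -
  interpret U: prob_space "uniform_measure lborel {0..1::real}" by (rule prob_space_uniform)
  interpret F: prob_space "white_noise_law P \<epsilon> f" by (rule prob_space_white_noise_law[OF f])
  interpret G: prob_space "white_noise_law P \<epsilon> g" by (rule prob_space_white_noise_law[OF g])
  interpret FU: pair_prob_space "white_noise_law P \<epsilon> f" "uniform_measure lborel {0..1::real}" ..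
  interpret GU: pair_prob_space "white_noise_law P \<epsilon> g" "uniform_measure lborel {0..1::real}" ..
  let ?S = "space (path_space \<Otimes>\<^sub>M borel)"
  have sp: "space (randomized h) = ?S" for h by (rule sets_eq_imp_space_eq[OF sets_experiment])
  have [measurable]: "\<delta> \<in> borel_measurable (path_space \<Otimes>\<^sub>M borel)"
    using \<delta> by (simp add: estimators_def)
  have ev: "{x \<in> ?S. r \<le> \<bar>\<delta> x - c\<bar>} \<in> sets (path_space \<Otimes>\<^sub>M borel)" for c by measurable
  define A where "A = {x \<in> ?S. r \<le> \<bar>\<delta> x - minimizer f\<bar>}"
  define A' where "A' = {x \<in> ?S. r \<le> \<bar>\<delta> x - minimizer g\<bar>}"
  have AF: "A \<in> sets (randomized f)" and AG: "A \<in> sets (randomized g)" and A'G: "A' \<in> sets (randomized g)"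
    unfolding sets_experiment A_def A'_def by (rule ev)+
  define p where "p = measure (randomized f) A"
  define q where "q = measure (randomized g) A"
  \<comment> \<open>The solution of \<open>c = 1 - (1 / 4 + exp \<kappa> * c)\<close>, where both
    alternatives give the same bound.\<close>
  define c where "c = 3 / 4 / (1 + exp \<kappa>)"
  have ep: "0 < 1 + exp \<kappa>" by (simp add: add_pos_pos)
  have cc: "c + exp \<kappa> * c = 3 / 4"
  proof -
    have "3 / 4 / y * y = 3 / 4" if "0 < y" for y :: real using that by simp
    from this[OF ep] have "c * (1 + exp \<kappa>) = 3 / 4" unfolding c_def .
    then show ?thesis by (simp add: algebra_simps)
  qed
  have "ennreal q \<le> ennreal (1 / 4) + ennreal (exp \<kappa>) * ennreal p"
    using experiment_contiguous[OF f g \<kappa> ev, of "minimizer f"]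
    unfolding A_def[symmetric] p_def q_def FU.emeasure_eq_measure GU.emeasure_eq_measure .
  also have "\<dots> = ennreal (1 / 4 + exp \<kappa> * p)"
    unfolding p_def by (subst ennreal_mult[symmetric], simp, simp, subst ennreal_plus[symmetric], simp, simp, rule refl)
  finally have q: "q \<le> 1 / 4 + exp \<kappa> * p"
    by (subst (asm) ennreal_le_iff) (simp_all add: add_nonneg_nonneg p_def)
  have rf: "ennreal (r * p) \<le> risk P \<epsilon> \<delta> f"
    using risk_ge[of f r \<delta>] AF r(1) unfolding sp A_def[symmetric]
    by (simp add: FU.emeasure_eq_measure p_def ennreal_mult)
  have rg: "ennreal (r * (1 - q)) \<le> risk P \<epsilon> \<delta> g"
  proof -
    have "?S - A \<subseteq> A'" using r(2) by (auto simp: A_def A'_def)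
    then have "measure (randomized g) (?S - A) \<le> measure (randomized g) A'"
      using A'G by (rule GU.finite_measure_mono)
    moreover have "measure (randomized g) (?S - A) = 1 - q"
      using GU.prob_compl[OF AG] unfolding sp q_def .
    ultimately have "r * (1 - q) \<le> r * measure (randomized g) A'" using r(1) by (intro mult_left_mono) auto
    then have "ennreal (r * (1 - q)) \<le> ennreal (r * measure (randomized g) A')" by (rule ennreal_leI)
    also have "\<dots> \<le> risk P \<epsilon> \<delta> g"
      using risk_ge[of g r \<delta>] A'G r(1) unfolding sp A'_def[symmetric]
      by (simp add: GU.emeasure_eq_measure ennreal_mult)
    finally show ?thesis .
  qed
  show ?thesis
  proof (cases "c \<le> p")
    case True
    then have "ennreal (r * c) \<le> ennreal (r * p)" using r(1) by (intro ennreal_leI mult_left_mono)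
    from order_trans[OF order_trans[OF this rf] max.cobounded1] show ?thesis unfolding c_def .
  next
    case False
    then have "exp \<kappa> * p \<le> exp \<kappa> * c" by (intro mult_left_mono) auto
    then have "c \<le> 1 - q" using q cc by linarith
    then have "ennreal (r * c) \<le> ennreal (r * (1 - q))" using r(1) by (intro ennreal_leI mult_left_mono)
    from order_trans[OF order_trans[OF this rg] max.cobounded2] show ?thesis unfolding c_def .
  qed
qed

end

lemma (in convex_fn_eps) benchmark_ge:
  assumes "wiener_measure P"
  shows "ennreal (\<rho> / 4 * (3 / 4 / (1 + exp 4000))) \<le> benchmark_z P \<epsilon> f"
proof -
  interpret wiener P \<epsilon> using assms eps by unfold_locales
  obtain g where g: "g \<in> convex_class" "\<rho> / 2 \<le> \<bar>minimizer g - Z\<bar>"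
    "(LINT t:{0..1}|lborel. (g t - f t)\<^sup>2) \<le> 4000 * \<epsilon>\<^sup>2"
    by (rule competitor)
  \<comment> \<open>The factor \<open>\<rho> / 4\<close> is half the guaranteed separation
    \<open>\<rho> / 2\<close> of the minimizers.\<close>
  have "ennreal (\<rho> / 4 * (3 / 4 / (1 + exp 4000))) \<le> (INF \<delta>\<in>estimators. max (risk P \<epsilon> \<delta> f) (risk P \<epsilon> \<delta> g))"
    using g(2) rho_z_nonneg by (intro INF_greatest two_point[OF in_class g(1,3)]) auto
  also have "\<dots> \<le> benchmark_z P \<epsilon> f"
    unfolding benchmark_z_def by (rule SUP_upper[OF g(1)])
  finally show ?thesis .
qed

theorem theorem3p1:
  shows "\<exists>C_z::real. C_z > 0 \<and> (\<forall>\<epsilon>::real. \<epsilon> > 0 \<longrightarrow> (\<forall>f\<in>convex_class.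
    (\<forall>(\<Omega>::'w measure) W B1 B2. independent_brownian_motions \<Omega> W B1 B2 \<longrightarrow>
       (\<integral>\<^sup>+ \<omega>. ennreal \<bar>minimizer_estimator \<epsilon> (white_noise \<epsilon> f (\<lambda>t. W t \<omega>))
                        (\<lambda>t. B1 t \<omega>) (\<lambda>t. B2 t \<omega>) - minimizer f\<bar> \<partial>\<Omega>)
         < ennreal (53 * rho_z \<epsilon> f)) \<and>
    (\<forall>P. wiener_measure P \<longrightarrow>
       ennreal (53 * rho_z \<epsilon> f) \<le> ennreal C_z * benchmark_z P \<epsilon> f)))"
proof -
  define c :: real where "c = 3 / 4 / (1 + exp 4000)"
  have c: "0 < c" by (simp add: c_def add_pos_pos)
  have upper: "(\<integral>\<^sup>+ \<omega>. ennreal \<bar>minimizer_estimator \<epsilon> (white_noise \<epsilon> f (\<lambda>t. W t \<omega>))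
      (\<lambda>t. B1 t \<omega>) (\<lambda>t. B2 t \<omega>) - minimizer f\<bar> \<partial>\<Omega>) < ennreal (53 * rho_z \<epsilon> f)"
    if "0 < \<epsilon>" "f \<in> convex_class" and ibm: "independent_brownian_motions \<Omega> W B1 B2"
    for \<epsilon> f and \<Omega> :: "'w measure" and W B1 B2
  proof -
    have "prob_space \<Omega>"
      using ibm unfolding independent_brownian_motions_def standard_brownian_motion_def by blast
    then interpret estimation f \<epsilon> \<Omega> W B1 B2
      by (intro estimation.intro convex_fn_eps.intro convex_fn.intro convex_fn_eps_axioms.intro
          white_noise_copies.intro white_noise_copies_axioms.intro that)
    show ?thesis by (rule estimator_risk)
  qed
  have lower: "ennreal (53 * rho_z \<epsilon> f) \<le> ennreal (212 / c) * benchmark_z P \<epsilon> f"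
    if "0 < \<epsilon>" "f \<in> convex_class" and P: "wiener_measure P" for \<epsilon> f P
  proof -
    interpret convex_fn_eps f \<epsilon> using that by unfold_locales
    \<comment> \<open>The constant is 212 = 53 * 4, with the 4 from \<open>\<rho> / 4\<close> in
      \<open>benchmark_ge\<close>.\<close>
    have "ennreal (53 * \<rho>) = ennreal (212 / c * (\<rho> / 4 * c))" using c by simp
    also have "\<dots> = ennreal (212 / c) * ennreal (\<rho> / 4 * c)"
      using c rho_z_nonneg by (intro ennreal_mult) auto
    also have "\<dots> \<le> ennreal (212 / c) * benchmark_z P \<epsilon> f"
      using benchmark_ge[OF P] unfolding c_def by (rule mult_left_mono) simp
    finally show ?thesis .
  qed
  show ?thesis
    using c upper lower by (intro exI[of _ "212 / c"]) simp
qed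

end
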